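(* Consider a 3-S 3-D MUN-D with time-varying LECs (as in the context), $n>d_{max}$, positive integers $n\ge n_1\ge n_2\ge n_3$, in which the min-cut between $S_2$ and $T_1$ is $0$ (so $M_{21}=0$) and the min-cut between $S_i$ and $T_j$ is at least $1$ for every other pair $(i,j)$. Let $V_1=[\theta_{ab}]$ ($n\times n_1$), $A$ ($n_1\times n_2$), $B$ ($n_1\times n_3$) have indeterminate entries and $V_2=M_{23}^{-1}M_{13}V_1A$, $V_3=M_{32}^{-1}M_{12}V_1B$. If, over the field of rational functions in the LECs and these indeterminates, $$\mathrm{Rank}[V_1\ \ M_{11}^{-1}M_{31}V_3]=n_1+n_3,\quad \mathrm{Rank}[M_{12}^{-1}M_{22}V_2\ \ V_1]=n_1+n_2,\quad \mathrm{Rank}[M_{13}^{-1}M_{33}V_3\ \ V_1]=n_1+n_3,$$ then there is an assignment of values (from a sufficiently large finite field of characteristic $p$) to the LECs and indeterminates such that in the system $Y_j=\sum_{i=1}^3M_{ij}V_iX_i'$ ($X_i'$ of length $n_i$) each $X_j'$ can be exactly recovered from $Y_j$ ($j=1,2,3$). These conditions are also necessary when $n_1+n_2=n_1+n_3=n$.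
   Context: A 3-S 3-D MUN-D: finite directed acyclic graph, links carrying one symbol of a field of characteristic $p$ per time unit with unit delay, sources $S_1,S_2,S_3$ (one process each), destinations $T_1,T_2,T_3$ ($T_i$ demands $S_i$'s process), min-cut between $S_i$ and $T_i$ equal to $1$. Time-varying LECs: $\underline{\varepsilon}^{(t)}$ is the LEC vector at time $t$; $Y_j^{(t)}=\sum_{i}\sum_{d=0}^{d_{max}}M_{ij}^{(d)}(\underline{\varepsilon}^{(t-d,t)})X_i^{(t-d)}$, where $M_{ij}^{(d)}(\underline{\varepsilon}^{(t-d,t)})$ is the response at $T_j$ at time $t$ to a unit symbol from $S_i$ at time $t-d$, a polynomial in the LECs of times $t-d,\dots,t$. Each source sends $n$ generations preceded by a cyclic prefix of its last $d_{max}$ generations starting at time $-d_{max}$. $M_{ij}$ is the $n\times n$ matrix (rows/columns indexed $0,\dots,n-1$) with entry $M_{ij}^{(d)}(\underline{\varepsilon}^{(n-1-r-d,\,n-1-r)})$ in row $r$, column $(r+d)\bmod n$ for $0\le d\le d_{max}$, zero elsewhere. The source block is $X_i^n=V_iX_i'$; exact recovery of $X_j'$ from $Y_j$ means existence of a matrix $G_j$ with $G_jY_j=X_j'$ for all inputs. *)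

theory Defs
  imports
    "HOL-Library.Poly_Mapping"
    "HOL-Library.Product_Lexorder"
    "HOL-Computational_Algebra.Fraction_Field"
    "HOL-Algebra.Algebraic_Closure_Type"
    "Berlekamp_Zassenhaus.Finite_Field"
    "Jordan_Normal_Form.DL_Rank"
    "Jordan_Normal_Form.Gauss_Jordan_Elimination"
begin

text \<open>A network: finite set of edges (edges are named by natural numbers, parallel
edges allowed), tail/head of each edge, sources src 1, src 2, src 3 and
destinations dst 1, dst 2, dst 3.  Every edge carries one symbol per time unit
with unit delay.\<close>

record 'v net =
  edges :: "nat set"
  tailv :: "nat \<Rightarrow> 'v"
  headv :: "nat \<Rightarrow> 'v"
  src   :: "nat \<Rightarrow> 'v"
  dst   :: "nat \<Rightarrow> 'v"

definition is_path :: "'v net \<Rightarrow> 'v \<Rightarrow> 'v \<Rightarrow> nat list \<Rightarrow> bool" where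
  "is_path N u v es \<longleftrightarrow> es \<noteq> [] \<and> set es \<subseteq> edges N \<and>
     tailv N (hd es) = u \<and> headv N (last es) = v \<and>
     (\<forall>k. Suc k < length es \<longrightarrow> headv N (es ! k) = tailv N (es ! Suc k))"

definition finite_dag :: "'v net \<Rightarrow> bool" where
  "finite_dag N \<longleftrightarrow> finite (edges N) \<and> (\<forall>v es. \<not> is_path N v v es)"

definition mincut :: "'v net \<Rightarrow> 'v \<Rightarrow> 'v \<Rightarrow> nat" where
  "mincut N u v = (LEAST k. \<exists>C \<subseteq> edges N. card C = k \<and>
                     (\<forall>es. is_path N u v es \<longrightarrow> set es \<inter> C \<noteq> {}))"

definition dmax :: "'v net \<Rightarrow> nat" where
  "dmax N = Max ({length es | es i j. i \<in> {1,2,3} \<and> j \<in> {1,2,3} \<and>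
                     is_path N (src N i) (dst N j) es} \<union> {0})"

text \<open>Variables: time-varying LECs (tagged 0,1,2, with an integer time index) and the
entries of V1 (tag 3), A (tag 4), B (tag 5).\<close>
type_synonym var = "nat \<times> nat \<times> nat \<times> int"

definition lec_src :: "nat \<Rightarrow> nat \<Rightarrow> int \<Rightarrow> var" where
  "lec_src i e t = (0, i, e, t)"   \<comment> \<open>source S_i onto its outgoing edge e at time t\<close>
definition lec_mid :: "nat \<Rightarrow> nat \<Rightarrow> int \<Rightarrow> var" where
  "lec_mid e e' t = (1, e, e', t)" \<comment> \<open>incoming edge e onto outgoing edge e' at time t\<close>
definition lec_snk :: "nat \<Rightarrow> nat \<Rightarrow> int \<Rightarrow> var" where
  "lec_snk e j t = (2, e, j, t)"   \<comment> \<open>incoming edge e at destination T_j at time t\<close>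
definition theta_var :: "nat \<Rightarrow> nat \<Rightarrow> var" where "theta_var a b = (3, a, b, 0)"
definition a_var :: "nat \<Rightarrow> nat \<Rightarrow> var" where "a_var a b = (4, a, b, 0)"
definition b_var :: "nat \<Rightarrow> nat \<Rightarrow> var" where "b_var a b = (5, a, b, 0)"

text \<open>Gain at time t along a path es from S_i to T_j (the symbol left S_i at time
t - length es; each hop has unit delay).\<close>
definition path_gain :: "(var \<Rightarrow> 'r::comm_ring_1) \<Rightarrow> nat \<Rightarrow> nat \<Rightarrow> nat list \<Rightarrow> int \<Rightarrow> 'r" where
  "path_gain x i j es t =
     x (lec_src i (hd es) (t - int (length es))) *
     (\<Prod>m < length es - 1. x (lec_mid (es ! m) (es ! Suc m) (t - int (length es) + 1 + int m))) *
     x (lec_snk (last es) j t)"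

text \<open>M_ij^(d) at time t: response at T_j at time t to a unit symbol of S_i at time t-d.\<close>
definition Mresp :: "'v net \<Rightarrow> (var \<Rightarrow> 'r::comm_ring_1) \<Rightarrow> nat \<Rightarrow> nat \<Rightarrow> nat \<Rightarrow> int \<Rightarrow> 'r" where
  "Mresp N x i j d t =
     (\<Sum>es \<in> {es. is_path N (src N i) (dst N j) es \<and> length es = d}. path_gain x i j es t)"

definition Mmat :: "'v net \<Rightarrow> (var \<Rightarrow> 'r::comm_ring_1) \<Rightarrow> nat \<Rightarrow> nat \<Rightarrow> nat \<Rightarrow> 'r mat" where
  "Mmat N x n i j = mat n n (\<lambda>(r, c).
     \<Sum>d \<in> {0..dmax N}. if (r + d) mod n = c then Mresp N x i j d (int n - 1 - int r) else 0)"

definition minv :: "'a::field mat \<Rightarrow> 'a mat" where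
  "minv A = the (mat_inverse A)"

definition hcat :: "'a::zero mat \<Rightarrow> 'a mat \<Rightarrow> 'a mat" where
  "hcat A B = mat (dim_row A) (dim_col A + dim_col B)
     (\<lambda>(r, c). if c < dim_col A then A $$ (r, c) else B $$ (r, c - dim_col A))"

definition V1mat :: "(var \<Rightarrow> 'r) \<Rightarrow> nat \<Rightarrow> nat \<Rightarrow> 'r mat" where
  "V1mat x n n1 = mat n n1 (\<lambda>(a, b). x (theta_var a b))"
definition Amat :: "(var \<Rightarrow> 'r) \<Rightarrow> nat \<Rightarrow> nat \<Rightarrow> 'r mat" where
  "Amat x n1 n2 = mat n1 n2 (\<lambda>(a, b). x (a_var a b))"
definition Bmat :: "(var \<Rightarrow> 'r) \<Rightarrow> nat \<Rightarrow> nat \<Rightarrow> 'r mat" where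
  "Bmat x n1 n3 = mat n1 n3 (\<lambda>(a, b). x (b_var a b))"

definition Vmat :: "'v net \<Rightarrow> (var \<Rightarrow> 'r::field) \<Rightarrow> nat \<Rightarrow> nat \<Rightarrow> nat \<Rightarrow> nat \<Rightarrow> nat \<Rightarrow> 'r mat" where
  "Vmat N x n n1 n2 n3 i =
     (if i = 1 then V1mat x n n1
      else if i = 2 then minv (Mmat N x n 2 3) * Mmat N x n 1 3 * V1mat x n n1 * Amat x n1 n2
      else minv (Mmat N x n 3 2) * Mmat N x n 1 2 * V1mat x n n1 * Bmat x n1 n3)"

type_synonym 'p ratfun = "((var \<Rightarrow>\<^sub>0 nat) \<Rightarrow>\<^sub>0 'p mod_ring) fract"

definition indet :: "var \<Rightarrow> 'p::prime_card ratfun" where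
  "indet v = Fract (Poly_Mapping.single (Poly_Mapping.single v 1) 1) 1"

definition rank_conditions :: "'p::prime_card itself \<Rightarrow> 'v net \<Rightarrow> nat \<Rightarrow> nat \<Rightarrow> nat \<Rightarrow> nat \<Rightarrow> bool" where
  "rank_conditions _ N n n1 n2 n3 \<longleftrightarrow>
    (let x = (indet :: var \<Rightarrow> 'p ratfun); M = Mmat N x n; V = Vmat N x n n1 n2 n3 in
      vec_space.rank n (hcat (V 1) (minv (M 1 1) * M 3 1 * V 3)) = n1 + n3 \<and>
      vec_space.rank n (hcat (minv (M 1 2) * M 2 2 * V 2) (V 1)) = n1 + n2 \<and>
      vec_space.rank n (hcat (minv (M 1 3) * M 3 3 * V 3) (V 1)) = n1 + n3)"

definition ndim :: "nat \<Rightarrow> nat \<Rightarrow> nat \<Rightarrow> nat \<Rightarrow> nat" where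
  "ndim n1 n2 n3 i = (if i = 1 then n1 else if i = 2 then n2 else n3)"

definition recoverable ::
  "'v net \<Rightarrow> (var \<Rightarrow> 'r::field) \<Rightarrow> nat \<Rightarrow> nat \<Rightarrow> nat \<Rightarrow> nat \<Rightarrow> nat \<Rightarrow> bool" where
  "recoverable N x n n1 n2 n3 j \<longleftrightarrow>
    (\<exists>G \<in> carrier_mat (ndim n1 n2 n3 j) n.
      \<forall>X1 \<in> carrier_vec n1. \<forall>X2 \<in> carrier_vec n2. \<forall>X3 \<in> carrier_vec n3.
        (let V = Vmat N x n n1 n2 n3; M = Mmat N x n;
             Y = (M 1 j * V 1) *\<^sub>v X1 + (M 2 j * V 2) *\<^sub>v X2 + (M 3 j * V 3) *\<^sub>v X3
         in G *\<^sub>v Y = (if j = 1 then X1 else if j = 2 then X2 else X3)))"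

text \<open>An assignment alpha of values to all LECs and indeterminates, in the algebraic
closure of F_p (so all finitely many relevant values lie in a finite field of
characteristic p), for which the precoders are defined and every destination
recovers its message.\<close>
definition good_assignment ::
  "'v net \<Rightarrow> (var \<Rightarrow> 'p::prime_card mod_ring alg_closure) \<Rightarrow> nat \<Rightarrow> nat \<Rightarrow> nat \<Rightarrow> nat \<Rightarrow> bool" where
  "good_assignment N \<alpha> n n1 n2 n3 \<longleftrightarrow>
     invertible_mat (Mmat N \<alpha> n 2 3) \<and> invertible_mat (Mmat N \<alpha> n 3 2) \<and>
     (\<forall>j \<in> {1,2,3}. recoverable N \<alpha> n n1 n2 n3 j)"

end

theory Submission
  imports Defs "HOL-Library.Function_Algebras"
begin

text \<open>Full column rank over the rational functions gives a left inverse; away from the zeros of its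
common denominator it specializes to decoders, and the alignment conditions M_32 V_3 = M_12 V_1 B and
M_23 V_2 = M_13 V_1 A merge the interference into the column space of a single block.

For the converse, a good assignment may annihilate interference, so a violated rank condition cannot
simply be specialized. A condition that fails generically says det [P V, Q V C] = 0 for all V and C,
where P = M_1b and Q = M_ab M_ab'^-1 M_1b'. With C of k columns and n = n1 + k this forces
rank (Q - c P) < k for a unique scalar c. Changing one LEC perturbs the four transfer matrices by
rank one, with row and column factors shared along sources and destinations; counting
dimensions shows that c does not move. Hence c is a nonzero constant, the rank bound holds at every
point, and at a good assignment it contradicts decodability.\<close>

text \<open>A good assignment makes only M_23 and M_32 invertible, so it may lie outside the open
  set on which c is defined. Everything is therefore kept polynomial: inverses become adjugates, and
  the rank bound is stated as the vanishing of all determinants of products R Z C of size k, a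
  closed condition that extends from a dense open set to every point. The delicate step is the
  constancy of c. The kernels to be compared have codimension at most k - 1, and 2 k <= n. A source
  or sink LEC costs one further linear condition; 2 (k - 1) + 1 < n leaves a common nonzero vector,
  which forces equal scalars. An LEC between two edges acts on the signals of both sources and costs
  two conditions, one too many when n = 2 k. Three points on a line are compared instead, and
  infinitude of the field turns "at most two values on the line" into one. At T_2 and T_3 the
  decoder kills the signal of S_1, and the minor is nonzero for any c. At T_1 the decoder kills the
  other block and only a multiple of c survives, so c must be nonzero; moreover the decoder of T_3
  is borrowed to show that B has a left inverse.\<close>

no_notation fps_nth (infixl "$" 75)

section \<open>Linear algebra: operators for which no k vectors are independent together with their
  images\<close>

locale linear_pairs = vector_space scale
  for scale :: "'a::field \<Rightarrow> 'b::ab_group_add \<Rightarrow> 'b"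
begin

definition pair_comb :: "('b \<Rightarrow> 'b) \<Rightarrow> (nat \<Rightarrow> 'b) \<Rightarrow> nat \<Rightarrow> (nat \<Rightarrow> 'a) \<Rightarrow> (nat \<Rightarrow> 'a) \<Rightarrow> 'b" where
  "pair_comb U v j p q = (\<Sum>i<j. scale (p i) (v i)) + (\<Sum>i<j. scale (q i) (U (v i)))"

text \<open>Independence of the indexed family of all \<open>v i\<close> and \<open>U (v i)\<close>.
  Coefficients are used rather than a set of vectors, so that a repeated vector counts as a
  dependence.\<close>

definition pair_indep :: "('b \<Rightarrow> 'b) \<Rightarrow> (nat \<Rightarrow> 'b) \<Rightarrow> nat \<Rightarrow> bool" where
  "pair_indep U v j \<longleftrightarrow> (\<forall>p q. pair_comb U v j p q = 0 \<longrightarrow> (\<forall>i<j. p i = 0 \<and> q i = 0))"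

definition pair_span :: "('b \<Rightarrow> 'b) \<Rightarrow> (nat \<Rightarrow> 'b) \<Rightarrow> nat \<Rightarrow> 'b set" where
  "pair_span U v j = {pair_comb U v j p q | p q. True}"

lemma pair_comb_in_pair_span: "pair_comb U v j p q \<in> pair_span U v j"
  unfolding pair_span_def by blast

lemma pair_spanE:
  assumes "x \<in> pair_span U v j"
  obtains p q where "x = pair_comb U v j p q"
  using assms unfolding pair_span_def by blast

lemma pair_comb_add:
  "pair_comb U v j p q + pair_comb U v j p' q' = pair_comb U v j (\<lambda>i. p i + p' i) (\<lambda>i. q i + q' i)"
  by (simp add: pair_comb_def scale_left_distrib sum.distrib algebra_simps)

lemma pair_comb_scale:
  "scale a (pair_comb U v j p q) = pair_comb U v j (\<lambda>i. a * p i) (\<lambda>i. a * q i)"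
  by (simp add: pair_comb_def scale_right_distrib scale_sum_right)

lemma pair_comb_diff:
  "pair_comb U v j p q - pair_comb U v j p' q' = pair_comb U v j (\<lambda>i. p i - p' i) (\<lambda>i. q i - q' i)"
  by (simp add: pair_comb_def scale_left_diff_distrib sum_subtractf algebra_simps)

lemma pair_comb_Suc:
  "pair_comb U (v(j := x)) (Suc j) p q = pair_comb U v j p q + scale (p j) x + scale (q j) (U x)"
  by (simp add: pair_comb_def algebra_simps)

lemma pair_span_subspace: "subspace (pair_span U v j)"
proof (rule subspaceI)
  have "pair_comb U v j (\<lambda>_. 0) (\<lambda>_. 0) = 0" by (simp add: pair_comb_def)
  then show "0 \<in> pair_span U v j" by (metis pair_comb_in_pair_span)
  show "x + y \<in> pair_span U v j" if "x \<in> pair_span U v j" "y \<in> pair_span U v j" for x y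
    using that pair_comb_add pair_comb_in_pair_span unfolding pair_span_def by (smt (verit) mem_Collect_eq)
  show "scale c x \<in> pair_span U v j" if "x \<in> pair_span U v j" for c x
    using that pair_comb_scale pair_comb_in_pair_span unfolding pair_span_def by (smt (verit) mem_Collect_eq)
qed

text \<open>The \<open>2 * j\<close> spanning vectors together with \<open>x\<close> span too small
  a dimension to contain \<open>span B\<close>. The spare dimension for \<open>x\<close> is what
  later yields two vectors that are independent modulo the pair span.\<close>

lemma outside_pair_span:
  assumes "finite B" "independent B" "2 * j + 1 < card B"
  shows "\<exists>e\<in>span B. \<forall>a. e - scale a x \<notin> pair_span U v j"
proof (rule ccontr)
  let ?T = "insert x (v ` {..<j} \<union> (\<lambda>i. U (v i)) ` {..<j})"
  assume "\<not> ?thesis"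
  then have *: "\<exists>a. e - scale a x \<in> pair_span U v j" if "e \<in> span B" for e
    using that by blast
  have sub: "pair_span U v j \<subseteq> span ?T"
    unfolding pair_span_def pair_comb_def
    by (auto intro!: span_add[OF span_sum span_sum] span_scale intro: span_base)
  have "B \<subseteq> span ?T"
  proof
    fix e assume "e \<in> B"
    then obtain a where "e - scale a x \<in> pair_span U v j" using * span_base by blast
    then have "(e - scale a x) + scale a x \<in> span ?T"
      using sub span_base[of x ?T] by (intro span_add span_scale) auto
    then show "e \<in> span ?T" by simp
  qed
  then have "card B \<le> card ?T"
    using independent_span_bound[of ?T B] assms(2) by auto
  also have "\<dots> \<le> Suc (card (v ` {..<j} \<union> (\<lambda>i. U (v i)) ` {..<j}))"
    by (rule card_insert_le_m1) simp_all
  also have "\<dots> \<le> Suc (card (v ` {..<j}) + card ((\<lambda>i. U (v i)) ` {..<j}))"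
    using card_Un_le by simp
  also have "\<dots> \<le> Suc (j + j)"
    using card_image_le[of "{..<j}" v] card_image_le[of "{..<j}" "\<lambda>i. U (v i)"] by simp
  finally show False using assms(3) by simp
qed

text \<open>The classical argument that a map with only eigenvectors is a scalar, carried out modulo
  W, the pair span of \<open>v\<close>. Maximality of \<open>v\<close> makes every \<open>x\<close>
  outside W an eigenvector modulo W; the eigenvalues of two vectors independent modulo W are
  compared through their sum.\<close>

lemma scalar_modulo_pair_span:
  assumes B: "finite B" "independent B" "2 * j + 1 < card B"
    and Uadd: "\<And>x y. U (x + y) = U x + U y"
    and ind: "pair_indep U v j"
    and maxi: "\<And>x. x \<in> span B \<Longrightarrow> \<not> pair_indep U (v(j := x)) (Suc j)"
  shows "\<exists>c. \<forall>x\<in>span B. U x - scale c x \<in> pair_span U v j"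
proof -
  let ?W = "pair_span U v j"
  note W = pair_span_subspace[of U v j]
  note Wadd = subspace_add[OF W] and Wdiff = subspace_diff[OF W] and Wscale = subspace_scale[OF W]
  have loc: "\<exists>c. U x - scale c x \<in> ?W" if x: "x \<in> span B" "x \<notin> ?W" for x
  proof -
    obtain p q where pq: "pair_comb U v j p q + scale (p j) x + scale (q j) (U x) = 0"
      and nz: "\<not> (\<forall>i<Suc j. p i = 0 \<and> q i = 0)"
      using maxi[OF x(1)] unfolding pair_indep_def pair_comb_Suc by blast
    \<comment> \<open>If \<open>q j\<close> vanished, the relation would either be one among the old
      pairs or would put \<open>x\<close> into W.\<close>
    have q: "q j \<noteq> 0"
    proof
      assume q0: "q j = 0"
      show False
      proof (cases "p j = 0")
        case True
        then have "pair_comb U v j p q = 0" using pq q0 by simp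
        then have "\<forall>i<j. p i = 0 \<and> q i = 0" using ind unfolding pair_indep_def by blast
        then show False using nz True q0 less_Suc_eq by auto
      next
        case False
        have "scale (p j) x = - pair_comb U v j p q"
          using pq q0 by (simp add: eq_neg_iff_add_eq_0 add.commute)
        then have "x = scale (- inverse (p j)) (pair_comb U v j p q)"
          using False by (metis scale_minus_left scale_minus_right scale_one scale_scale left_inverse)
        moreover have "pair_comb U v j p q \<in> ?W" by (rule pair_comb_in_pair_span)
        ultimately show False using Wscale x(2) by metis
      qed
    qed
    have "scale (q j) (U x - scale (- p j / q j) x) = - pair_comb U v j p q"
      using pq q by (simp add: scale_right_diff_distrib eq_neg_iff_add_eq_0 algebra_simps)
    then have "U x - scale (- p j / q j) x = scale (- inverse (q j)) (pair_comb U v j p q)"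
      using q by (metis scale_minus_left scale_minus_right scale_one scale_scale left_inverse)
    moreover have "pair_comb U v j p q \<in> ?W" by (rule pair_comb_in_pair_span)
    ultimately show ?thesis using Wscale by metis
  qed
  \<comment> \<open>Here no multiple of \<open>x\<close> brings \<open>y\<close> into W, so in the
    relation obtained from \<open>x + y\<close> both coefficients vanish.\<close>
  have same: "c = d"
    if x: "x \<in> span B" "x \<notin> ?W" and y: "y \<in> span B" "\<And>a. y - scale a x \<notin> ?W"
      and c: "U x - scale c x \<in> ?W" and d: "U y - scale d y \<in> ?W" for x y c d
  proof -
    have xy: "x + y \<notin> ?W"
      using y(2)[of "-1"] by (simp add: add.commute)
    have xyS: "x + y \<in> span B" using x y span_add by blast
    obtain f where f: "U (x + y) - scale f (x + y) \<in> ?W" using loc[OF xyS xy] by blast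
    have "(U (x + y) - scale f (x + y)) - (U x - scale c x) - (U y - scale d y) \<in> ?W"
      using f c d Wdiff by blast
    then have *: "scale (d - f) y - scale (f - c) x \<in> ?W"
      by (simp add: Uadd algebra_simps)
    have df: "d = f"
    proof (rule ccontr)
      assume "d \<noteq> f"
      then have "scale (inverse (d - f)) (scale (d - f) y - scale (f - c) x)
          = y - scale (inverse (d - f) * (f - c)) x"
        by (simp add: scale_right_diff_distrib)
      then show False using Wscale[OF *] y(2) by metis
    qed
    then have **: "scale (c - f) x \<in> ?W" using * by (simp add: algebra_simps)
    have "c = f"
    proof (rule ccontr)
      assume "c \<noteq> f"
      then have "scale (inverse (c - f)) (scale (c - f) x) = x" by simp
      then show False using Wscale[OF **] x(2) by metis
    qed
    then show ?thesis using df by simp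
  qed
  obtain e where e: "e \<in> span B" "e \<notin> ?W"
    using outside_pair_span[OF B, of 0 U v] by auto
  obtain c where c: "U e - scale c e \<in> ?W" using loc[OF e] by blast
  have out: "U x - scale c x \<in> ?W" if x: "x \<in> span B" "x \<notin> ?W" for x
  proof -
    obtain d where d: "U x - scale d x \<in> ?W" using loc[OF x] by blast
    \<comment> \<open>\<open>e\<close> and \<open>x\<close> may be dependent modulo W. In that case
      \<open>y\<close>, which is independent of \<open>x\<close> and hence of \<open>e\<close>,
      serves as an intermediary between their eigenvalues.\<close>
    obtain y where y: "y \<in> span B" "\<And>a. y - scale a x \<notin> ?W"
      using outside_pair_span[OF B, of x U v] by blast
    have yW: "y \<notin> ?W" using y(2)[of 0] by simp
    obtain f where f: "U y - scale f y \<in> ?W" using loc[OF y(1) yW] by blast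
    have "d = f" by (rule same[OF x y d f])
    show ?thesis
    proof (cases "\<exists>a. e - scale a x \<in> ?W")
      case True
      then obtain a where a: "e - scale a x \<in> ?W" by blast
      have "y - scale b e \<notin> ?W" for b
      proof
        assume "y - scale b e \<in> ?W"
        then have "(y - scale b e) + scale b (e - scale a x) \<in> ?W" using a Wadd Wscale by blast
        then show False using y(2)[of "b * a"] by (simp add: scale_right_diff_distrib)
      qed
      from same[OF e y(1) this c f] have "c = f" .
      then show ?thesis using d \<open>d = f\<close> by simp
    next
      case False
      then have "d = c" using same[OF x e(1) _ d c] by blast
      then show ?thesis using d by simp
    qed
  qed
  have "U x - scale c x \<in> ?W" if x: "x \<in> span B" for x
  proof (cases "x \<in> ?W")
    case True
    \<comment> \<open>For \<open>x\<close> in W the claim is the difference of the claims for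
      \<open>x + e\<close>, which lies outside W, and for \<open>e\<close>.\<close>
    then have "x + e \<notin> ?W" using e(2) Wdiff by fastforce
    then have "U (x + e) - scale c (x + e) \<in> ?W" using out x e(1) span_add by blast
    then have "(U (x + e) - scale c (x + e)) - (U e - scale c e) \<in> ?W" using c Wdiff by blast
    then show ?thesis by (simp add: Uadd scale_right_distrib algebra_simps)
  qed (use out x in blast)
  then show ?thesis by blast
qed

lemma pair_comb_upd:
  assumes "l < j"
    and Uadd: "\<And>x y. U (x + y) = U x + U y" and Uscale: "\<And>a x. U (scale a x) = scale a (U x)"
  shows "pair_comb U (v(l := v l + scale s e)) j p q
       = pair_comb U v j p q + scale (p l * s) e + scale (q l * s) (U e)"
proof -
  have 1: "(\<Sum>i<j. scale (p i) ((v(l := v l + scale s e)) i))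
      = (\<Sum>i<j. scale (p i) (v i) + (if i = l then scale (p l * s) e else 0))" for p v and e
    by (rule sum.cong) (auto simp: scale_right_distrib)
  have 2: "U ((v(l := v l + scale s e)) i) = ((U \<circ> v)(l := (U \<circ> v) l + scale s (U e))) i" for i
    by (simp add: Uadd Uscale)
  show ?thesis
    unfolding pair_comb_def 2 1 sum.distrib using assms(1) by (simp add: algebra_simps)
qed

text \<open>Take a longest family v with v and Uv jointly independent and let W be their span.
Modulo W every vector is an eigenvector, so U - c maps into W for one c. If its image were
larger than the span of the (U - c) v, moving a single v out of W would yield a family
whose span misses part of that image.\<close>

lemma low_rank_shift_of_no_independent_pairs:
  assumes inf: "infinite (UNIV :: 'a set)"
    and B: "finite B" "independent B" "2 * k \<le> card B"
    and Uadd: "\<And>x y. U (x + y) = U x + U y" and Uscale: "\<And>a x. U (scale a x) = scale a (U x)"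
    and no: "\<not> (\<exists>v. (\<forall>i<k. v i \<in> span B) \<and> pair_indep U v k)"
  shows "\<exists>c j w. j < k \<and> (\<forall>x\<in>span B. \<exists>q. U x - scale c x = (\<Sum>i<j. scale (q i) (w i)))"
proof -
  let ?P = "\<lambda>j. \<exists>v. (\<forall>i<j. v i \<in> span B) \<and> pair_indep U v j"
  have P0: "?P 0" by (simp add: pair_indep_def)
  have restr: "?P j" if "?P (Suc j)" for j
  proof -
    from that obtain v where v: "\<forall>i<Suc j. v i \<in> span B" "pair_indep U v (Suc j)" by blast
    have "pair_indep U v j" unfolding pair_indep_def
    proof (intro allI impI)
      fix p q i assume *: "pair_comb U v j p q = 0" and i: "i < j"
      have "pair_comb U (v(j := v j)) (Suc j) (p(j := 0)) (q(j := 0)) = pair_comb U v j (p(j := 0)) (q(j := 0))"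
        unfolding pair_comb_Suc by simp
      also have "\<dots> = pair_comb U v j p q" by (simp add: pair_comb_def)
      finally have "pair_comb U v (Suc j) (p(j := 0)) (q(j := 0)) = 0" using * by simp
      then have "(p(j := 0)) i = 0 \<and> (q(j := 0)) i = 0"
        using v(2) i less_Suc_eq unfolding pair_indep_def by blast
      then show "p i = 0 \<and> q i = 0" using i by simp
    qed
    then show ?thesis using v(1) less_Suc_eq by blast
  qed
  have down: "?P m" if "?P (m + d)" for m d
    using that by (induction d) (use restr in auto)
  have bd: "j < k" if "?P j" for j
  proof (rule ccontr)
    assume "\<not> j < k"
    then have "?P (k + (j - k))" using that by simp
    then show False using down no by blast
  qed
  have "\<exists>j. ?P j \<and> \<not> ?P (Suc j)"
  proof (rule ccontr)
    assume "\<not> ?thesis"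
    then have "?P j" for j by (induction j) (use P0 in blast)+
    then show False using no by blast
  qed
  then obtain j v where v: "\<And>i. i < j \<Longrightarrow> v i \<in> span B" and ind: "pair_indep U v j"
    and mx: "\<not> ?P (Suc j)" by blast
  have jk: "j < k" using bd v ind by blast
  then have Bj: "2 * j + 1 < card B" using B(3) by simp
  have maxi: "\<not> pair_indep U (v'(j := x)) (Suc j)"
    if "\<And>i. i < j \<Longrightarrow> v' i \<in> span B" "x \<in> span B" for v' x
  proof
    assume "pair_indep U (v'(j := x)) (Suc j)"
    moreover have "\<forall>i<Suc j. (v'(j := x)) i \<in> span B" using that by (simp add: less_Suc_eq)
    ultimately show False using mx by blast
  qed
  obtain c where c: "\<And>x. x \<in> span B \<Longrightarrow> U x - scale c x \<in> pair_span U v j"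
    using scalar_modulo_pair_span[OF B(1,2) Bj Uadd ind maxi] v by blast
  \<comment> \<open>Passing from \<open>U\<close> to \<open>T\<close> only replaces the coefficients
    \<open>p i\<close> by \<open>p i - c * q i\<close>, an invertible change. Spans and independence
    of pairs are therefore the same for \<open>U\<close> and \<open>T\<close>, while
    \<open>T\<close> maps \<open>span B\<close> into the pair span.\<close>
  define T where "T x = U x - scale c x" for x
  have Tadd: "T (x + y) = T x + T y" for x y by (simp add: T_def Uadd scale_right_distrib)
  have Tscale: "T (scale a x) = scale a (T x)" for a x
    by (simp add: T_def Uscale scale_right_diff_distrib mult.commute)
  have Tcomb: "pair_comb T v j p q = pair_comb U v j (\<lambda>i. p i - c * q i) q" for p q and v and j
    by (simp add: pair_comb_def T_def scale_right_diff_distrib scale_left_diff_distrib sum_subtractf algebra_simps)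
  have Ucomb: "pair_comb U v j p q = pair_comb T v j (\<lambda>i. p i + c * q i) q" for p q and v and j
    by (simp add: Tcomb)
  have Tspan: "pair_span T v j = pair_span U v j" for v and j
    unfolding pair_span_def using Tcomb[of v j] Ucomb[of v j] by metis
  have Tind: "pair_indep T v j \<longleftrightarrow> pair_indep U v j" for v and j
  proof
    assume t: "pair_indep T v j"
    show "pair_indep U v j" unfolding pair_indep_def Ucomb
    proof (intro allI impI)
      fix p q i assume "pair_comb T v j (\<lambda>i. p i + c * q i) q = 0" "i < j"
      then have "p i + c * q i = 0" "q i = 0" using t unfolding pair_indep_def by blast+
      then show "p i = 0 \<and> q i = 0" by simp
    qed
  next
    assume t: "pair_indep U v j"
    show "pair_indep T v j" unfolding pair_indep_def Tcomb
    proof (intro allI impI)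
      fix p q i assume "pair_comb U v j (\<lambda>i. p i - c * q i) q = 0" "i < j"
      then have "p i - c * q i = 0" "q i = 0" using t unfolding pair_indep_def by blast+
      then show "p i = 0 \<and> q i = 0" by simp
    qed
  qed
  let ?W = "pair_span T v j"
  note W = pair_span_subspace[of T v j]
  note Wadd = subspace_add[OF W] and Wdiff = subspace_diff[OF W] and Wscale = subspace_scale[OF W]
  have TW: "T x \<in> ?W" if "x \<in> span B" for x using c[OF that] by (simp add: Tspan T_def)
  have indT: "pair_indep T v j" using ind Tind by simp
  have uniq: "p i = p' i \<and> q i = q' i" if "pair_comb T v j p q = pair_comb T v j p' q'" "i < j" for p q p' q' i
  proof -
    have "pair_comb T v j (\<lambda>i. p i - p' i) (\<lambda>i. q i - q' i) = 0"
      using that(1) by (simp add: pair_comb_diff[symmetric])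
    then show ?thesis using indT that(2) unfolding pair_indep_def by fastforce
  qed
  \<comment> \<open>In the expansion of \<open>T y\<close> the coefficients \<open>b\<close> belong
    to the \<open>T (v i)\<close>. Subtracting the \<open>b\<close>-combination of the
    \<open>v i\<close> from \<open>y\<close> leaves \<open>y'\<close>, whose image is the
    \<open>a\<close>-combination of the \<open>v i\<close> alone; it remains to show that every
    \<open>a l\<close> is zero.\<close>
  have main: "\<exists>q. T y = (\<Sum>i<j. scale (q i) (T (v i)))" if y: "y \<in> span B" for y
  proof -
    obtain a b where ab: "T y = pair_comb T v j a b" using TW[OF y] by (rule pair_spanE)
    define y' where "y' = y - (\<Sum>i<j. scale (b i) (v i))"
    have y'S: "y' \<in> span B" unfolding y'_def using y v by (intro span_diff span_sum span_scale) auto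
    have Tsum: "T (\<Sum>i\<in>I. f i) = (\<Sum>i\<in>I. T (f i))" for f and I :: "nat set"
    proof (induction I rule: infinite_finite_induct)
      case empty
      show ?case using Tscale[of 0 0] by simp
    qed (use Tadd Tscale[of 0 0] in simp_all)
    have Ty': "T y' = (\<Sum>i<j. scale (a i) (v i))"
    proof -
      have "T y = T y' + T (\<Sum>i<j. scale (b i) (v i))" unfolding y'_def Tadd[symmetric] by simp
      then show ?thesis using ab by (simp add: Tsum Tscale pair_comb_def)
    qed
    have "a l = 0" if l: "l < j" for l
    proof (rule ccontr)
      assume al: "a l \<noteq> 0"
      \<comment> \<open>\<open>e\<close> is the direction in which \<open>v l\<close> is moved;
        \<open>e'\<close> below is independent of \<open>e\<close> modulo the pair span and will
        show that the scalar does not change.\<close>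
      obtain e where e: "e \<in> span B" "e \<notin> ?W"
        using outside_pair_span[OF B(1,2) Bj, of 0 T v] by auto
      obtain e' where e': "e' \<in> span B" "\<And>a. e' - scale a e \<notin> ?W"
        using outside_pair_span[OF B(1,2) Bj, of e T v] by auto
      obtain g d where gd: "T e = pair_comb T v j g d" using TW[OF e(1)] by (rule pair_spanE)
      \<comment> \<open>After the move, the coefficient of \<open>T (v l)\<close> in the image of
        the new vector is \<open>1 + s * d l\<close>, which must stay nonzero to keep the pairs
        independent. For \<open>d l = 0\<close> also \<open>inverse (d l) = 0\<close>, and only
        \<open>s = 0\<close> is excluded.\<close>
      have "\<exists>s. s \<notin> {0, - inverse (d l)}" using inf by (meson ex_new_if_finite finite.emptyI finite.insertI)
      then obtain s where s: "s \<noteq> 0" "s \<noteq> - inverse (d l)" by blast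
      have sd: "1 + s * d l \<noteq> 0"
      proof
        assume *: "1 + s * d l = 0"
        then have "d l \<noteq> 0" by auto
        moreover from * have "s * d l = - 1" by (simp add: eq_neg_iff_add_eq_0 add.commute)
        ultimately show False using s(2) by (metis inverse_unique minus_mult_left mult.commute mult_minus1_right minus_minus)
      qed
      define v' where "v' = v(l := v l + scale s e)"
      have v': "v' i \<in> span B" if "i < j" for i
        unfolding v'_def using v[OF that] v[OF l] e(1) by (auto intro: span_add span_scale)
      have comb': "pair_comb T v' j p q
          = pair_comb T v j (\<lambda>i. p i + q l * s * g i) (\<lambda>i. q i + q l * s * d i) + scale (p l * s) e" for p q
        unfolding v'_def pair_comb_upd[OF l Tadd Tscale] gd pair_comb_scale pair_comb_add[symmetric]
        by (simp add: algebra_simps)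
      have e_coeff: "t = 0" if "scale t e \<in> ?W" for t
      proof (rule ccontr)
        assume "t \<noteq> 0"
        then show False using Wscale[OF that, of "inverse t"] e(2) by simp
      qed
      \<comment> \<open>The component of a combination of the new family along \<open>e\<close> is
        \<open>r l * s\<close>, so a combination that falls into the old span has
        \<open>r l = 0\<close>.\<close>
      have key: "r l = 0 \<and> (\<forall>i<j. r i = p i) \<and> (\<forall>i<j. t i = 0)"
        if "pair_comb T v' j r t = pair_comb T v j p (\<lambda>_. 0)" for r t p
      proof -
        have "scale (r l * s) e = pair_comb T v j p (\<lambda>_. 0) - pair_comb T v j (\<lambda>i. r i + t l * s * g i) (\<lambda>i. t i + t l * s * d i)"
          using that unfolding comb' by (simp add: algebra_simps)
        then have "scale (r l * s) e \<in> ?W" by (simp add: pair_comb_diff pair_comb_in_pair_span)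
        then have rl: "r l = 0" using e_coeff s(1) by fastforce
        then have eq: "pair_comb T v j (\<lambda>i. r i + t l * s * g i) (\<lambda>i. t i + t l * s * d i) = pair_comb T v j p (\<lambda>_. 0)"
          using that unfolding comb' by simp
        have "t l + t l * s * d l = 0" using uniq[OF eq l] by simp
        then have "t l * (1 + s * d l) = 0" by (simp add: algebra_simps)
        then have tl: "t l = 0" using sd by simp
        show ?thesis using rl tl uniq[OF eq] by simp
      qed
      have "pair_indep T v' j" unfolding pair_indep_def
      proof (intro allI impI)
        fix r t i assume "pair_comb T v' j r t = 0" "i < j"
        moreover have "pair_comb T v j (\<lambda>_. 0) (\<lambda>_. 0) = 0" by (simp add: pair_comb_def)
        ultimately show "r i = 0 \<and> t i = 0" using key[of r t "\<lambda>_. 0"] by auto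
      qed
      then have "pair_indep U v' j" using Tind by simp
      then obtain c' where c': "\<And>x. x \<in> span B \<Longrightarrow> U x - scale c' x \<in> pair_span U v' j"
        using scalar_modulo_pair_span[OF B(1,2) Bj Uadd _ maxi] v' by blast
      have W'W: "\<exists>t. x - scale t e \<in> ?W" if "x \<in> pair_span T v' j" for x
      proof -
        from that obtain p q where "x = pair_comb T v' j p q" by (rule pair_spanE)
        then have "x - scale (p l * s) e = pair_comb T v j (\<lambda>i. p i + q l * s * g i) (\<lambda>i. q i + q l * s * d i)"
          by (simp add: comb')
        then show ?thesis using pair_comb_in_pair_span by metis
      qed
      have "T e' - scale (c' - c) e' \<in> pair_span T v' j"
        using c'[OF e'(1)] by (simp add: T_def Tspan scale_left_diff_distrib)
      then obtain t where "T e' - scale (c' - c) e' - scale t e \<in> ?W" using W'W by blast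
      then have *: "T e' - (T e' - scale (c' - c) e' - scale t e) \<in> ?W" using TW[OF e'(1)] Wdiff by blast
      \<comment> \<open>The new span lies in the old one plus multiples of \<open>e\<close>, while
        \<open>e'\<close> is independent of \<open>e\<close> modulo the old one. A difference of the
        two scalars would contradict this.\<close>
      have cc: "c' = c"
      proof (rule ccontr)
        assume "c' \<noteq> c"
        then have "scale (inverse (c' - c)) (T e' - (T e' - scale (c' - c) e' - scale t e))
            = e' - scale (- (inverse (c' - c) * t)) e"
          by (simp add: scale_right_distrib)
        then show False using Wscale[OF *] e'(2) by metis
      qed
      have "T y' \<in> pair_span T v' j" using c'[OF y'S] by (simp add: T_def Tspan cc)
      then obtain r t where rt: "T y' = pair_comb T v' j r t" by (rule pair_spanE)
      have "T y' = pair_comb T v j a (\<lambda>_. 0)" by (simp add: Ty' pair_comb_def)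
      then have "pair_comb T v' j r t = pair_comb T v j a (\<lambda>_. 0)" using rt by simp
      \<comment> \<open>\<open>T y'\<close> lies in the new span because the scalar is the same, yet
        its coefficient \<open>a l\<close> would have to equal \<open>r l = 0\<close>.\<close>
      from key[OF this] l al show False by auto
    qed
    then have "(\<Sum>i<j. scale (a i) (v i)) = 0" by simp
    then show ?thesis using ab unfolding pair_comb_def by auto
  qed
  have "\<exists>q. U y - scale c y = (\<Sum>i<j. scale (q i) (U (v i) - scale c (v i)))" if "y \<in> span B" for y
    using main[OF that] unfolding T_def .
  then show ?thesis
    using jk by (intro exI[of _ c] exI[of _ j] exI[of _ "\<lambda>i. U (v i) - scale c (v i)"]) simp
qed

end

section \<open>Block matrices: injectivity, completion to a square matrix, left inverses\<close>

lemma mult3_mat_vec: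
  assumes "A \<in> carrier_mat a b" "B \<in> carrier_mat b c" "C \<in> carrier_mat c d" "v \<in> carrier_vec d"
  shows "(A * B * C) *\<^sub>v v = A *\<^sub>v (B *\<^sub>v (C *\<^sub>v v))"
proof -
  have "(A * B * C) *\<^sub>v v = (A * B) *\<^sub>v (C *\<^sub>v v)"
    using assms by (intro assoc_mult_mat_vec[of _ a c _ d]) auto
  also have "\<dots> = A *\<^sub>v (B *\<^sub>v (C *\<^sub>v v))"
    using assms by (intro assoc_mult_mat_vec[of _ a b _ c]) auto
  finally show ?thesis .
qed

text \<open>The dimension count behind all later intersections of kernels. The functionals are the
  rows of a square matrix padded with zero rows; the last unit vector lies in the kernel of its
  transpose, so the matrix is singular.\<close>

lemma nonzero_solution:
  fixes F :: "'a::field vec set"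
  assumes "finite F" "F \<subseteq> carrier_vec n" "card F < n"
  shows "\<exists>y\<in>carrier_vec n. y \<noteq> 0\<^sub>v n \<and> (\<forall>f\<in>F. f \<bullet> y = 0)"
proof -
  obtain fs where fs: "set fs = F" "distinct fs" using assms(1) finite_distinct_list by blast
  then have len: "length fs < n" using assms(3) distinct_card by fastforce
  define A where "A = mat n n (\<lambda>(i,c). if i < length fs then fs ! i $ c else 0)"
  have A: "A \<in> carrier_mat n n" by (simp add: A_def)
  have "transpose_mat A *\<^sub>v unit_vec n (n - 1) = 0\<^sub>v n"
    using len by (intro eq_vecI) (auto simp: A_def scalar_prod_def unit_vec_def if_distrib cong: if_cong)
  moreover have "unit_vec n (n - 1) \<noteq> 0\<^sub>v n" using len by simp
  ultimately have "det (transpose_mat A) = 0"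
    using det_0_iff_vec_prod_zero_field[of "transpose_mat A" n] A by (metis transpose_carrier_mat unit_vec_carrier)
  then have "det A = 0" using det_transpose[OF A] by simp
  then obtain y where y: "y \<in> carrier_vec n" "y \<noteq> 0\<^sub>v n" "A *\<^sub>v y = 0\<^sub>v n"
    using det_0_iff_vec_prod_zero_field[OF A] by blast
  have "f \<bullet> y = 0" if "f \<in> F" for f
  proof -
    from that have "f \<in> set fs" using fs(1) by simp
    then obtain i where i: "i < length fs" "f = fs ! i" by (auto simp: in_set_conv_nth)
    have "row A i = f"
      using i len that assms(2) by (intro eq_vecI) (auto simp: A_def)
    moreover have "row A i \<bullet> y = (A *\<^sub>v y) $ i" using i len A by simp
    ultimately show ?thesis using y(3) i len by simp
  qed
  then show ?thesis using y by blast
qed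

text \<open>Full column rank of the block matrix of \<open>A\<close> and \<open>B\<close>. The
  kernel form makes sense over any commutative ring and keeps the coefficients of the two blocks
  apart.\<close>

definition jinj :: "'a::comm_ring_1 mat \<Rightarrow> 'a mat \<Rightarrow> bool" where
  "jinj A B \<longleftrightarrow> (\<forall>p\<in>carrier_vec (dim_col A). \<forall>q\<in>carrier_vec (dim_col B).
     A *\<^sub>v p + B *\<^sub>v q = 0\<^sub>v (dim_row A) \<longrightarrow> p = 0\<^sub>v (dim_col A) \<and> q = 0\<^sub>v (dim_col B))"

lemma hcat_carrier [simp]:
  "A \<in> carrier_mat n a \<Longrightarrow> B \<in> carrier_mat n b \<Longrightarrow> hcat A B \<in> carrier_mat n (a + b)"
  by (auto simp: hcat_def)

lemma hcat_mult_vec: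
  fixes A :: "'a::comm_ring_1 mat"
  assumes "A \<in> carrier_mat n a" "B \<in> carrier_mat n b" "p \<in> carrier_vec a" "q \<in> carrier_vec b"
  shows "hcat A B *\<^sub>v (p @\<^sub>v q) = A *\<^sub>v p + B *\<^sub>v q"
proof (rule eq_vecI)
  fix r assume "r < dim_vec (A *\<^sub>v p + B *\<^sub>v q)"
  then have r: "r < n" using assms by auto
  have "row (hcat A B) r = row A r @\<^sub>v row B r"
    using assms r by (intro eq_vecI) (auto simp: hcat_def)
  then show "(hcat A B *\<^sub>v (p @\<^sub>v q)) $ r = (A *\<^sub>v p + B *\<^sub>v q) $ r"
    using assms r scalar_prod_append[of "row A r" a "row B r" b p q]
    by (simp add: hcat_def del: row_mat)
qed (use assms in \<open>auto simp: hcat_def\<close>)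

lemma jinj_iff_hcat:
  fixes A :: "'a::comm_ring_1 mat"
  assumes "A \<in> carrier_mat n a" "B \<in> carrier_mat n b"
  shows "jinj A B \<longleftrightarrow> (\<forall>v\<in>carrier_vec (a + b). hcat A B *\<^sub>v v = 0\<^sub>v n \<longrightarrow> v = 0\<^sub>v (a + b))"
proof
  assume j: "jinj A B"
  show "\<forall>v\<in>carrier_vec (a + b). hcat A B *\<^sub>v v = 0\<^sub>v n \<longrightarrow> v = 0\<^sub>v (a + b)"
  proof (intro ballI impI)
    fix v :: "'a vec" assume v: "v \<in> carrier_vec (a + b)" and 0: "hcat A B *\<^sub>v v = 0\<^sub>v n"
    have split: "v = vec_first v a @\<^sub>v vec_last v b" using v by simp
    have "A *\<^sub>v vec_first v a + B *\<^sub>v vec_last v b = 0\<^sub>v n"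
      using 0 hcat_mult_vec[OF assms, of "vec_first v a" "vec_last v b"] split by simp
    then have "vec_first v a = 0\<^sub>v a \<and> vec_last v b = 0\<^sub>v b"
      using j assms vec_first_carrier[of v a] vec_last_carrier[of v b] unfolding jinj_def by blast
    then have "v = 0\<^sub>v a @\<^sub>v 0\<^sub>v b" using split by metis
    also have "\<dots> = 0\<^sub>v (a + b)" by (intro eq_vecI) auto
    finally show "v = 0\<^sub>v (a + b)" .
  qed
next
  assume h: "\<forall>v\<in>carrier_vec (a + b). hcat A B *\<^sub>v v = 0\<^sub>v n \<longrightarrow> v = 0\<^sub>v (a + b)"
  show "jinj A B" unfolding jinj_def
  proof (intro ballI impI)
    fix p q assume p: "p \<in> carrier_vec (dim_col A)" and q: "q \<in> carrier_vec (dim_col B)"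
      and 0: "A *\<^sub>v p + B *\<^sub>v q = 0\<^sub>v (dim_row A)"
    have p': "p \<in> carrier_vec a" and q': "q \<in> carrier_vec b" using p q assms by auto
    have "hcat A B *\<^sub>v (p @\<^sub>v q) = 0\<^sub>v n" using 0 hcat_mult_vec[OF assms p' q'] assms by simp
    then have z: "p @\<^sub>v q = 0\<^sub>v (a + b)" using h p' q' by simp
    have "0\<^sub>v (a + b) = 0\<^sub>v a @\<^sub>v (0\<^sub>v b :: 'a vec)" by (intro eq_vecI) auto
    then have "p @\<^sub>v q = 0\<^sub>v a @\<^sub>v 0\<^sub>v b" using z by simp
    then have "p = 0\<^sub>v a \<and> q = 0\<^sub>v b" using append_vec_eq[of p a "0\<^sub>v a" q "0\<^sub>v b"] p' by simp
    then show "p = 0\<^sub>v (dim_col A) \<and> q = 0\<^sub>v (dim_col B)" using assms by auto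
  qed
qed

lemma jinj_commute:
  fixes A :: "'a::comm_ring_1 mat"
  assumes "A \<in> carrier_mat n a" "B \<in> carrier_mat n b"
  shows "jinj A B \<longleftrightarrow> jinj B A"
proof -
  have "A *\<^sub>v p + B *\<^sub>v q = B *\<^sub>v q + A *\<^sub>v p" if "p \<in> carrier_vec a" "q \<in> carrier_vec b" for p q
    using assms that by (intro comm_add_vec[of _ n]) auto
  then show ?thesis unfolding jinj_def using assms by auto
qed

lemma jinj_square_iff_det:
  fixes A :: "'a::idom mat"
  assumes "A \<in> carrier_mat n a" "B \<in> carrier_mat n b" "a + b = n"
  shows "jinj A B \<longleftrightarrow> det (hcat A B) \<noteq> 0"
proof -
  have H: "hcat A B \<in> carrier_mat n n" using hcat_carrier[OF assms(1,2)] assms(3) by metis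
  show ?thesis
    using jinj_iff_hcat[OF assms(1,2)] det_0_iff_vec_prod_zero[OF H] unfolding assms(3) by blast
qed

text \<open>Columns are added one at a time. A nonzero \<open>f\<close> orthogonal to all columns of
  \<open>A\<close> has some \<open>f $ i\<close> nonzero, and then the \<open>i\<close>-th unit
  vector cannot lie in the column space.\<close>

lemma complete_to_invertible:
  fixes A :: "'a::field mat"
  assumes "A \<in> carrier_mat n m" "m \<le> n"
    and "\<And>v. v \<in> carrier_vec m \<Longrightarrow> A *\<^sub>v v = 0\<^sub>v n \<Longrightarrow> v = 0\<^sub>v m"
  shows "\<exists>E\<in>carrier_mat n (n - m). jinj A E"
  using assms
proof (induction "n - m" arbitrary: m A)
  case 0
  have "jinj A (0\<^sub>m n 0)" unfolding jinj_def
  proof (intro ballI impI)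
    fix p q assume p: "p \<in> carrier_vec (dim_col A)" and q: "q \<in> carrier_vec (dim_col (0\<^sub>m n 0 :: 'a mat))"
      and "A *\<^sub>v p + 0\<^sub>m n 0 *\<^sub>v q = 0\<^sub>v (dim_row A)"
    moreover have "0\<^sub>m n 0 *\<^sub>v q = 0\<^sub>v n" using q by (intro eq_vecI) (auto simp: scalar_prod_def)
    ultimately have "A *\<^sub>v p = 0\<^sub>v n" using 0(2) by auto
    moreover have "p \<in> carrier_vec m" using p 0(2) by auto
    ultimately have "p = 0\<^sub>v m" by (rule 0(4)[rotated])
    moreover have "q = 0\<^sub>v 0" using q by auto
    ultimately show "p = 0\<^sub>v (dim_col A) \<and> q = 0\<^sub>v (dim_col (0\<^sub>m n 0 :: 'a mat))" using 0(2) by auto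
  qed
  moreover have "0\<^sub>m n 0 \<in> carrier_mat n (n - m)" using 0(1) by auto
  ultimately show ?case by blast
next
  case (Suc d)
  have "card (set (cols A)) \<le> length (cols A)" by (rule card_length)
  then have "card (set (cols A)) < n" using Suc.hyps(2) Suc.prems(1) by simp
  moreover have "set (cols A) \<subseteq> carrier_vec n" using Suc.prems(1) cols_dim by blast
  ultimately obtain f where f: "f \<in> carrier_vec n" "f \<noteq> 0\<^sub>v n" "\<forall>g\<in>set (cols A). g \<bullet> f = 0"
    using nonzero_solution[of "set (cols A)" n] by auto
  obtain i where i: "i < n" "f $ i \<noteq> 0" using f(1,2) by (auto simp: vec_eq_iff)
  define e where "e = mat n 1 (\<lambda>(r,c). if r = i then 1 else (0::'a))"
  have e: "e \<in> carrier_mat n 1" by (simp add: e_def)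
  have fA: "f \<bullet> (A *\<^sub>v v) = 0" if v: "v \<in> carrier_vec m" for v
  proof -
    have "f \<bullet> (A *\<^sub>v v) = (transpose_mat A *\<^sub>v f) \<bullet> v"
      using transpose_vec_mult_scalar[OF Suc.prems(1) v f(1)] by simp
    also have "transpose_mat A *\<^sub>v f = 0\<^sub>v m"
      using f(3) Suc.prems(1) by (intro eq_vecI) (auto simp: cols_def)
    finally show ?thesis using v by simp
  qed
  have inj: "jinj A e" unfolding jinj_def
  proof (intro ballI impI)
    fix p q assume p: "p \<in> carrier_vec (dim_col A)" and q: "q \<in> carrier_vec (dim_col e)"
      and 0: "A *\<^sub>v p + e *\<^sub>v q = 0\<^sub>v (dim_row A)"
    have p': "p \<in> carrier_vec m" and q': "q \<in> carrier_vec 1" using p q Suc.prems(1) e by auto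
    have ev: "f \<bullet> (e *\<^sub>v q) = f $ i * q $ 0"
      using q' i(1) f(1) by (simp add: scalar_prod_def e_def if_distrib[of "\<lambda>x. _ * x"] if_distrib[of "\<lambda>x. x * _"] cong: if_cong)
    have "f \<bullet> (A *\<^sub>v p + e *\<^sub>v q) = f \<bullet> (A *\<^sub>v p) + f \<bullet> (e *\<^sub>v q)"
      using f(1) p' q' Suc.prems(1) e by (intro scalar_prod_add_distrib[of _ n]) auto
    then have "f $ i * q $ 0 = 0" using 0 fA[OF p'] ev f(1) Suc.prems(1) by auto
    then have q0: "q = 0\<^sub>v 1" using i(2) q' by (intro eq_vecI) auto
    moreover have "e *\<^sub>v 0\<^sub>v 1 = 0\<^sub>v n" using e by (intro eq_vecI) auto
    ultimately have "A *\<^sub>v p = 0\<^sub>v n" using 0 p' Suc.prems(1) by auto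
    then have "p = 0\<^sub>v m" by (rule Suc.prems(3)[OF p'])
    then show "p = 0\<^sub>v (dim_col A) \<and> q = 0\<^sub>v (dim_col e)" using Suc.prems(1) q0 e by auto
  qed
  have he: "hcat A e \<in> carrier_mat n (m + 1)" by (rule hcat_carrier[OF Suc.prems(1) e])
  have inj': "v = 0\<^sub>v (m + 1)" if "v \<in> carrier_vec (m + 1)" "hcat A e *\<^sub>v v = 0\<^sub>v n" for v
    using inj that jinj_iff_hcat[OF Suc.prems(1) e] by blast
  have d: "d = n - (m + 1)" "m + 1 \<le> n" using Suc.hyps(2) by simp_all
  obtain E where E: "E \<in> carrier_mat n (n - (m + 1))" "jinj (hcat A e) E"
    using Suc.hyps(1)[OF d(1) he d(2) inj'] by blast
  define E' where "E' = hcat e E"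
  have nm: "1 + (n - (m + 1)) = n - m" using Suc.hyps(2) by simp
  have E': "E' \<in> carrier_mat n (n - m)" unfolding E'_def using hcat_carrier[OF e E(1)] nm by simp
  have "hcat A E' = hcat (hcat A e) E"
    using Suc.prems(1) e E(1) nm by (intro eq_matI) (auto simp: hcat_def E'_def)
  moreover have "m + (n - m) = (m + 1) + (n - (m + 1))" using nm by simp
  ultimately have "jinj A E'"
    using E(2) jinj_iff_hcat[OF he E(1)] jinj_iff_hcat[OF Suc.prems(1) E'] by metis
  then show ?case using E' by blast
qed

text \<open>The first \<open>m\<close> rows of the inverse of a square completion of
  \<open>A\<close> do the job.\<close>

lemma injective_left_inverse:
  fixes A :: "'a::field mat"
  assumes A: "A \<in> carrier_mat n m"
    and inj: "\<And>v. v \<in> carrier_vec m \<Longrightarrow> A *\<^sub>v v = 0\<^sub>v n \<Longrightarrow> v = 0\<^sub>v m"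
  shows "\<exists>L\<in>carrier_mat m n. L * A = 1\<^sub>m m"
proof -
  have mn: "m \<le> n"
  proof (rule ccontr)
    assume "\<not> m \<le> n"
    then have "card (set (rows A)) < m" using card_length[of "rows A"] A by simp
    moreover have "set (rows A) \<subseteq> carrier_vec m" using A rows_carrier by blast
    ultimately obtain v where v: "v \<in> carrier_vec m" "v \<noteq> 0\<^sub>v m" "\<forall>f\<in>set (rows A). f \<bullet> v = 0"
      using nonzero_solution[of "set (rows A)" m] by auto
    then have "A *\<^sub>v v = 0\<^sub>v n" using A by (intro eq_vecI) (auto simp: rows_def)
    then show False using inj v by blast
  qed
  obtain E where E: "E \<in> carrier_mat n (n - m)" "jinj A E"
    using complete_to_invertible[OF A mn] inj by blast
  have H: "hcat A E \<in> carrier_mat n n" using hcat_carrier[OF A E(1)] mn by simp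
  have "det (hcat A E) \<noteq> 0" using jinj_square_iff_det[OF A E(1)] E(2) mn by simp
  then obtain J where J: "J \<in> carrier_mat n n" "J * hcat A E = 1\<^sub>m n"
    using det_non_zero_imp_unit[OF H, of "()"] by (auto simp: Units_def ring_mat_simps)
  define L where "L = mat m n (\<lambda>(r,c). J $$ (r,c))"
  have "L * A = 1\<^sub>m m"
  proof (rule eq_matI)
    fix r c assume "r < dim_row (1\<^sub>m m :: 'a mat)" "c < dim_col (1\<^sub>m m :: 'a mat)"
    then have rc: "r < m" "c < m" by auto
    have "row L r = row J r" using rc mn J by (intro eq_vecI) (auto simp: L_def)
    moreover have "col (hcat A E) c = col A c" using rc mn A E by (intro eq_vecI) (auto simp: hcat_def)
    moreover have "L \<in> carrier_mat m n" by (simp add: L_def)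
    ultimately have "(L * A) $$ (r,c) = (J * hcat A E) $$ (r,c)" using rc mn A J(1) H by simp
    then show "(L * A) $$ (r,c) = 1\<^sub>m m $$ (r,c)" using J(2) rc mn by simp
  qed (use A in \<open>auto simp: L_def\<close>)
  moreover have "L \<in> carrier_mat m n" by (simp add: L_def)
  ultimately show ?thesis by blast
qed

text \<open>Zero forcing: the first \<open>a\<close> rows of a left inverse of the block matrix
  recover the coefficients of \<open>A\<close> and annihilate \<open>B\<close>.\<close>

lemma jinj_left_inverse:
  fixes A :: "'a::field mat"
  assumes A: "A \<in> carrier_mat n a" and B: "B \<in> carrier_mat n b" and j: "jinj A B"
  shows "\<exists>G\<in>carrier_mat a n. G * A = 1\<^sub>m a \<and> G * B = 0\<^sub>m a b"
proof -
  have H: "hcat A B \<in> carrier_mat n (a + b)" using A B by simp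
  obtain L where L: "L \<in> carrier_mat (a + b) n" "L * hcat A B = 1\<^sub>m (a + b)"
    using injective_left_inverse[OF H] j jinj_iff_hcat[OF A B] by blast
  define G where "G = mat a n (\<lambda>(r,c). L $$ (r,c))"
  have G: "G \<in> carrier_mat a n" by (simp add: G_def)
  have row: "row G r = row L r" if "r < a" for r using that L by (intro eq_vecI) (auto simp: G_def)
  have "G * A = 1\<^sub>m a"
  proof (rule eq_matI)
    fix r c assume "r < dim_row (1\<^sub>m a :: 'a mat)" "c < dim_col (1\<^sub>m a :: 'a mat)"
    then have rc: "r < a" "c < a" by auto
    have "col (hcat A B) c = col A c" using rc A B by (intro eq_vecI) (auto simp: hcat_def)
    then have "(G * A) $$ (r,c) = (L * hcat A B) $$ (r,c)" using rc A L(1) H G row by simp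
    then show "(G * A) $$ (r,c) = 1\<^sub>m a $$ (r,c)" using L(2) rc by simp
  qed (use A in \<open>auto simp: G_def\<close>)
  moreover have "G * B = 0\<^sub>m a b"
  proof (rule eq_matI)
    fix r c assume "r < dim_row (0\<^sub>m a b :: 'a mat)" "c < dim_col (0\<^sub>m a b :: 'a mat)"
    then have rc: "r < a" "c < b" by auto
    have "col (hcat A B) (a + c) = col B c" using rc A B by (intro eq_vecI) (auto simp: hcat_def)
    then have "(G * B) $$ (r,c) = (L * hcat A B) $$ (r,a + c)" using rc B L(1) H G row by (simp add: carrier_matD)
    then show "(G * B) $$ (r,c) = 0\<^sub>m a b $$ (r,c)" using L(2) rc by simp
  qed (use B in \<open>auto simp: G_def\<close>)
  ultimately show ?thesis using G by blast
qed

lemma (in vec_space) full_rank_injective: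
  assumes A: "A \<in> carrier_mat n nc" and r: "rank A = nc"
    and v: "v \<in> carrier_vec nc" "A *\<^sub>v v = 0\<^sub>v n"
  shows "v = 0\<^sub>v nc"
proof -
  \<comment> \<open>\<open>rank\<close> is the size of a maximal independent subset of the set of
    columns, so a repeated column would already push it below \<open>nc\<close>.\<close>
  have "distinct (cols A)"
  proof (rule ccontr)
    assume "\<not> distinct (cols A)"
    then have "card (set (cols A)) \<noteq> length (cols A)" using card_distinct by blast
    then have "card (set (cols A)) < nc" using card_length[of "cols A"] A by simp
    moreover obtain S where S: "maximal S (\<lambda>T. T \<subseteq> set (cols A) \<and> lin_indpt T)"
      using maximal_exists_superset[of "set (cols A)" "\<lambda>T. T \<subseteq> set (cols A) \<and> lin_indpt T" "{}"]
      by (auto simp: finite_lin_indpt2)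
    moreover have "S \<subseteq> set (cols A)" using S unfolding maximal_def by blast
    ultimately show False using rank_card_indpt[OF A S] r card_mono[of "set (cols A)" S] by auto
  qed
  then show ?thesis using full_rank_lin_indpt[OF A r] lin_depI[OF A v(1) _ v(2)] by blast
qed

lemma rank_hcat_imp_jinj:
  fixes A :: "'a::field mat"
  assumes "A \<in> carrier_mat n a" "B \<in> carrier_mat n b" "vec_space.rank n (hcat A B) = a + b"
  shows "jinj A B"
  unfolding jinj_iff_hcat[OF assms(1,2)]
  by (intro ballI impI) (rule vec_space.full_rank_injective[OF hcat_carrier[OF assms(1,2)] assms(3)])

lemma jinj_imp_rank_hcat_square:
  fixes A :: "'a::field mat"
  assumes "A \<in> carrier_mat n a" "B \<in> carrier_mat n b" "a + b = n" "jinj A B"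
  shows "vec_space.rank n (hcat A B) = a + b"
proof -
  have H: "hcat A B \<in> carrier_mat n n" using hcat_carrier[OF assms(1,2)] assms(3) by metis
  have "det (hcat A B) \<noteq> 0" using jinj_square_iff_det[OF assms(1-3)] assms(4) by blast
  then show ?thesis unfolding assms(3) using vec_space.det_rank_iff[OF H] by blast
qed

section \<open>Rank bounds expressed by linear functionals and by minors\<close>

text \<open>This is rank below \<open>k\<close>: the kernel contains the solution space of fewer
  than \<open>k\<close> linear equations. In this form kernels of different matrices are intersected
  by uniting their sets of equations.\<close>

definition rk_lt :: "nat \<Rightarrow> nat \<Rightarrow> 'a::field mat \<Rightarrow> bool" where
  "rk_lt n k Z \<longleftrightarrow> (\<exists>F. finite F \<and> F \<subseteq> carrier_vec n \<and> card F < k \<and>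
     (\<forall>y\<in>carrier_vec n. (\<forall>f\<in>F. f \<bullet> y = 0) \<longrightarrow> Z *\<^sub>v y = 0\<^sub>v n))"

lemma rk_ltE:
  assumes "rk_lt n k Z"
  obtains F where "finite F" "F \<subseteq> carrier_vec n" "card F < k"
    "\<And>y. y \<in> carrier_vec n \<Longrightarrow> (\<forall>f\<in>F. f \<bullet> y = 0) \<Longrightarrow> Z *\<^sub>v y = 0\<^sub>v n"
  using assms unfolding rk_lt_def by (elim exE conjE) simp

text \<open>Composed with \<open>C\<close>, the fewer than \<open>k\<close> functionals become
  equations on vectors of length \<open>k\<close>. They have a nonzero common solution, which lies
  in the kernel of the product.\<close>

lemma rk_lt_imp_det_zero:
  fixes Z :: "'a::field mat"
  assumes Z: "Z \<in> carrier_mat n n" and rk: "rk_lt n k Z"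
    and R: "R \<in> carrier_mat k n" and C: "C \<in> carrier_mat n k"
  shows "det (R * Z * C) = 0"
proof -
  obtain F where F: "finite F" "F \<subseteq> carrier_vec n" "card F < k"
    "\<And>y. y \<in> carrier_vec n \<Longrightarrow> (\<forall>f\<in>F. f \<bullet> y = 0) \<Longrightarrow> Z *\<^sub>v y = 0\<^sub>v n"
    using rk by (rule rk_ltE) blast
  let ?F = "(\<lambda>f. transpose_mat C *\<^sub>v f) ` F"
  have "card ?F < k" using F(1,3) card_image_le le_less_trans by blast
  moreover have "?F \<subseteq> carrier_vec k" using C F(2) by auto
  ultimately obtain b where b: "b \<in> carrier_vec k" "b \<noteq> 0\<^sub>v k" "\<forall>f\<in>?F. f \<bullet> b = 0"
    using nonzero_solution[of ?F k] F(1) by auto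
  have "\<forall>f\<in>F. f \<bullet> (C *\<^sub>v b) = 0"
  proof
    fix f assume f: "f \<in> F"
    then have "f \<bullet> (C *\<^sub>v b) = (transpose_mat C *\<^sub>v f) \<bullet> b"
      using transpose_vec_mult_scalar[OF C b(1), of f] F(2) by auto
    then show "f \<bullet> (C *\<^sub>v b) = 0" using b(3) f by simp
  qed
  then have "Z *\<^sub>v (C *\<^sub>v b) = 0\<^sub>v n" using F(4) C b(1) by simp
  then have "(R * Z * C) *\<^sub>v b = R *\<^sub>v 0\<^sub>v n"
    using mult3_mat_vec[OF R Z C b(1)] by simp
  also have "\<dots> = 0\<^sub>v k" using R by (intro eq_vecI) auto
  finally have "(R * Z * C) *\<^sub>v b = 0\<^sub>v k" .
  moreover have "R * Z * C \<in> carrier_mat k k" using R Z C by simp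
  ultimately show ?thesis
    using det_0_iff_vec_prod_zero_field[of "R * Z * C" k] b(1,2) by blast
qed

text \<open>Rows of \<open>R * Z\<close> for a nonvanishing \<open>det (R * Z * C)\<close> that
  cannot be enlarged serve as the functionals. With the converse above, the rank bound becomes a
  system of polynomial equations in the entries of \<open>Z\<close>, which is how it spreads from
  generic points to all points.\<close>

lemma det_zero_imp_rk_lt:
  fixes Z :: "'a::field mat"
  assumes Z: "Z \<in> carrier_mat n n"
    and det0: "\<And>R C. R \<in> carrier_mat k n \<Longrightarrow> C \<in> carrier_mat n k \<Longrightarrow> det (R * Z * C) = 0"
  shows "rk_lt n k Z"
proof -
  let ?P = "\<lambda>r. \<exists>R\<in>carrier_mat r n. \<exists>C\<in>carrier_mat n r. det (R * Z * C) \<noteq> 0"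
  have P0: "?P 0"
  proof -
    have "det (0\<^sub>m 0 n * Z * 0\<^sub>m n 0) = 1" by (rule det_dim_zero) auto
    then show ?thesis by (intro bexI[of _ "0\<^sub>m 0 n"] bexI[of _ "0\<^sub>m n 0"]) simp_all
  qed
  have nk: "\<not> ?P k" using det0 by blast
  have "\<exists>r<k. ?P r \<and> \<not> ?P (Suc r)"
  proof (rule ccontr)
    assume *: "\<not> ?thesis"
    have "r \<le> k \<Longrightarrow> ?P r" for r
    proof (induction r)
      case 0
      show ?case by (rule P0)
    next
      case (Suc r)
      then have "r < k" "?P r" by simp_all
      then show ?case using * by blast
    qed
    then show False using nk by blast
  qed
  then obtain r R C where r: "r < k" and R: "R \<in> carrier_mat r n" and C: "C \<in> carrier_mat n r"
    and d: "det (R * Z * C) \<noteq> 0" and mx: "\<not> ?P (Suc r)" by blast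
  let ?F = "set (rows (R * Z))"
  have cF: "card ?F < k" using card_length[of "rows (R * Z)"] R Z r by simp
  have FC: "?F \<subseteq> carrier_vec n" using R Z rows_carrier[of "R * Z"] by auto
  have "Z *\<^sub>v y = 0\<^sub>v n" if y: "y \<in> carrier_vec n" and f0: "\<forall>f\<in>?F. f \<bullet> y = 0" for y
  proof (rule ccontr)
    assume nz: "Z *\<^sub>v y \<noteq> 0\<^sub>v n"
    have Zy: "Z *\<^sub>v y \<in> carrier_vec n" using Z y by simp
    obtain i where i: "i < n" "(Z *\<^sub>v y) $ i \<noteq> 0" using nz Zy Z by (auto simp: vec_eq_iff)
    have RZy: "R *\<^sub>v (Z *\<^sub>v y) = 0\<^sub>v r"
    proof -
      have "(R * Z) *\<^sub>v y = 0\<^sub>v r" using f0 R Z by (intro eq_vecI) (auto simp: rows_def)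
      then show ?thesis using R Z y by simp
    qed
    \<comment> \<open>The minor is bordered by the \<open>i\<close>-th unit row and the column
      \<open>y\<close>, where \<open>Z *\<^sub>v y\<close> has a nonzero entry \<open>i\<close>.
      Since \<open>R * Z\<close> kills \<open>y\<close>, the bordered product is block triangular
      and nonsingular, against the choice of \<open>r\<close>.\<close>
    define R' where "R' = mat (Suc r) n (\<lambda>(a,b). if a < r then R $$ (a,b) else if b = i then 1 else 0)"
    define C' where "C' = mat n (Suc r) (\<lambda>(a,b). if b < r then C $$ (a,b) else y $ a)"
    have R': "R' \<in> carrier_mat (Suc r) n" and C': "C' \<in> carrier_mat n (Suc r)" by (auto simp: R'_def C'_def)
    have RZC': "R' * Z * C' \<in> carrier_mat (Suc r) (Suc r)" using R' Z C' by simp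
    have "det (R' * Z * C') = 0" using mx R' C' by blast
    then obtain b where b: "b \<in> carrier_vec (Suc r)" "b \<noteq> 0\<^sub>v (Suc r)" "(R' * Z * C') *\<^sub>v b = 0\<^sub>v (Suc r)"
      using det_0_iff_vec_prod_zero_field[OF RZC'] by blast
    define p where "p = vec r (\<lambda>a. b $ a)"
    define q where "q = b $ r"
    have p: "p \<in> carrier_vec r" by (simp add: p_def)
    have Cb: "C' *\<^sub>v b = C *\<^sub>v p + q \<cdot>\<^sub>v y"
    proof (rule eq_vecI)
      fix a assume "a < dim_vec (C *\<^sub>v p + q \<cdot>\<^sub>v y)"
      then have a: "a < n" using y by auto
      have "(C' *\<^sub>v b) $ a = (\<Sum>c = 0..<Suc r. C' $$ (a,c) * b $ c)"
        using a b(1) by (simp add: C'_def scalar_prod_def)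
      also have "\<dots> = (\<Sum>c = 0..<r. C $$ (a,c) * b $ c) + y $ a * b $ r"
        using a by (simp add: C'_def)
      finally show "(C' *\<^sub>v b) $ a = (C *\<^sub>v p + q \<cdot>\<^sub>v y) $ a"
        using a C y by (simp add: p_def q_def scalar_prod_def mult.commute)
    qed (use C C' y in auto)
    define u where "u = C *\<^sub>v p + q \<cdot>\<^sub>v y"
    have u: "u \<in> carrier_vec n" using C p y by (simp add: u_def)
    have "(R' * Z * C') *\<^sub>v b = (R' * Z) *\<^sub>v (C' *\<^sub>v b)" using R' Z C' b(1) by (intro assoc_mult_mat_vec) auto
    also have "\<dots> = R' *\<^sub>v (Z *\<^sub>v u)" unfolding Cb u_def[symmetric] using R' Z u by (intro assoc_mult_mat_vec) auto
    finally have R0: "R' *\<^sub>v (Z *\<^sub>v u) = 0\<^sub>v (Suc r)" using b(3) by simp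
    have Zu: "Z *\<^sub>v u = Z *\<^sub>v (C *\<^sub>v p) + q \<cdot>\<^sub>v (Z *\<^sub>v y)"
      using Z C p y by (simp add: u_def mult_add_distrib_mat_vec[of _ n n] mult_mat_vec[of _ n n])
    have top: "(R *\<^sub>v (Z *\<^sub>v u)) $ a = 0" if "a < r" for a
    proof -
      have "row R' a = row R a" using that R by (intro eq_vecI) (auto simp: R'_def)
      then have "(R *\<^sub>v (Z *\<^sub>v u)) $ a = (R' *\<^sub>v (Z *\<^sub>v u)) $ a" using that R R' by simp
      then show ?thesis using R0 that by simp
    qed
    have "R *\<^sub>v (Z *\<^sub>v u) = R *\<^sub>v (Z *\<^sub>v (C *\<^sub>v p)) + q \<cdot>\<^sub>v (R *\<^sub>v (Z *\<^sub>v y))"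
      unfolding Zu using R Z C p y by (simp add: mult_add_distrib_mat_vec[of _ r n] mult_mat_vec[of _ r n])
    also have "\<dots> = R *\<^sub>v (Z *\<^sub>v (C *\<^sub>v p))" unfolding RZy using R Z C p by (intro eq_vecI) auto
    also have "\<dots> = (R * Z * C) *\<^sub>v p" using mult3_mat_vec[OF R Z C p] by simp
    finally have "(R * Z * C) *\<^sub>v p = 0\<^sub>v r" using top R by (intro eq_vecI) auto
    moreover have "R * Z * C \<in> carrier_mat r r" using R Z C by simp
    ultimately have p0: "p = 0\<^sub>v r" using d p det_0_iff_vec_prod_zero_field[of "R * Z * C" r] by blast
    have "Z *\<^sub>v (C *\<^sub>v p) = 0\<^sub>v n" unfolding p0 using Z C by (intro eq_vecI) (auto simp: scalar_prod_def)
    then have Zu': "Z *\<^sub>v u = q \<cdot>\<^sub>v (Z *\<^sub>v y)" unfolding Zu using Zy by simp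
    have "(R' *\<^sub>v (Z *\<^sub>v u)) $ r = (Z *\<^sub>v u) $ i"
      using i Z u by (simp add: R'_def scalar_prod_def if_distrib[of "\<lambda>x. x * _"] cong: if_cong)
    then have "q * (Z *\<^sub>v y) $ i = 0" using R0 Zu' i(1) Zy by (metis carrier_vecD index_smult_vec(1) index_zero_vec(1) lessI)
    then have q0: "q = 0" using i(2) by simp
    have "b = 0\<^sub>v (Suc r)"
    proof (rule eq_vecI)
      fix a assume "a < dim_vec (0\<^sub>v (Suc r) :: 'a vec)"
      then have a: "a < Suc r" by simp
      show "b $ a = 0\<^sub>v (Suc r) $ a"
      proof (cases "a = r")
        case True then show ?thesis using q0 a by (simp add: q_def)
      next
        case False
        then have "a < r" using a by simp
        then have "p $ a = 0" using p0 by simp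
        moreover have "p $ a = b $ a" using \<open>a < r\<close> by (simp add: p_def)
        ultimately show ?thesis using a by simp
      qed
    qed (use b in simp)
    then show False using b(2) by simp
  qed
  then show ?thesis unfolding rk_lt_def using cF FC by (intro exI[of _ ?F]) auto
qed

lemma sum_fun_at: "(\<Sum>i\<in>A. f i) x = (\<Sum>i\<in>A. f i x)" for f :: "'i \<Rightarrow> 'x \<Rightarrow> 'a::comm_monoid_add"
  by (induction A rule: infinite_finite_induct) simp_all

text \<open>Contraposition of the abstract statement: \<open>k\<close> vectors independent together
  with their images could be completed to a forbidden pair \<open>V\<close>, \<open>C\<close>. The
  bound \<open>k \<le> n1\<close> gives the room \<open>2 * k \<le> n\<close> that the abstract
  statement requires.\<close>

lemma low_rank_shift:
  fixes U :: "'a::field mat"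
  assumes inf: "infinite (UNIV :: 'a set)"
    and U: "U \<in> carrier_mat n n" and n: "n = n1 + k" and k: "k \<le> n1"
    and no: "\<And>V C. V \<in> carrier_mat n n1 \<Longrightarrow> C \<in> carrier_mat n1 k \<Longrightarrow> \<not> jinj V (U * V * C)"
  shows "\<exists>c. rk_lt n k (U - c \<cdot>\<^sub>m 1\<^sub>m n)"
proof -
  \<comment> \<open>\<open>linear_pairs\<close> needs a vector space that is a whole type. Column
    vectors are therefore modelled as functions on \<open>nat\<close>, and \<open>B\<close> below
    consists of the first \<open>n\<close> unit functions.\<close>
  interpret L: linear_pairs "\<lambda>a (f :: nat \<Rightarrow> 'a) i. a * f i"
    by unfold_locales (auto simp: fun_eq_iff algebra_simps)
  define e where "e i = (\<lambda>r. if r = i then 1 else (0::'a))" for i :: nat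
  define B where "B = e ` {..<n}"
  have inje: "inj_on e {..<n}" by (auto simp: inj_on_def e_def fun_eq_iff split: if_splits)
  have finB: "finite B" by (simp add: B_def)
  have cardB: "card B = n" unfolding B_def using card_image[OF inje] by simp
  have indB: "L.independent B"
  proof
    assume "L.dependent B"
    then obtain u where u: "\<exists>v\<in>B. u v \<noteq> 0" "(\<Sum>v\<in>B. (\<lambda>i. u v * v i)) = 0"
      using L.dependent_finite[OF finB] by auto
    then obtain i where i: "i < n" "u (e i) \<noteq> 0" unfolding B_def by auto
    have "0 = (\<Sum>v\<in>B. (\<lambda>i. u v * v i)) i" using u(2) by simp
    also have "\<dots> = (\<Sum>l<n. u (e l) * e l i)"
      unfolding B_def sum_fun_at by (subst sum.reindex[OF inje]) simp
    also have "\<dots> = u (e i)" using i(1) by (simp add: e_def if_distrib[of "\<lambda>x. _ * x"] cong: if_cong)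
    finally show False using i(2) by simp
  qed
  have spanB: "f r = 0" if "f \<in> L.span B" "n \<le> r" for f r
  proof -
    have "L.subspace {f. f r = 0}" by (rule L.subspaceI) auto
    moreover have "B \<subseteq> {f. f r = 0}" using that(2) by (auto simp: B_def e_def)
    ultimately have "L.span B \<subseteq> {f. f r = 0}" by (rule L.span_minimal[rotated])
    then show ?thesis using that(1) by blast
  qed
  define Uf where "Uf f = (\<lambda>r. if r < n then \<Sum>c<n. U $$ (r,c) * f c else 0)" for f :: "nat \<Rightarrow> 'a"
  have Uadd: "Uf (f + g) = Uf f + Uf g" for f g
    by (auto simp: Uf_def fun_eq_iff algebra_simps sum.distrib)
  have Uscale: "Uf (\<lambda>i. a * f i) = (\<lambda>i. a * Uf f i)" for a f
    by (auto simp: Uf_def fun_eq_iff sum_distrib_left mult.left_commute)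
  have no': "\<not> (\<exists>v. (\<forall>i<k. v i \<in> L.span B) \<and> L.pair_indep Uf v k)"
  proof
    assume "\<exists>v. (\<forall>i<k. v i \<in> L.span B) \<and> L.pair_indep Uf v k"
    then obtain v where vS: "\<And>i. i < k \<Longrightarrow> v i \<in> L.span B" and ind: "L.pair_indep Uf v k" by blast
    define W where "W = mat n k (\<lambda>(r,i). v i r)"
    have W: "W \<in> carrier_mat n k" by (simp add: W_def)
    have UW: "U * W \<in> carrier_mat n k" using U W by simp
    have jW: "jinj W (U * W)" unfolding jinj_def
    proof (intro ballI impI)
      fix p q assume "p \<in> carrier_vec (dim_col W)" "q \<in> carrier_vec (dim_col (U * W))"
        and 0: "W *\<^sub>v p + U * W *\<^sub>v q = 0\<^sub>v (dim_row W)"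
      then have p: "p \<in> carrier_vec k" and q: "q \<in> carrier_vec k" using W UW by auto
      have "L.pair_comb Uf v k (\<lambda>i. p $ i) (\<lambda>i. q $ i) = 0"
      proof (rule ext)
        fix r
        show "L.pair_comb Uf v k (\<lambda>i. p $ i) (\<lambda>i. q $ i) r = (0 :: nat \<Rightarrow> 'a) r"
        proof (cases "r < n")
          case True
          have "(W *\<^sub>v p + U * W *\<^sub>v q) $ r = 0" using 0 True W by simp
          moreover have "(W *\<^sub>v p) $ r = (\<Sum>i<k. p $ i * v i r)"
            using True p by (simp add: W_def scalar_prod_def atLeast0LessThan mult.commute)
          moreover have "(U * W *\<^sub>v q) $ r = (\<Sum>i<k. q $ i * Uf (v i) r)"
            using True q U by (simp add: W_def scalar_prod_def atLeast0LessThan mult.commute Uf_def)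
          ultimately show ?thesis
            using True U W unfolding L.pair_comb_def by (simp add: sum_fun_at)
        next
          case False
          have "v i r = 0" if "i < k" for i using spanB[OF vS[OF that]] False by simp
          then show ?thesis using False unfolding L.pair_comb_def by (simp add: sum_fun_at Uf_def)
        qed
      qed
      then have "\<forall>i<k. p $ i = 0 \<and> q $ i = 0" using ind unfolding L.pair_indep_def by blast
      then have "p = 0\<^sub>v k" "q = 0\<^sub>v k" using p q by (auto intro!: eq_vecI)
      then show "p = 0\<^sub>v (dim_col W) \<and> q = 0\<^sub>v (dim_col (U * W))" using W by simp
    qed
    \<comment> \<open>\<open>V\<close> is made of the \<open>k\<close> vectors and of a complement
      \<open>E\<close> of all \<open>2 * k\<close> vectors, which gives
      \<open>k + (n - 2 * k) = n1\<close> columns. \<open>C\<close> selects the first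
      \<open>k\<close> of them, so \<open>V\<close> and \<open>U * V * C\<close> together rearrange
      the invertible matrix with blocks \<open>W\<close>, \<open>U * W\<close>,
      \<open>E\<close>.\<close>
    have H: "hcat W (U * W) \<in> carrier_mat n (k + k)" by (rule hcat_carrier[OF W UW])
    have "k + k \<le> n" using n k by simp
    then obtain E where E: "E \<in> carrier_mat n (n - (k + k))" "jinj (hcat W (U * W)) E"
      using complete_to_invertible[OF H] jW jinj_iff_hcat[OF W UW] by blast
    define V where "V = hcat W E"
    have nn: "k + (n - (k + k)) = n1" using n k by simp
    have V: "V \<in> carrier_mat n n1" unfolding V_def using hcat_carrier[OF W E(1)] nn by simp
    define C where "C = mat n1 k (\<lambda>(i,j). if i = j then 1 else (0::'a))"
    have C: "C \<in> carrier_mat n1 k" by (simp add: C_def)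
    have "V * C = W"
    proof (rule eq_matI)
      fix r j assume "r < dim_row W" "j < dim_col W"
      then have rj: "r < n" "j < k" using W by auto
      have "(V * C) $$ (r,j) = (\<Sum>i<n1. V $$ (r,i) * (if i = j then 1 else 0))"
        using rj V by (simp add: C_def scalar_prod_def atLeast0LessThan)
      also have "\<dots> = V $$ (r,j)" using rj k by (simp add: if_distrib[of "\<lambda>x. _ * x"] cong: if_cong)
      also have "\<dots> = W $$ (r,j)" using rj W by (simp add: V_def hcat_def)
      finally show "(V * C) $$ (r,j) = W $$ (r,j)" .
    qed (use V C W in auto)
    then have UVC: "U * V * C = U * W" using U V C by simp
    have "jinj V (U * V * C)" unfolding UVC jinj_def
    proof (intro ballI impI)
      fix x s assume "x \<in> carrier_vec (dim_col V)" "s \<in> carrier_vec (dim_col (U * W))"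
        and 0: "V *\<^sub>v x + U * W *\<^sub>v s = 0\<^sub>v (dim_row V)"
      then have x: "x \<in> carrier_vec (k + (n - (k + k)))" and s: "s \<in> carrier_vec k" using V W nn by auto
      define p where "p = vec_first x k"
      define q where "q = vec_last x (n - (k + k))"
      have pq: "p \<in> carrier_vec k" "q \<in> carrier_vec (n - (k + k))" "x = p @\<^sub>v q"
        unfolding p_def q_def using x by simp_all
      have Vx: "V *\<^sub>v x = W *\<^sub>v p + E *\<^sub>v q" unfolding V_def pq(3) by (rule hcat_mult_vec[OF W E(1) pq(1,2)])
      have ps: "p @\<^sub>v s \<in> carrier_vec (k + k)" using pq s by simp
      have "hcat W (U * W) *\<^sub>v (p @\<^sub>v s) + E *\<^sub>v q = (W *\<^sub>v p + U * W *\<^sub>v s) + E *\<^sub>v q"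
        using hcat_mult_vec[OF W UW pq(1) s] by simp
      also have "\<dots> = (W *\<^sub>v p + E *\<^sub>v q) + U * W *\<^sub>v s"
        using W UW E(1) U pq s by (intro eq_vecI) (auto simp: algebra_simps)
      also have "\<dots> = 0\<^sub>v n" using 0 V by (simp add: Vx)
      finally have "p @\<^sub>v s = 0\<^sub>v (k + k) \<and> q = 0\<^sub>v (n - (k + k))"
        using E ps pq(2) H unfolding jinj_def by (metis carrier_matD(1,2))
      moreover have "0\<^sub>v (k + k) = 0\<^sub>v k @\<^sub>v (0\<^sub>v k :: 'a vec)" by (intro eq_vecI) auto
      ultimately have z: "p = 0\<^sub>v k" "s = 0\<^sub>v k" "q = 0\<^sub>v (n - (k + k))"
        using append_vec_eq[of p k "0\<^sub>v k" s "0\<^sub>v k"] pq(1) by auto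
      have "x = 0\<^sub>v (dim_col V)" unfolding pq(3) z using V nn by (intro eq_vecI) auto
      then show "x = 0\<^sub>v (dim_col V) \<and> s = 0\<^sub>v (dim_col (U * W))" using z W by simp
    qed
    then show False using no[OF V C] by blast
  qed
  have "2 * k \<le> card B" using cardB n k by simp
  from L.low_rank_shift_of_no_independent_pairs[OF inf finB indB this Uadd Uscale no']
  obtain c j w where j: "j < k"
    and q0: "\<forall>x\<in>L.span B. \<exists>q. Uf x - (\<lambda>i. c * x i) = (\<Sum>i<j. (\<lambda>r. q i * w i r))" by blast
  have "\<exists>q. Uf (e r) - (\<lambda>i. c * e r i) = (\<Sum>i<j. (\<lambda>s. q i * w i s))" if "r < n" for r
    using q0 L.span_base[of "e r" B] that unfolding B_def by blast
  then obtain q where q: "\<And>r. r < n \<Longrightarrow> Uf (e r) - (\<lambda>i. c * e r i) = (\<Sum>i<j. (\<lambda>s. q r i * w i s))"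
    by metis
  \<comment> \<open>The shifted matrix is a sum of \<open>j\<close> products of a column
    \<open>w i\<close> with a row of coefficients \<open>q r i\<close>; these \<open>j < k\<close>
    rows are the required functionals.\<close>
  define F where "F = (\<lambda>i. vec n (\<lambda>r. q r i)) ` {..<j}"
  have entry: "(U - c \<cdot>\<^sub>m 1\<^sub>m n) $$ (s,r) = (\<Sum>i<j. q r i * w i s)" if sr: "s < n" "r < n" for s r
  proof -
    have "(Uf (e r) - (\<lambda>i. c * e r i)) s = (\<Sum>i<j. q r i * w i s)"
      unfolding q[OF sr(2)] by (simp add: sum_fun_at)
    moreover have "Uf (e r) s = U $$ (s,r)"
      using sr by (simp add: Uf_def e_def if_distrib[of "\<lambda>x. _ * x"] cong: if_cong)
    ultimately show ?thesis using sr U by (simp add: e_def)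
  qed
  have "(U - c \<cdot>\<^sub>m 1\<^sub>m n) *\<^sub>v y = 0\<^sub>v n" if y: "y \<in> carrier_vec n" and 0: "\<forall>f\<in>F. f \<bullet> y = 0" for y
  proof (rule eq_vecI)
    fix s assume "s < dim_vec (0\<^sub>v n :: 'a vec)"
    then have s: "s < n" by simp
    have "((U - c \<cdot>\<^sub>m 1\<^sub>m n) *\<^sub>v y) $ s = (\<Sum>r<n. (U - c \<cdot>\<^sub>m 1\<^sub>m n) $$ (s,r) * y $ r)"
      using s y U by (simp add: scalar_prod_def atLeast0LessThan)
    also have "\<dots> = (\<Sum>r<n. \<Sum>i<j. q r i * w i s * y $ r)"
      using s entry by (intro sum.cong) (simp_all add: sum_distrib_right)
    also have "\<dots> = (\<Sum>i<j. w i s * (\<Sum>r<n. q r i * y $ r))"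
      by (subst sum.swap) (simp add: sum_distrib_left algebra_simps)
    also have "\<dots> = (\<Sum>i<j. w i s * (vec n (\<lambda>r. q r i) \<bullet> y))"
      using y by (intro sum.cong) (auto simp: scalar_prod_def atLeast0LessThan)
    also have "\<dots> = 0" using 0 by (intro sum.neutral) (auto simp: F_def)
    finally show "((U - c \<cdot>\<^sub>m 1\<^sub>m n) *\<^sub>v y) $ s = 0\<^sub>v n $ s" using s by simp
  qed (use U in simp)
  moreover have "finite F" "F \<subseteq> carrier_vec n" by (auto simp: F_def)
  moreover have "card F < k" using j card_image_le[of "{..<j}" "\<lambda>i. vec n (\<lambda>r. q r i)"] by (simp add: F_def)
  ultimately show ?thesis unfolding rk_lt_def by blast
qed

section \<open>Evaluation of polynomials at points of the algebraic closure\<close>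

definition mono_eval :: "('x \<Rightarrow> 'k::comm_ring_1) \<Rightarrow> ('x \<Rightarrow>\<^sub>0 nat) \<Rightarrow> 'k" where
  "mono_eval \<alpha> m = (\<Prod>v\<in>Poly_Mapping.keys m. \<alpha> v ^ Poly_Mapping.lookup m v)"

definition ac_eval :: "('x \<Rightarrow> 'a::field alg_closure) \<Rightarrow> (('x \<Rightarrow>\<^sub>0 nat) \<Rightarrow>\<^sub>0 'a) \<Rightarrow> 'a alg_closure" where
  "ac_eval \<alpha> p = (\<Sum>m\<in>Poly_Mapping.keys p. to_ac (Poly_Mapping.lookup p m) * mono_eval \<alpha> m)"

lemma mono_eval_superset:
  assumes "finite A" "Poly_Mapping.keys m \<subseteq> A"
  shows "mono_eval \<alpha> m = (\<Prod>v\<in>A. \<alpha> v ^ Poly_Mapping.lookup m v)"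
  unfolding mono_eval_def using assms
  by (intro prod.mono_neutral_left) (auto simp: in_keys_iff)

lemma mono_eval_add: "mono_eval \<alpha> (m + m') = mono_eval \<alpha> m * mono_eval \<alpha> m'"
proof -
  let ?A = "Poly_Mapping.keys m \<union> Poly_Mapping.keys m'"
  have "Poly_Mapping.keys (m + m') \<subseteq> ?A" by (rule keys_add)
  then show ?thesis
    by (simp add: mono_eval_superset[of ?A] lookup_add power_add prod.distrib)
qed

lemma ac_eval_superset:
  assumes "finite A" "Poly_Mapping.keys p \<subseteq> A"
  shows "ac_eval \<alpha> p = (\<Sum>m\<in>A. to_ac (Poly_Mapping.lookup p m) * mono_eval \<alpha> m)"
  unfolding ac_eval_def using assms
  by (intro sum.mono_neutral_left) (auto simp: in_keys_iff)

lemma ac_eval_add: "ac_eval \<alpha> (p + q) = ac_eval \<alpha> p + ac_eval \<alpha> q"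
proof -
  let ?A = "Poly_Mapping.keys p \<union> Poly_Mapping.keys q"
  have "Poly_Mapping.keys (p + q) \<subseteq> ?A" by (rule keys_add)
  then show ?thesis
    by (simp add: ac_eval_superset[of ?A] lookup_add algebra_simps sum.distrib)
qed

lemma ac_eval_zero: "ac_eval \<alpha> 0 = 0"
  by (simp add: ac_eval_def)

lemma ac_eval_single: "ac_eval \<alpha> (Poly_Mapping.single m c) = to_ac c * mono_eval \<alpha> m"
  by (cases "c = 0") (simp_all add: ac_eval_def)

lemma ac_eval_sum: "ac_eval \<alpha> (\<Sum>i\<in>I. f i) = (\<Sum>i\<in>I. ac_eval \<alpha> (f i))"
  by (induction I rule: infinite_finite_induct) (simp_all add: ac_eval_zero ac_eval_add)

lemma poly_mapping_sum_single: "p = (\<Sum>m\<in>Poly_Mapping.keys p. Poly_Mapping.single m (Poly_Mapping.lookup p m))"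
  by (rule poly_mapping_eqI)
    (auto simp: lookup_sum lookup_single when_def in_keys_iff if_distrib cong: if_cong)

lemma ac_eval_mult: "ac_eval \<alpha> (p * q) = ac_eval \<alpha> p * ac_eval \<alpha> q"
proof -
  have "p * q = (\<Sum>m\<in>Poly_Mapping.keys p. Poly_Mapping.single m (Poly_Mapping.lookup p m))
      * (\<Sum>m\<in>Poly_Mapping.keys q. Poly_Mapping.single m (Poly_Mapping.lookup q m))"
    by (rule arg_cong2[where f = "(*)"]) (rule poly_mapping_sum_single)+
  also have "\<dots> = (\<Sum>m\<in>Poly_Mapping.keys p. \<Sum>m'\<in>Poly_Mapping.keys q.
      Poly_Mapping.single (m + m') (Poly_Mapping.lookup p m * Poly_Mapping.lookup q m'))"
    by (simp add: sum_product mult_single)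
  finally have "ac_eval \<alpha> (p * q) = (\<Sum>m\<in>Poly_Mapping.keys p. \<Sum>m'\<in>Poly_Mapping.keys q.
      to_ac (Poly_Mapping.lookup p m * Poly_Mapping.lookup q m') * mono_eval \<alpha> (m + m'))"
    by (simp only: ac_eval_sum ac_eval_single)
  then show ?thesis
    by (simp add: mono_eval_add ac_eval_def[of \<alpha> p] ac_eval_def[of \<alpha> q] sum_product algebra_simps)
qed

lemma ac_eval_one: "ac_eval \<alpha> 1 = 1"
proof -
  have "ac_eval \<alpha> (Poly_Mapping.single 0 1) = 1" unfolding ac_eval_single by (simp add: mono_eval_def)
  then show ?thesis by simp
qed

lemma ac_eval_hom: "comm_ring_hom (ac_eval \<alpha>)"
  by unfold_locales (simp_all add: ac_eval_zero ac_eval_one ac_eval_add ac_eval_mult)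

text \<open>In a finite field the product of all \<open>X - a\<close>, plus 1, would be a
  nonconstant polynomial without a root.\<close>

lemma infinite_alg_closure: "infinite (UNIV :: 'a::field alg_closure set)"
proof
  assume fin: "finite (UNIV :: 'a alg_closure set)"
  define p where "p = (\<Prod>a\<in>(UNIV :: 'a alg_closure set). [:- a, 1:]) + 1"
  have deg: "degree (\<Prod>a\<in>(UNIV :: 'a alg_closure set). [:- a, 1:]) = card (UNIV :: 'a alg_closure set)"
    by (subst degree_prod_eq_sum_degree) (simp_all add: fin)
  have "card (UNIV :: 'a alg_closure set) > 0" using fin by (simp add: card_gt_0_iff)
  then have "degree p > 0" unfolding p_def using deg by (subst degree_add_eq_left) simp_all
  then obtain x where "poly p x = 0" using alg_closed_imp_poly_has_root by blast
  moreover have "poly p x = 1" unfolding p_def using fin by (simp add: poly_prod prod_zero_iff)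
  ultimately show False by simp
qed

lemma exists_nonroot:
  fixes q :: "'k::idom poly"
  assumes "infinite (UNIV :: 'k set)" "q \<noteq> 0"
  shows "\<exists>t. poly q t \<noteq> 0"
proof (rule ccontr)
  assume "\<not> ?thesis"
  then have "{t. poly q t = 0} = UNIV" by blast
  then show False using poly_roots_finite[OF assms(2)] assms(1) by simp
qed

text \<open>Induction on the variables: the terms with the same exponent as \<open>m0\<close> at
  \<open>v\<close> form one coefficient of a polynomial in the single variable \<open>v\<close>. The
  induction hypothesis makes this coefficient nonzero, and then some value of \<open>v\<close> is
  not a root. The last assumption says that no two monomials coincide on \<open>V\<close>.\<close>

lemma exists_nonvanishing_point:
  fixes a :: "('x \<Rightarrow> nat) \<Rightarrow> 'k::idom"
  assumes inf: "infinite (UNIV :: 'k set)" and "finite V"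
    and "finite Ms" "m0 \<in> Ms" "a m0 \<noteq> 0"
    and "\<And>m m'. m \<in> Ms \<Longrightarrow> m' \<in> Ms \<Longrightarrow> (\<And>v. v \<in> V \<Longrightarrow> m v = m' v) \<Longrightarrow> m = m'"
  shows "\<exists>\<alpha>. (\<Sum>m\<in>Ms. a m * (\<Prod>v\<in>V. \<alpha> v ^ m v)) \<noteq> 0"
  using assms(2-)
proof (induction V arbitrary: Ms rule: finite_induct)
  case empty
  then have "Ms = {m0}" by auto
  then show ?case using empty by simp
next
  case (insert v V)
  define Me where "Me = {m\<in>Ms. m v = m0 v}"
  have "\<exists>\<alpha>. (\<Sum>m\<in>Me. a m * (\<Prod>w\<in>V. \<alpha> w ^ m w)) \<noteq> 0"
  proof (rule insert.IH)
    fix m m' assume m: "m \<in> Me" "m' \<in> Me" and eq: "\<And>w. w \<in> V \<Longrightarrow> m w = m' w"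
    show "m = m'"
    proof (rule insert.prems(4))
      fix w assume "w \<in> insert v V"
      then show "m w = m' w" using m eq by (auto simp: Me_def)
    qed (use m in \<open>auto simp: Me_def\<close>)
  qed (use insert.prems in \<open>auto simp: Me_def\<close>)
  then obtain \<alpha> where \<alpha>: "(\<Sum>m\<in>Me. a m * (\<Prod>w\<in>V. \<alpha> w ^ m w)) \<noteq> 0" by blast
  define q where "q = (\<Sum>m\<in>Ms. monom (a m * (\<Prod>w\<in>V. \<alpha> w ^ m w)) (m v))"
  have "coeff q (m0 v) = (\<Sum>m\<in>Me. a m * (\<Prod>w\<in>V. \<alpha> w ^ m w))"
    unfolding q_def Me_def coeff_sum coeff_monom using insert.prems(1)
    by (simp add: sum.inter_filter)
  then have "q \<noteq> 0" using \<alpha> by auto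
  then obtain t where t: "poly q t \<noteq> 0" using exists_nonroot[OF inf] by blast
  have "(\<Prod>w\<in>V. (\<alpha>(v := t)) w ^ m w) = (\<Prod>w\<in>V. \<alpha> w ^ m w)" for m
    using insert.hyps(2) by (intro prod.cong) auto
  then have "(\<Sum>m\<in>Ms. a m * (\<Prod>w\<in>insert v V. (\<alpha>(v := t)) w ^ m w)) = poly q t"
    using insert.hyps by (simp add: q_def poly_sum poly_monom algebra_simps)
  then show ?case using t by (intro exI[of _ "\<alpha>(v := t)"]) simp
qed

lemma ac_eval_nonzero:
  assumes "p \<noteq> 0"
  shows "\<exists>\<alpha>. ac_eval \<alpha> p \<noteq> 0"
proof -
  define V where "V = (\<Union>m\<in>Poly_Mapping.keys p. Poly_Mapping.keys m)"
  have fV: "finite V" by (simp add: V_def)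
  have "Poly_Mapping.keys p \<noteq> {}" using assms by simp
  then obtain m0 where m0: "m0 \<in> Poly_Mapping.keys p" by blast
  have inj: "inj_on Poly_Mapping.lookup (Poly_Mapping.keys p)" by (rule inj_onI) (auto intro: poly_mapping_eqI)
  define a where "a f = to_ac (Poly_Mapping.lookup p (Abs_poly_mapping f))" for f
  have "\<exists>\<alpha>. (\<Sum>f\<in>Poly_Mapping.lookup ` Poly_Mapping.keys p. a f * (\<Prod>v\<in>V. \<alpha> v ^ f v)) \<noteq> 0"
  proof (rule exists_nonvanishing_point[OF infinite_alg_closure fV])
    show "Poly_Mapping.lookup m0 \<in> Poly_Mapping.lookup ` Poly_Mapping.keys p" using m0 by blast
    show "a (Poly_Mapping.lookup m0) \<noteq> 0" using m0 by (simp add: a_def lookup_inverse in_keys_iff)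
    fix f f' assume f: "f \<in> Poly_Mapping.lookup ` Poly_Mapping.keys p" "f' \<in> Poly_Mapping.lookup ` Poly_Mapping.keys p" and eq: "\<And>v. v \<in> V \<Longrightarrow> f v = f' v"
    show "f = f'"
    proof
      fix v show "f v = f' v"
      proof (cases "v \<in> V")
        case False
        then have "f v = 0" "f' v = 0" using f by (auto simp: V_def in_keys_iff)
        then show ?thesis by simp
      qed (rule eq)
    qed
  qed simp
  then obtain \<alpha> where "(\<Sum>f\<in>Poly_Mapping.lookup ` Poly_Mapping.keys p. a f * (\<Prod>v\<in>V. \<alpha> v ^ f v)) \<noteq> 0" by blast
  moreover have "(\<Sum>f\<in>Poly_Mapping.lookup ` Poly_Mapping.keys p. a f * (\<Prod>v\<in>V. \<alpha> v ^ f v)) = ac_eval \<alpha> p"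
  proof -
    have "(\<Sum>f\<in>Poly_Mapping.lookup ` Poly_Mapping.keys p. a f * (\<Prod>v\<in>V. \<alpha> v ^ f v))
        = (\<Sum>m\<in>Poly_Mapping.keys p. to_ac (Poly_Mapping.lookup p m) * (\<Prod>v\<in>V. \<alpha> v ^ Poly_Mapping.lookup m v))"
      by (subst sum.reindex[OF inj]) (simp add: a_def lookup_inverse)
    also have "\<dots> = ac_eval \<alpha> p"
      unfolding ac_eval_def
    proof (intro sum.cong refl)
      fix m assume "m \<in> Poly_Mapping.keys p"
      then have "Poly_Mapping.keys m \<subseteq> V" by (auto simp: V_def)
      then show "to_ac (Poly_Mapping.lookup p m) * (\<Prod>v\<in>V. \<alpha> v ^ Poly_Mapping.lookup m v) = to_ac (Poly_Mapping.lookup p m) * mono_eval \<alpha> m"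
        by (simp add: mono_eval_superset[OF fV])
    qed
    finally show ?thesis .
  qed
  ultimately show ?thesis by auto
qed

section \<open>Polynomial functions of assignments\<close>

text \<open>Closure rules instead of coefficients: the later arguments only use that such a function
  restricts to a polynomial on every coordinate line and depends on finitely many variables.\<close>

inductive polyfun :: "(('x \<Rightarrow> 'k::comm_ring_1) \<Rightarrow> 'k) \<Rightarrow> bool" where
  const: "polyfun (\<lambda>x. c)"
| var: "polyfun (\<lambda>x. x v)"
| add: "polyfun f \<Longrightarrow> polyfun g \<Longrightarrow> polyfun (\<lambda>x. f x + g x)"
| mult: "polyfun f \<Longrightarrow> polyfun g \<Longrightarrow> polyfun (\<lambda>x. f x * g x)"

lemma polyfun_sum:
  assumes "\<And>i. i \<in> I \<Longrightarrow> polyfun (f i)"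
  shows "polyfun (\<lambda>x. \<Sum>i\<in>I. f i x)"
  using assms
proof (induction I rule: infinite_finite_induct)
  case (insert i I)
  have "polyfun (f i)" "polyfun (\<lambda>x. \<Sum>l\<in>I. f l x)" using insert by simp_all
  from polyfun.add[OF this] show ?case using insert.hyps by simp
qed (simp_all add: polyfun.const)

lemma polyfun_prod:
  assumes "\<And>i. i \<in> I \<Longrightarrow> polyfun (f i)"
  shows "polyfun (\<lambda>x. \<Prod>i\<in>I. f i x)"
  using assms
proof (induction I rule: infinite_finite_induct)
  case (insert i I)
  have "polyfun (f i)" "polyfun (\<lambda>x. \<Prod>l\<in>I. f l x)" using insert by simp_all
  from polyfun.mult[OF this] show ?case using insert.hyps by simp
qed (simp_all add: polyfun.const)

lemma polyfun_on_line:
  assumes "polyfun f" shows "\<exists>q. \<forall>t. f (x(v := t)) = poly q t"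
  using assms
proof induction
  case (const c)
  show ?case by (rule exI[of _ "[:c:]"]) simp
next
  case (var w)
  show ?case
  proof (cases "w = v")
    case True then show ?thesis by (intro exI[of _ "[:0, 1:]"]) simp
  next
    case False then show ?thesis by (intro exI[of _ "[:x w:]"]) simp
  qed
next
  case (add f g)
  then obtain p q where "\<forall>t. f (x(v := t)) = poly p t" "\<forall>t. g (x(v := t)) = poly q t" by blast
  then show ?case by (intro exI[of _ "p + q"]) (simp only: poly_add simp_thms)
next
  case (mult f g)
  then obtain p q where "\<forall>t. f (x(v := t)) = poly p t" "\<forall>t. g (x(v := t)) = poly q t" by blast
  then show ?case by (intro exI[of _ "p * q"]) (simp only: poly_mult simp_thms)
qed

lemma polyfun_finite_support:
  assumes "polyfun f" shows "\<exists>S. finite S \<and> (\<forall>x y. (\<forall>v\<in>S. x v = y v) \<longrightarrow> f x = f y)"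
  using assms
proof induction
  case (const c)
  show ?case by (rule exI[of _ "{}"]) simp
next
  case (var w)
  show ?case by (rule exI[of _ "{w}"]) simp
next
  case (add f g)
  then obtain S T where S: "finite S" "\<forall>x y. (\<forall>v\<in>S. x v = y v) \<longrightarrow> f x = f y"
    and T: "finite T" "\<forall>x y. (\<forall>v\<in>T. x v = y v) \<longrightarrow> g x = g y" by blast
  have "f x + g x = f y + g y" if "\<forall>v\<in>S \<union> T. x v = y v" for x y
  proof -
    have "f x = f y" by (rule S(2)[rule_format]) (use that in simp)
    moreover have "g x = g y" by (rule T(2)[rule_format]) (use that in simp)
    ultimately show ?thesis by simp
  qed
  then show ?case using S(1) T(1) by (intro exI[of _ "S \<union> T"]) simp
next
  case (mult f g)
  then obtain S T where S: "finite S" "\<forall>x y. (\<forall>v\<in>S. x v = y v) \<longrightarrow> f x = f y"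
    and T: "finite T" "\<forall>x y. (\<forall>v\<in>T. x v = y v) \<longrightarrow> g x = g y" by blast
  have "f x * g x = f y * g y" if "\<forall>v\<in>S \<union> T. x v = y v" for x y
  proof -
    have "f x = f y" by (rule S(2)[rule_format]) (use that in simp)
    moreover have "g x = g y" by (rule T(2)[rule_format]) (use that in simp)
    ultimately show ?thesis by simp
  qed
  then show ?case using S(1) T(1) by (intro exI[of _ "S \<union> T"]) simp
qed

lemma common_nonzero_on_lines:
  fixes f g :: "('x \<Rightarrow> 'k::idom) \<Rightarrow> 'k"
  assumes inf: "infinite (UNIV :: 'k set)" and "polyfun f" "polyfun g" "f x \<noteq> 0" "g y \<noteq> 0"
  shows "\<exists>t. f (x(v := t)) \<noteq> 0 \<and> g (y(v := t)) \<noteq> 0"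
proof -
  obtain p where p: "\<And>t. f (x(v := t)) = poly p t" using polyfun_on_line[OF assms(2)] by blast
  obtain q where q: "\<And>t. g (y(v := t)) = poly q t" using polyfun_on_line[OF assms(3)] by blast
  have "p \<noteq> 0" using p[of "x v"] assms(4) by auto
  moreover have "q \<noteq> 0" using q[of "y v"] assms(5) by auto
  ultimately obtain t where "poly (p * q) t \<noteq> 0" using exists_nonroot[OF inf, of "p * q"] by auto
  then show ?thesis using p q by auto
qed

text \<open>Coordinates are changed one at a time, but the direct walk from \<open>x\<close> to
  \<open>y\<close> may leave the set where \<open>f\<close> is nonzero. So at each coordinate both
  endpoints are moved to a common value \<open>t\<close> at which \<open>f\<close> is nonzero on
  both lines.\<close>

lemma constant_if_constant_on_lines:
  fixes f :: "('x \<Rightarrow> 'k::idom) \<Rightarrow> 'k" and c :: "('x \<Rightarrow> 'k) \<Rightarrow> 'c"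
  assumes inf: "infinite (UNIV :: 'k set)" and f: "polyfun f"
    and S: "finite S" "\<And>x y. (\<forall>v\<in>S. x v = y v) \<Longrightarrow> c x = c y" "\<And>x y. (\<forall>v\<in>S. x v = y v) \<Longrightarrow> f x = f y"
    and line: "\<And>x v t. f x \<noteq> 0 \<Longrightarrow> f (x(v := t)) \<noteq> 0 \<Longrightarrow> c (x(v := t)) = c x"
    and xy: "f x \<noteq> 0" "f y \<noteq> 0"
  shows "c x = c y"
proof -
  have *: "\<forall>x y. (\<forall>v. v \<notin> D \<longrightarrow> x v = y v) \<longrightarrow> f x \<noteq> 0 \<longrightarrow> f y \<noteq> 0 \<longrightarrow> c x = c y" if "finite D" for D
    using that
  proof (induction D rule: finite_induct)
    case empty
    show ?case
    proof (intro allI impI)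
      fix x y :: "'x \<Rightarrow> 'k" assume "\<forall>v. v \<notin> {} \<longrightarrow> x v = y v"
      then have "x = y" by (intro ext) simp
      then show "c x = c y" by simp
    qed
  next
    case (insert v D)
    show ?case
    proof (intro allI impI)
      fix x y assume eq: "\<forall>w. w \<notin> insert v D \<longrightarrow> x w = y w" and nz: "f x \<noteq> 0" "f y \<noteq> 0"
      from common_nonzero_on_lines[where f = f and g = f, OF inf f f nz, of v]
      obtain t where t: "f (x(v := t)) \<noteq> 0" "f (y(v := t)) \<noteq> 0" by (elim exE conjE)
      have "\<forall>w. w \<notin> D \<longrightarrow> (x(v := t)) w = (y(v := t)) w" using eq by auto
      then have "c (x(v := t)) = c (y(v := t))"
        using insert.IH[rule_format, of "x(v := t)" "y(v := t)"] t by simp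
      then show "c x = c y" using line[OF nz(1) t(1)] line[OF nz(2) t(2)] by simp
    qed
  qed
  \<comment> \<open>Only coordinates in the finite set \<open>S\<close> matter, so \<open>y\<close>
    may be replaced by a point that differs from \<open>x\<close> in finitely many
    coordinates.\<close>
  define y' where "y' v = (if v \<in> S then y v else x v)" for v
  have cy: "c y' = c y" by (rule S(2)) (simp add: y'_def)
  have fy: "f y' = f y" by (rule S(3)) (simp add: y'_def)
  have "c x = c y'" by (rule *[OF S(1), rule_format]) (use xy fy in \<open>simp_all add: y'_def\<close>)
  then show ?thesis using cy by simp
qed

text \<open>Two nonempty open sets meet: \<open>x\<close> and \<open>y\<close> are made equal
  coordinate by coordinate, each time at a value where neither function vanishes.\<close>

lemma polyfun_common_nonzero:
  fixes f g :: "('x \<Rightarrow> 'k::idom) \<Rightarrow> 'k"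
  assumes inf: "infinite (UNIV :: 'k set)" and f: "polyfun f" and g: "polyfun g" and nz: "f x \<noteq> 0" "g y \<noteq> 0"
  shows "\<exists>z. f z \<noteq> 0 \<and> g z \<noteq> 0"
proof -
  have *: "\<forall>x y. (\<forall>v. v \<notin> D \<longrightarrow> x v = y v) \<longrightarrow> f x \<noteq> 0 \<longrightarrow> g y \<noteq> 0 \<longrightarrow> (\<exists>z. f z \<noteq> 0 \<and> g z \<noteq> 0)"
    if "finite D" for D
    using that
  proof (induction D rule: finite_induct)
    case empty
    show ?case
    proof (intro allI impI)
      fix x y :: "'x \<Rightarrow> 'k" assume "\<forall>v. v \<notin> {} \<longrightarrow> x v = y v" and nz: "f x \<noteq> 0" "g y \<noteq> 0"
      then have "x = y" by (intro ext) simp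
      then show "\<exists>z. f z \<noteq> 0 \<and> g z \<noteq> 0" using nz by auto
    qed
  next
    case (insert v D)
    show ?case
    proof (intro allI impI)
      fix x y assume eq: "\<forall>w. w \<notin> insert v D \<longrightarrow> x w = y w" and nz: "f x \<noteq> 0" "g y \<noteq> 0"
      from common_nonzero_on_lines[where f = f and g = g, OF inf f g nz, of v]
      obtain t where t: "f (x(v := t)) \<noteq> 0" "g (y(v := t)) \<noteq> 0" by (elim exE conjE)
      have "\<forall>w. w \<notin> D \<longrightarrow> (x(v := t)) w = (y(v := t)) w" using eq by auto
      then show "\<exists>z. f z \<noteq> 0 \<and> g z \<noteq> 0" using insert.IH[rule_format, of "x(v := t)" "y(v := t)"] t by simp
    qed
  qed
  obtain S where S: "finite S" "\<forall>x y. (\<forall>v\<in>S. x v = y v) \<longrightarrow> g x = g y"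
    using polyfun_finite_support[OF g] by blast
  define y' where "y' v = (if v \<in> S then y v else x v)" for v
  have "g y' = g y" by (rule S(2)[rule_format]) (simp add: y'_def)
  then have "g y' \<noteq> 0" using nz(2) by simp
  with nz(1) show ?thesis by (intro *[OF S(1), rule_format, of x y']) (simp_all add: y'_def)
qed

section \<open>Matrices with polynomial entries\<close>

definition polymat :: "nat \<Rightarrow> nat \<Rightarrow> (('x \<Rightarrow> 'k::comm_ring_1) \<Rightarrow> 'k mat) \<Rightarrow> bool" where
  "polymat a b A \<longleftrightarrow> (\<forall>x. A x \<in> carrier_mat a b) \<and> (\<forall>i<a. \<forall>j<b. polyfun (\<lambda>x. A x $$ (i,j)))"

lemma polymat_const: "C \<in> carrier_mat a b \<Longrightarrow> polymat a b (\<lambda>x. C)"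
  by (simp add: polymat_def polyfun.const)

lemma polymat_mult:
  assumes "polymat a b A" "polymat b c B"
  shows "polymat a c (\<lambda>x. A x * B x)"
proof -
  have A: "A x \<in> carrier_mat a b" and B: "B x \<in> carrier_mat b c" for x
    using assms by (auto simp: polymat_def)
  have "polyfun (\<lambda>x. (A x * B x) $$ (i,j))" if ij: "i < a" "j < c" for i j
  proof -
    have "(A x * B x) $$ (i,j) = (\<Sum>l<b. A x $$ (i,l) * B x $$ (l,j))" for x
      using A[of x] B[of x] ij by (simp add: scalar_prod_def atLeast0LessThan)
    moreover have "polyfun (\<lambda>x. \<Sum>l<b. A x $$ (i,l) * B x $$ (l,j))"
      using assms ij by (intro polyfun_sum polyfun.mult) (auto simp: polymat_def)
    ultimately show ?thesis by simp
  qed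
  then show ?thesis using mult_carrier_mat[OF A B] by (simp add: polymat_def)
qed

lemma polymat_diff:
  assumes "polymat a b A" "polymat a b B"
  shows "polymat a b (\<lambda>x. A x - B x)"
proof -
  have A: "A x \<in> carrier_mat a b" and B: "B x \<in> carrier_mat a b" for x
    using assms by (auto simp: polymat_def)
  have "polyfun (\<lambda>x. (A x - B x) $$ (i,j))" if ij: "i < a" "j < b" for i j
  proof -
    have "(A x - B x) $$ (i,j) = A x $$ (i,j) + (- 1) * B x $$ (i,j)" for x
      using A[of x] B[of x] ij by simp
    moreover have "polyfun (\<lambda>x. A x $$ (i,j) + (- 1) * B x $$ (i,j))"
      using assms ij by (intro polyfun.add polyfun.mult polyfun.const) (auto simp: polymat_def)
    ultimately show ?thesis by simp
  qed
  then show ?thesis using minus_carrier_mat[OF B] by (simp add: polymat_def)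
qed

lemma polymat_smult:
  assumes "polyfun f" "polymat a b A"
  shows "polymat a b (\<lambda>x. f x \<cdot>\<^sub>m A x)"
proof -
  have A: "A x \<in> carrier_mat a b" for x using assms by (auto simp: polymat_def)
  have "polyfun (\<lambda>x. (f x \<cdot>\<^sub>m A x) $$ (i,j))" if ij: "i < a" "j < b" for i j
  proof -
    have "(f x \<cdot>\<^sub>m A x) $$ (i,j) = f x * A x $$ (i,j)" for x using A[of x] ij by simp
    moreover have "polyfun (\<lambda>x. f x * A x $$ (i,j))"
      using assms ij by (intro polyfun.mult) (auto simp: polymat_def)
    ultimately show ?thesis by simp
  qed
  then show ?thesis using smult_carrier_mat[OF A] by (simp add: polymat_def)
qed

lemma polyfun_det:
  assumes "polymat n n A"
  shows "polyfun (\<lambda>x. det (A x))"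
proof -
  have A: "A x \<in> carrier_mat n n" for x using assms by (auto simp: polymat_def)
  have "polyfun (\<lambda>x. \<Sum>p\<in>{p. p permutes {0..<n}}. signof p * (\<Prod>i = 0..<n. A x $$ (i, p i)))"
  proof (intro polyfun_sum polyfun.mult polyfun.const polyfun_prod)
    fix p i assume "p \<in> {p. p permutes {0..<n}}" "i \<in> {0..<n}"
    then have "p i < n" using permutes_in_image by fastforce
    then show "polyfun (\<lambda>x. A x $$ (i, p i))" using assms \<open>i \<in> {0..<n}\<close> by (simp add: polymat_def)
  qed
  then show ?thesis by (simp add: det_def'[OF A])
qed

lemma polymat_adj:
  assumes "polymat n n A"
  shows "polymat n n (\<lambda>x. adj_mat (A x))"
proof -
  have A: "A x \<in> carrier_mat n n" for x using assms by (auto simp: polymat_def)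
  have "polyfun (\<lambda>x. adj_mat (A x) $$ (i,j))" if ij: "i < n" "j < n" for i j
  proof -
    have "polymat (n - 1) (n - 1) (\<lambda>x. mat_delete (A x) j i)"
      unfolding polymat_def
    proof (intro conjI allI impI)
      show "mat_delete (A x) j i \<in> carrier_mat (n - 1) (n - 1)" for x
        by (rule mat_delete_carrier[OF A])
      fix a b assume ab: "a < n - 1" "b < n - 1"
      let ?a = "if a < j then a else Suc a" and ?b = "if b < i then b else Suc b"
      have "mat_delete (A x) j i $$ (a,b) = A x $$ (?a,?b)" for x
        using A[of x] ab by (simp add: mat_delete_def)
      moreover have "?a < n" "?b < n" using ab by auto
      ultimately show "polyfun (\<lambda>x. mat_delete (A x) j i $$ (a,b))" using assms by (simp add: polymat_def)
    qed
    then have "polyfun (\<lambda>x. (- 1) ^ (j + i) * det (mat_delete (A x) j i))"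
      by (intro polyfun.mult polyfun.const polyfun_det)
    moreover have "adj_mat (A x) $$ (i,j) = (- 1) ^ (j + i) * det (mat_delete (A x) j i)" for x
      using A[of x] ij by (simp add: adj_mat_def cofactor_def)
    ultimately show ?thesis by simp
  qed
  then show ?thesis using adj_mat(1)[OF A] by (simp add: polymat_def)
qed

section \<open>Paths and transfer matrices\<close>

text \<open>A repeated edge closes a cycle: the segment from one occurrence up to just before the
  next leads from the tail of the edge back to that tail.\<close>

lemma path_distinct:
  assumes dag: "finite_dag N" and p: "is_path N u v es"
  shows "distinct es"
proof (rule ccontr)
  assume "\<not> distinct es"
  then obtain a b where ab: "a < b" "b < length es" "es ! a = es ! b"
    by (metis distinct_conv_nth nat_neq_iff)
  define c where "c = take (b - a) (drop a es)"
  have len: "length c = b - a" using ab by (simp add: c_def)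
  have nth: "c ! k = es ! (a + k)" if "k < b - a" for k using that ab by (simp add: c_def)
  have ne: "c \<noteq> []" using len ab by auto
  have link: "headv N (es ! k) = tailv N (es ! Suc k)" if "Suc k < length es" for k
    using p that unfolding is_path_def by blast
  have "is_path N (tailv N (es ! a)) (tailv N (es ! a)) c"
    unfolding is_path_def
  proof (intro conjI allI impI)
    show "c \<noteq> []" by (rule ne)
    show "set c \<subseteq> edges N"
      using p set_take_subset[of "b - a" "drop a es"] set_drop_subset[of a es]
      unfolding is_path_def c_def by blast
    show "tailv N (hd c) = tailv N (es ! a)" using nth[of 0] ab ne by (simp add: hd_conv_nth)
    have "last c = es ! (b - 1)" using nth[of "b - a - 1"] ab ne len by (simp add: last_conv_nth)
    then show "headv N (last c) = tailv N (es ! a)" using link[of "b - 1"] ab by simp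
    fix k assume "Suc k < length c"
    then show "headv N (c ! k) = tailv N (c ! Suc k)"
      using nth[of k] nth[of "Suc k"] link[of "a + k"] ab len by simp
  qed
  then show False using dag unfolding finite_dag_def by blast
qed

text \<open>\<open>Max\<close> is meaningful here because distinct edges bound every path length by
  the number of edges.\<close>

lemma path_length_le_dmax:
  assumes dag: "finite_dag N" and p: "is_path N (src N i) (dst N j) es"
    and ij: "i \<in> {1,2,3}" "j \<in> {1,2,3}"
  shows "length es \<le> dmax N"
proof -
  let ?L = "{length es | es i j. i \<in> {1,2,3} \<and> j \<in> {1,2,3} \<and> is_path N (src N i) (dst N j) es}"
  have fin: "finite (edges N)" using dag by (simp add: finite_dag_def)
  have "?L \<subseteq> {..card (edges N)}"
  proof
    fix l assume "l \<in> ?L"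
    then obtain es i j where es: "l = length es" "is_path N (src N i) (dst N j) es" by blast
    then have "card (set es) = length es" using path_distinct[OF dag] distinct_card by blast
    moreover have "set es \<subseteq> edges N" using es(2) by (simp add: is_path_def)
    then have "card (set es) \<le> card (edges N)" by (rule card_mono[OF fin])
    ultimately show "l \<in> {..card (edges N)}" using es(1) by simp
  qed
  then have "finite ?L" using finite_subset by blast
  moreover have "length es \<in> ?L" using p ij by blast
  ultimately show ?thesis unfolding dmax_def by (intro Max_ge) auto
qed

lemma finite_paths:
  assumes "finite_dag N" shows "finite {es. is_path N u v es}"
proof -
  have fin: "finite (edges N)" using assms by (simp add: finite_dag_def)
  have "{es. is_path N u v es} \<subseteq> {es. set es \<subseteq> edges N \<and> length es \<le> card (edges N)}"
  proof
    fix es assume "es \<in> {es. is_path N u v es}"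
    then have es: "is_path N u v es" by simp
    then have sub: "set es \<subseteq> edges N" by (simp add: is_path_def)
    have "length es = card (set es)" using path_distinct[OF assms es] by (simp add: distinct_card)
    also have "\<dots> \<le> card (edges N)" by (rule card_mono[OF fin sub])
    finally show "es \<in> {es. set es \<subseteq> edges N \<and> length es \<le> card (edges N)}" using sub by simp
  qed
  then show ?thesis by (rule finite_subset) (rule finite_lists_length_le[OF fin])
qed

lemma mincut_zero_no_path:
  assumes dag: "finite_dag N" and "mincut N u v = 0"
  shows "\<not> is_path N u v es"
proof -
  let ?P = "\<lambda>k. \<exists>C \<subseteq> edges N. card C = k \<and> (\<forall>es. is_path N u v es \<longrightarrow> set es \<inter> C \<noteq> {})"
  \<comment> \<open>The set of all edges is a cut, so the \<open>LEAST\<close> in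
    \<open>mincut\<close> is attained and its value 0 really comes from an empty cut.\<close>
  have "set es \<inter> edges N \<noteq> {}" if "is_path N u v es" for es
    using that unfolding is_path_def by (cases es) auto
  then have "?P (card (edges N))" by (intro exI[of _ "edges N"]) simp
  then have "?P (LEAST k. ?P k)" by (rule LeastI)
  then have "?P 0" using assms(2) unfolding mincut_def by simp
  then obtain C where C: "C \<subseteq> edges N" "card C = 0" "\<forall>es. is_path N u v es \<longrightarrow> set es \<inter> C \<noteq> {}" by blast
  have "finite C" using C(1) dag finite_subset unfolding finite_dag_def by blast
  then have "C = {}" using C(2) by simp
  then show ?thesis using C(3) by blast
qed

lemma mincut_pos_path:
  assumes "mincut N u v \<ge> 1" shows "\<exists>es. is_path N u v es"
proof (rule ccontr)
  assume "\<not> ?thesis"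
  then have "\<exists>C \<subseteq> edges N. card C = 0 \<and> (\<forall>es. is_path N u v es \<longrightarrow> set es \<inter> C \<noteq> {})"
    by (intro exI[of _ "{}"]) simp
  then have "mincut N u v \<le> 0" unfolding mincut_def by (rule Least_le)
  then show False using assms by simp
qed

lemma Mmat_carrier [simp]: "Mmat N x n i j \<in> carrier_mat n n"
  by (simp add: Mmat_def)

text \<open>The sums over delays and over paths of that delay merge into one sum over paths, since
  every path length lies in the range of delays.\<close>

lemma Mmat_entry:
  assumes dag: "finite_dag N" and ij: "i \<in> {1,2,3}" "j \<in> {1,2,3}" and rc: "r < n" "c < n"
  shows "Mmat N x n i j $$ (r, c)
    = (\<Sum>es | is_path N (src N i) (dst N j) es \<and> (r + length es) mod n = c.
         path_gain x i j es (int n - 1 - int r))"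
proof -
  let ?P = "\<lambda>es. is_path N (src N i) (dst N j) es" and ?g = "\<lambda>es. path_gain x i j es (int n - 1 - int r)"
  let ?S = "{es. ?P es \<and> (r + length es) mod n = c}"
  have finS: "finite ?S" using finite_paths[OF dag] by (rule rev_finite_subset) blast
  have "Mmat N x n i j $$ (r, c)
      = (\<Sum>d\<in>{0..dmax N}. \<Sum>es | es \<in> ?S \<and> length es = d. ?g es)"
  proof -
    have "(if (r + d) mod n = c then Mresp N x i j d (int n - 1 - int r) else 0)
        = (\<Sum>es | es \<in> ?S \<and> length es = d. ?g es)" for d
    proof (cases "(r + d) mod n = c")
      case True
      then have "{es. es \<in> ?S \<and> length es = d} = {es. ?P es \<and> length es = d}" by auto
      then show ?thesis using True by (simp only: Mresp_def if_True simp_thms)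
    next
      case False
      then have "{es. es \<in> ?S \<and> length es = d} = {}" by auto
      then show ?thesis using False by (simp only: sum.empty if_False)
    qed
    then show ?thesis using rc by (simp add: Mmat_def)
  qed
  also have "\<dots> = sum ?g ?S"
  proof (rule sum.group[OF finS])
    show "finite {0..dmax N}" by simp
    show "length ` ?S \<subseteq> {0..dmax N}" using path_length_le_dmax[OF dag _ ij] by auto
  qed
  finally show ?thesis .
qed

lemma polymat_Mmat: "polymat n n (\<lambda>x. Mmat N x n i j)"
proof -
  have entry: "polyfun (\<lambda>x. Mmat N x n i j $$ (r, c))" if "r < n" "c < n" for r c
  proof -
    have gain: "polyfun (\<lambda>x. path_gain x i j es t)" for es t
      unfolding path_gain_def by (intro polyfun.mult polyfun_prod polyfun.var)
    have "polyfun (\<lambda>x. if (r + d) mod n = c then Mresp N x i j d (int n - 1 - int r) else 0)" for d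
      by (cases "(r + d) mod n = c") (simp_all add: Mresp_def gain polyfun_sum polyfun.const)
    then have "polyfun (\<lambda>x. \<Sum>d\<in>{0..dmax N}. if (r + d) mod n = c then Mresp N x i j d (int n - 1 - int r) else 0)"
      by (intro polyfun_sum)
    then show ?thesis using that by (simp add: Mmat_def)
  qed
  show ?thesis unfolding polymat_def by (intro conjI allI impI Mmat_carrier entry)
qed

lemma Mmat_hom:
  assumes "comm_ring_hom h"
  shows "Mmat N (\<lambda>v. h (x v)) n i j = map_mat h (Mmat N x n i j)"
proof -
  interpret comm_ring_hom h by (rule assms)
  have gain: "path_gain (\<lambda>v. h (x v)) i j es t = h (path_gain x i j es t)" for es t
    by (simp add: path_gain_def hom_mult hom_prod)
  have "Mresp N (\<lambda>v. h (x v)) i j d t = h (Mresp N x i j d t)" for d t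
    by (simp add: Mresp_def gain hom_sum)
  then show ?thesis
    by (intro eq_matI) (auto simp: Mmat_def hom_sum intro!: sum.cong)
qed

lemma Mmat_no_path:
  assumes "finite_dag N" "i \<in> {1,2,3}" "j \<in> {1,2,3}" "\<And>es. \<not> is_path N (src N i) (dst N j) es"
  shows "Mmat N x n i j = 0\<^sub>m n n"
proof (rule eq_matI)
  fix r c assume "r < dim_row (0\<^sub>m n n)" "c < dim_col (0\<^sub>m n n)"
  then show "Mmat N x n i j $$ (r, c) = 0\<^sub>m n n $$ (r, c)"
    using Mmat_entry[OF assms(1-3), of r n c x] assms(4) by simp
qed (simp_all add: Mmat_def)

text \<open>When only the transitions of \<open>es\<close> are switched on, a path of nonzero gain
  starts on the same edge and can only make these transitions. As the edges of \<open>es\<close> are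
  distinct, each one has at most one successor, so the path follows \<open>es\<close>; the common
  last edge fixes its length.\<close>

lemma nonzero_gain_unique_path:
  assumes d: "distinct es" and ne: "es \<noteq> []" "es' \<noteq> []" and hd: "hd es' = hd es" and last: "last es' = last es"
    and step: "\<And>m. Suc m < length es' \<Longrightarrow> \<exists>l. Suc l < length es \<and> es' ! m = es ! l \<and> es' ! Suc m = es ! Suc l"
  shows "es' = es"
proof -
  have pre: "m < length es \<and> es' ! m = es ! m" if "m < length es'" for m
    using that
  proof (induction m)
    case 0
    then show ?case using hd ne by (simp add: hd_conv_nth)
  next
    case (Suc m)
    then have IH: "m < length es" "es' ! m = es ! m" by simp_all
    obtain l where l: "Suc l < length es" "es' ! m = es ! l" "es' ! Suc m = es ! Suc l"
      using step[OF Suc.prems] by blast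
    have "l = m" using IH l d by (simp add: nth_eq_iff_index_eq)
    then show ?case using l by simp
  qed
  have le: "length es' - 1 < length es" "es' ! (length es' - 1) = es ! (length es' - 1)"
    using pre[of "length es' - 1"] ne by simp_all
  have "es ! (length es' - 1) = es ! (length es - 1)"
    using last le ne by (simp add: last_conv_nth)
  then have "length es' - 1 = length es - 1" using le d ne by (simp add: nth_eq_iff_index_eq)
  moreover have "0 < length es'" "0 < length es" using ne by simp_all
  ultimately have "length es' = length es" by linarith
  then show ?thesis using pre by (intro nth_equalityI) auto
qed

text \<open>Setting the LECs of one path to 1 and all others to 0 turns the transfer matrix into
a cyclic shift.\<close>

lemma exists_invertible_Mmat:
  assumes dag: "finite_dag N" and ij: "i \<in> {1,2,3}" "j \<in> {1,2,3}"
    and n: "dmax N < n" and p: "is_path N (src N i) (dst N j) es"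
  shows "\<exists>x :: var \<Rightarrow> 'k::idom. det (Mmat N x n i j) \<noteq> 0"
proof -
  \<comment> \<open>The LECs along \<open>es\<close> are switched on at all times, so that the path
    has gain 1 in every row of the matrix.\<close>
  define on where "on = {lec_src i (hd es) t | t. True}
    \<union> {lec_mid (es ! l) (es ! Suc l) t | l t. Suc l < length es} \<union> {lec_snk (last es) j t | t. True}"
  define x where "x v = (if v \<in> on then 1 else (0::'k))" for v
  have ne: "es \<noteq> []" using p by (simp add: is_path_def)
  have d: "distinct es" by (rule path_distinct[OF dag p])
  have L: "length es < n" using path_length_le_dmax[OF dag p ij] n by simp
  have n0: "0 < n" using L by simp
  have gain: "path_gain x i j es' t = (if es' = es then 1 else 0)" if "is_path N (src N i) (dst N j) es'" for es' t
  proof (cases "es' = es")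
    case True
    have "(\<Prod>m<length es - 1. x (lec_mid (es ! m) (es ! Suc m) (t - int (length es) + 1 + int m))) = 1"
      by (rule prod.neutral) (auto simp: x_def on_def)
    moreover have "x (lec_src i (hd es) (t - int (length es))) = 1" "x (lec_snk (last es) j t) = 1"
      by (auto simp: x_def on_def)
    ultimately show ?thesis using True by (simp add: path_gain_def)
  next
    case False
    have ne': "es' \<noteq> []" using that by (simp add: is_path_def)
    have "path_gain x i j es' t = 0"
    proof (rule ccontr)
      assume nz: "path_gain x i j es' t \<noteq> 0"
      have 1: "x (lec_src i (hd es') (t - int (length es'))) \<noteq> 0"
        and 2: "(\<Prod>m<length es' - 1. x (lec_mid (es' ! m) (es' ! Suc m) (t - int (length es') + 1 + int m))) \<noteq> 0"
        and 3: "x (lec_snk (last es') j t) \<noteq> 0"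
        using nz by (auto simp: path_gain_def)
      have "hd es' = hd es" using 1 by (auto simp: x_def on_def lec_src_def lec_mid_def lec_snk_def split: if_splits)
      moreover have "last es' = last es" using 3 by (auto simp: x_def on_def lec_src_def lec_mid_def lec_snk_def split: if_splits)
      moreover have "\<exists>l. Suc l < length es \<and> es' ! m = es ! l \<and> es' ! Suc m = es ! Suc l" if "Suc m < length es'" for m
      proof -
        have "x (lec_mid (es' ! m) (es' ! Suc m) (t - int (length es') + 1 + int m)) \<noteq> 0"
          using 2 that by (auto simp: prod_zero_iff)
        then show ?thesis by (auto simp: x_def on_def lec_src_def lec_mid_def lec_snk_def split: if_splits)
      qed
      ultimately have "es' = es" by (intro nonzero_gain_unique_path[OF d ne ne'])
      then show False using False by simp
    qed
    then show ?thesis using False by simp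
  qed
  let ?M = "Mmat N x n i j"
  have entry: "?M $$ (r, c) = (if (r + length es) mod n = c then 1 else 0)" if rc: "r < n" "c < n" for r c
  proof -
    let ?S = "{es. is_path N (src N i) (dst N j) es \<and> (r + length es) mod n = c}"
    have finS: "finite ?S" using finite_paths[OF dag] by (rule rev_finite_subset) blast
    have "?M $$ (r, c) = (\<Sum>es'\<in>?S. if es' = es then 1 else 0)"
      unfolding Mmat_entry[OF dag ij rc] by (rule sum.cong) (simp_all add: gain)
    also have "\<dots> = (if es \<in> ?S then 1 else 0)" using finS by simp
    finally show ?thesis using p by simp
  qed
  have "det ?M \<noteq> 0"
  proof
    assume "det ?M = 0"
    then obtain y where y: "y \<in> carrier_vec n" "y \<noteq> 0\<^sub>v n" "?M *\<^sub>v y = 0\<^sub>v n"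
      using det_0_iff_vec_prod_zero[of ?M n] by auto
    have "y $ c = 0" if c: "c < n" for c
    proof -
      \<comment> \<open>Row \<open>r\<close> of the shift has its only 1 in column \<open>c\<close>.
        The subtraction is exact because \<open>length es \<le> dmax N < n\<close>.\<close>
      define r where "r = (c + (n - length es)) mod n"
      have r: "r < n" using n0 by (simp add: r_def)
      have rc: "(r + length es) mod n = c" using L c by (simp add: r_def mod_add_left_eq)
      have "(?M *\<^sub>v y) $ r = (\<Sum>l<n. ?M $$ (r, l) * y $ l)"
        using r y(1) by (simp add: scalar_prod_def atLeast0LessThan Mmat_def)
      also have "\<dots> = (\<Sum>l<n. if c = l then y $ l else 0)"
        by (rule sum.cong) (use r rc in \<open>auto simp: entry\<close>)
      also have "\<dots> = y $ c" using c by simp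
      finally show ?thesis using y(3) r by simp
    qed
    then have "y = 0\<^sub>v n" using y(1) by (intro eq_vecI) auto
    then show False using y(2) by simp
  qed
  then show ?thesis by blast
qed

section \<open>Effect of changing a single LEC on the transfer matrices\<close>

lemma Mmat_upd_src_other:
  assumes "i \<noteq> i0"
  shows "Mmat N (x((0, i0, e, s) := t)) n i j = Mmat N x n i j"
proof -
  have "path_gain (x((0, i0, e, s) := t)) i j es T = path_gain x i j es T" for es T
    using assms by (simp add: path_gain_def lec_src_def lec_mid_def lec_snk_def)
  then have "Mresp N (x((0, i0, e, s) := t)) i j = Mresp N x i j" by (intro ext) (simp add: Mresp_def)
  then show ?thesis by (simp only: Mmat_def)
qed

text \<open>In row \<open>r\<close>, a path of length \<open>d\<close> uses its source LEC at time
  \<open>n - 1 - r - d\<close> and contributes to column \<open>(r + d) mod n\<close>. The time of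
  the LEC thus determines the column, and only one column can change.\<close>

lemma Mmat_upd_src_col:
  assumes "finite_dag N" "i \<in> {1,2,3}" "j \<in> {1,2,3}" "r < n" "c < n" "int c \<noteq> (int n - 1 - s) mod int n"
  shows "Mmat N (x((0, i0, e, s) := t)) n i j $$ (r, c) = Mmat N x n i j $$ (r, c)"
  unfolding Mmat_entry[OF assms(1-5)]
proof (rule sum.cong[OF refl])
  fix es assume "es \<in> {es. is_path N (src N i) (dst N j) es \<and> (r + length es) mod n = c}"
  then have "(r + length es) mod n = c" by simp
  then have "int c = (int r + int (length es)) mod int n" by (metis of_nat_add of_nat_mod)
  then have "int n - 1 - int r - int (length es) \<noteq> s" using assms(6) by auto
  then show "path_gain (x((0, i0, e, s) := t)) i j es (int n - 1 - int r) = path_gain x i j es (int n - 1 - int r)"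
    by (simp add: path_gain_def lec_src_def lec_mid_def lec_snk_def)
qed

lemma Mmat_upd_snk_other:
  assumes "j \<noteq> j0"
  shows "Mmat N (x((2, e, j0, s) := t)) n i j = Mmat N x n i j"
proof -
  have "path_gain (x((2, e, j0, s) := t)) i j es T = path_gain x i j es T" for es T
    using assms by (simp add: path_gain_def lec_src_def lec_mid_def lec_snk_def)
  then have "Mresp N (x((2, e, j0, s) := t)) i j = Mresp N x i j" by (intro ext) (simp add: Mresp_def)
  then show ?thesis by (simp only: Mmat_def)
qed

text \<open>The sink LEC is used at the time of reception, \<open>n - 1 - r\<close> for row
  \<open>r\<close>, so only one row can change.\<close>

lemma Mmat_upd_snk_row:
  assumes "r < n" "c < n" "int n - 1 - int r \<noteq> s"
  shows "Mmat N (x((2, e, j0, s) := t)) n i j $$ (r, c) = Mmat N x n i j $$ (r, c)"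
proof -
  have "path_gain (x((2, e, j0, s) := t)) i j es (int n - 1 - int r) = path_gain x i j es (int n - 1 - int r)" for es
    using assms(3) by (simp add: path_gain_def lec_src_def lec_mid_def lec_snk_def)
  then have "Mresp N (x((2, e, j0, s) := t)) i j d (int n - 1 - int r) = Mresp N x i j d (int n - 1 - int r)" for d
    by (simp add: Mresp_def)
  then show ?thesis using assms(1,2) by (auto simp: Mmat_def intro!: sum.cong)
qed

lemma Mmat_upd_indet:
  assumes "3 \<le> a"
  shows "Mmat N (x((a, b, c, s) := t)) n i j = Mmat N x n i j"
proof -
  have "path_gain (x((a, b, c, s) := t)) i j es T = path_gain x i j es T" for es T
    using assms by (simp add: path_gain_def lec_src_def lec_mid_def lec_snk_def)
  then have "Mresp N (x((a, b, c, s) := t)) i j = Mresp N x i j" by (intro ext) (simp add: Mresp_def)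
  then show ?thesis by (simp only: Mmat_def)
qed

text \<open>Paths of a single edge make no transition. This settles \<open>n \<le> 2\<close>, where
  the comparison of three points on a line has no room.\<close>

lemma Mmat_upd_mid_short:
  assumes "dmax N \<le> 1"
  shows "Mmat N (x((1, e, e', s) := t)) n i j = Mmat N x n i j"
proof -
  have "path_gain (x((1, e, e', s) := t)) i j es T = path_gain x i j es T" if "length es \<le> 1" for es T
    using that by (simp add: path_gain_def lec_src_def lec_snk_def)
  then have "Mresp N (x((1, e, e', s) := t)) i j d T = Mresp N x i j d T" if "d \<le> 1" for d T
    unfolding Mresp_def using that by (intro sum.cong) auto
  then show ?thesis using assms unfolding Mmat_def by (intro cong_mat) (auto intro!: sum.cong)
qed

text \<open>The factors of a path gain before and after a transition made at time \<open>s\<close>,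
  with the LEC of the transition itself left out. The prefix \<open>P\<close> leaves the source at
  time \<open>s - length P\<close>.\<close>

definition head_gain :: "(var \<Rightarrow> 'r::comm_ring_1) \<Rightarrow> nat \<Rightarrow> nat list \<Rightarrow> int \<Rightarrow> 'r" where
  "head_gain x i P s = x (lec_src i (hd P) (s - int (length P))) *
     (\<Prod>m < length P - 1. x (lec_mid (P ! m) (P ! Suc m) (s - int (length P) + 1 + int m)))"

definition tail_gain :: "(var \<Rightarrow> 'r::comm_ring_1) \<Rightarrow> nat \<Rightarrow> nat list \<Rightarrow> int \<Rightarrow> 'r" where
  "tail_gain x j Q s = (\<Prod>m < length Q - 1. x (lec_mid (Q ! m) (Q ! Suc m) (s + 1 + int m))) *
     x (lec_snk (last Q) j (s + int (length Q)))"

lemma prod_lessThan_add: "(\<Prod>m<a + b. f m) = (\<Prod>m<a. f m) * (\<Prod>m<b. f (a + m))"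
  for f :: "nat \<Rightarrow> 'a::comm_monoid_mult"
  by (induction b) (simp_all add: mult.assoc)

lemma path_gain_append:
  assumes "P \<noteq> []" "Q \<noteq> []" "T = s + int (length Q)"
  shows "path_gain x i j (P @ Q) T
    = head_gain x i P s * x (lec_mid (last P) (hd Q) s) * tail_gain x j Q s"
proof -
  define p where "p = length P - 1"
  define q where "q = length Q - 1"
  have P: "length P = Suc p" and Q: "length Q = Suc q" using assms(1,2) by (simp_all add: p_def q_def)
  let ?f = "\<lambda>m. x (lec_mid ((P @ Q) ! m) ((P @ Q) ! Suc m) (T - int (length (P @ Q)) + 1 + int m))"
  have "(\<Prod>m<length (P @ Q) - 1. ?f m) = (\<Prod>m<Suc p + q. ?f m)" using P Q by simp
  also have "\<dots> = (\<Prod>m<p. ?f m) * ?f p * (\<Prod>m<q. ?f (Suc p + m))"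
    unfolding prod_lessThan_add by simp
  also have "(\<Prod>m<p. ?f m) = (\<Prod>m<length P - 1. x (lec_mid (P ! m) (P ! Suc m) (s - int (length P) + 1 + int m)))"
    using P Q assms(3) by (intro prod.cong) (auto simp: nth_append algebra_simps)
  also have "?f p = x (lec_mid (last P) (hd Q) s)"
    using P Q assms by (simp add: nth_append last_conv_nth hd_conv_nth)
  also have "(\<Prod>m<q. ?f (Suc p + m)) = (\<Prod>m < length Q - 1. x (lec_mid (Q ! m) (Q ! Suc m) (s + 1 + int m)))"
    using P Q assms(3) by (intro prod.cong) (auto simp: nth_append algebra_simps)
  finally show ?thesis
    using assms unfolding path_gain_def head_gain_def tail_gain_def by (simp add: algebra_simps)
qed

lemma is_path_append:
  assumes "P \<noteq> []" "Q \<noteq> []"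
  shows "is_path N u v (P @ Q) \<longleftrightarrow> is_path N u (headv N (last P)) P \<and> is_path N (tailv N (hd Q)) v Q
    \<and> headv N (last P) = tailv N (hd Q)"
proof
  assume p: "is_path N u v (P @ Q)"
  have link: "headv N ((P @ Q) ! k) = tailv N ((P @ Q) ! Suc k)" if "Suc k < length P + length Q" for k
    using p that unfolding is_path_def by simp
  have "headv N (P ! k) = tailv N (P ! Suc k)" if "Suc k < length P" for k
    using link[of k] that by (simp add: nth_append)
  moreover have "headv N (Q ! k) = tailv N (Q ! Suc k)" if "Suc k < length Q" for k
    using link[of "length P + k"] that by (simp add: nth_append)
  moreover have "headv N (last P) = tailv N (hd Q)"
    using link[of "length P - 1"] assms by (simp add: nth_append last_conv_nth hd_conv_nth)
  ultimately show "is_path N u (headv N (last P)) P \<and> is_path N (tailv N (hd Q)) v Q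
    \<and> headv N (last P) = tailv N (hd Q)" using p assms unfolding is_path_def by auto
next
  assume *: "is_path N u (headv N (last P)) P \<and> is_path N (tailv N (hd Q)) v Q
    \<and> headv N (last P) = tailv N (hd Q)"
  have "headv N ((P @ Q) ! k) = tailv N ((P @ Q) ! Suc k)" if k: "Suc k < length P + length Q" for k
  proof -
    consider "Suc k < length P" | "Suc k = length P" | "length P \<le> k" by linarith
    then show ?thesis
    proof cases
      case 1 then show ?thesis using * unfolding is_path_def by (simp add: nth_append)
    next
      case 2
      then have "P ! k = last P" "k < length P" using assms by (simp_all add: last_conv_nth flip: 2)
      then show ?thesis using 2 * assms by (simp add: nth_append hd_conv_nth)
    next
      case 3
      then have "Suc (k - length P) < length Q" using k by simp
      then have "headv N (Q ! (k - length P)) = tailv N (Q ! Suc (k - length P))"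
        using * unfolding is_path_def by blast
      then show ?thesis using 3 by (simp add: nth_append Suc_diff_le)
    qed
  qed
  then show "is_path N u v (P @ Q)" using * assms unfolding is_path_def by auto
qed

text \<open>The signals passing from edge e to edge e' at time s form a rank-one contribution.\<close>

lemma Mmat_upd_mid:
  assumes dag: "finite_dag N"
  shows "\<exists>u w. \<forall>i\<in>{1,2,3}. \<forall>j\<in>{1,2,3}. \<forall>r<n. \<forall>c<n.
    Mmat N (x((1, e, e', s) := t)) n i j $$ (r, c) = Mmat N x n i j $$ (r, c) + u j r * w i c"
proof -
  let ?v = "(1, e, e', s) :: var"
  let ?x = "x(?v := t)"
  \<comment> \<open>In row \<open>r\<close>, a path passing from \<open>e\<close> to
    \<open>e'\<close> at time \<open>s\<close> has a suffix of length \<open>n - 1 - r - s\<close>.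
    Its column is then \<open>(length P - 1 - s) mod n\<close>, which involves the prefix alone;
    this separation of row and column makes the change a product
    \<open>u j r * w i c\<close>.\<close>
  define Pre where "Pre i c = {P. P \<noteq> [] \<and> last P = e \<and> is_path N (src N i) (headv N e) P
      \<and> (int (length P) - 1 - s) mod int n = int c}" for i c
  define Suf where "Suf j r = {Q. Q \<noteq> [] \<and> hd Q = e' \<and> headv N e = tailv N e' \<and> is_path N (tailv N e') (dst N j) Q
      \<and> int (length Q) = int n - 1 - int r - s}" for j r
  define u where "u j r = (t - x ?v) * (\<Sum>Q\<in>Suf j r. tail_gain x j Q s)" for j r
  define w where "w i c = (\<Sum>P\<in>Pre i c. head_gain x i P s)" for i c
  \<comment> \<open>The head uses transition LECs at times before \<open>s\<close> and the tail at
    times after \<open>s\<close>, so neither sees the changed variable.\<close>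
  have head: "head_gain ?x i P s = head_gain x i P s" for i P
  proof -
    have "(\<Prod>m < length P - 1. ?x (lec_mid (P ! m) (P ! Suc m) (s - int (length P) + 1 + int m)))
        = (\<Prod>m < length P - 1. x (lec_mid (P ! m) (P ! Suc m) (s - int (length P) + 1 + int m)))"
      by (rule prod.cong) (auto simp: lec_mid_def)
    then show ?thesis by (simp add: head_gain_def lec_src_def)
  qed
  have tail: "tail_gain ?x j Q s = tail_gain x j Q s" for j Q
  proof -
    have "(\<Prod>m < length Q - 1. ?x (lec_mid (Q ! m) (Q ! Suc m) (s + 1 + int m)))
        = (\<Prod>m < length Q - 1. x (lec_mid (Q ! m) (Q ! Suc m) (s + 1 + int m)))"
      by (rule prod.cong) (auto simp: lec_mid_def)
    then show ?thesis by (simp add: tail_gain_def lec_snk_def)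
  qed
  have main: "Mmat N ?x n i j $$ (r, c) = Mmat N x n i j $$ (r, c) + u j r * w i c"
    if ij: "i \<in> {1,2,3}" "j \<in> {1,2,3}" and rc: "r < n" "c < n" for i j r c
  proof -
    let ?S = "{es. is_path N (src N i) (dst N j) es \<and> (r + length es) mod n = c}"
    let ?T = "int n - 1 - int r"
    let ?I = "(\<lambda>(P, Q). P @ Q) ` (Pre i c \<times> Suf j r)"
    let ?d = "\<lambda>es. path_gain ?x i j es ?T - path_gain x i j es ?T"
    have finS: "finite ?S" using finite_paths[OF dag] by (rule rev_finite_subset) blast
    have sub: "?I \<subseteq> ?S"
    proof
      fix es assume "es \<in> ?I"
      then obtain P Q where PQ: "P \<in> Pre i c" "Q \<in> Suf j r" "es = P @ Q" by auto
      have "is_path N (src N i) (dst N j) es"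
        unfolding PQ(3) using is_path_append[of P Q N "src N i" "dst N j"] PQ(1,2) by (auto simp: Pre_def Suf_def)
      moreover have "int ((r + length es) mod n) = int c"
      proof -
        have "int ((r + length es) mod n) = (int r + int (length P) + int (length Q)) mod int n"
          using PQ(3) by (simp add: zmod_int algebra_simps)
        also have "int r + int (length P) + int (length Q) = (int (length P) - 1 - s) + int n"
          using PQ(2) unfolding Suf_def by simp
        also have "\<dots> mod int n = int c" using PQ(1) unfolding Pre_def by simp
        finally show ?thesis .
      qed
      ultimately show "es \<in> ?S" by simp
    qed
    \<comment> \<open>A path sees the changed variable only if it goes from \<open>e\<close> to
      \<open>e'\<close> at time \<open>s\<close>, and cutting it there exhibits it as some
      \<open>P @ Q\<close>.\<close>
    have out: "?d es = 0" if es: "es \<in> ?S - ?I" for es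
    proof -
      have "?x (lec_mid (es ! m) (es ! Suc m) (?T - int (length es) + 1 + int m))
          = x (lec_mid (es ! m) (es ! Suc m) (?T - int (length es) + 1 + int m))" if m: "m < length es - 1" for m
      proof (rule ccontr)
        assume "\<not> ?thesis"
        then have eq: "es ! m = e" "es ! Suc m = e'" "?T - int (length es) + 1 + int m = s"
          by (auto simp: lec_mid_def split: if_splits)
        define P where "P = take (Suc m) es"
        define Q where "Q = drop (Suc m) es"
        have PQ: "es = P @ Q" by (simp add: P_def Q_def)
        have ne: "P \<noteq> []" "Q \<noteq> []" using m by (auto simp: P_def Q_def)
        have len: "length P = Suc m" "length Q = length es - Suc m" using m by (auto simp: P_def Q_def)
        have lP: "last P = e" using ne len eq(1) m by (simp add: last_conv_nth) (simp add: P_def)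
        have hQ: "hd Q = e'" using m eq(2) by (simp add: Q_def hd_drop_conv_nth)
        have "is_path N (src N i) (dst N j) (P @ Q)" using es PQ by simp
        then have "is_path N (src N i) (headv N (last P)) P \<and> is_path N (tailv N (hd Q)) (dst N j) Q
            \<and> headv N (last P) = tailv N (hd Q)"
          by (rule is_path_append[OF ne, THEN iffD1])
        then have paths: "is_path N (src N i) (headv N e) P" "is_path N (tailv N e') (dst N j) Q" "headv N e = tailv N e'"
          unfolding lP hQ by blast+
        have lenQ: "int (length Q) = int n - 1 - int r - s" using eq(3) len m by simp
        have "int c = int ((r + length es) mod n)" using es by simp
        also have "\<dots> = (int r + int (length P) + int (length Q)) mod int n"
          unfolding PQ by (simp add: zmod_int algebra_simps)
        also have "int r + int (length P) + int (length Q) = (int (length P) - 1 - s) + int n" using lenQ by simp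
        finally have "(int (length P) - 1 - s) mod int n = int c" by simp
        then have "P \<in> Pre i c" "Q \<in> Suf j r"
          using ne lP hQ paths lenQ by (simp_all add: Pre_def Suf_def)
        then have "es \<in> ?I" using PQ by force
        then show False using es by simp
      qed
      then have "(\<Prod>m<length es - 1. ?x (lec_mid (es ! m) (es ! Suc m) (?T - int (length es) + 1 + int m)))
          = (\<Prod>m<length es - 1. x (lec_mid (es ! m) (es ! Suc m) (?T - int (length es) + 1 + int m)))"
        by (intro prod.cong) auto
      then show ?thesis by (simp add: path_gain_def lec_src_def lec_snk_def)
    qed
    \<comment> \<open>The suffix length is fixed by \<open>r\<close> and \<open>s\<close>, so a
      concatenated path splits in only one way.\<close>
    have inj: "inj_on (\<lambda>(P, Q). P @ Q) (Pre i c \<times> Suf j r)"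
    proof (rule inj_onI)
      fix a b assume ab: "a \<in> Pre i c \<times> Suf j r" "b \<in> Pre i c \<times> Suf j r"
        and eq: "(case a of (P, Q) \<Rightarrow> P @ Q) = (case b of (P, Q) \<Rightarrow> P @ Q)"
      obtain P Q P' Q' where a: "a = (P, Q)" and b: "b = (P', Q')" by (cases a, cases b) blast
      have "int (length Q) = int (length Q')" using ab unfolding a b Suf_def by auto
      then show "a = b" using eq unfolding a b by simp
    qed
    have "Mmat N ?x n i j $$ (r, c) - Mmat N x n i j $$ (r, c) = sum ?d ?S"
      unfolding Mmat_entry[OF dag ij rc] by (simp add: sum_subtractf)
    also have "\<dots> = sum ?d ?I" by (rule sum.mono_neutral_right[OF finS sub]) (use out in blast)
    also have "\<dots> = (\<Sum>(P, Q)\<in>Pre i c \<times> Suf j r. ?d (P @ Q))"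
      by (subst sum.reindex[OF inj]) (simp add: case_prod_unfold)
    also have "\<dots> = (\<Sum>(P, Q)\<in>Pre i c \<times> Suf j r. head_gain x i P s * ((t - x ?v) * tail_gain x j Q s))"
    proof (rule sum.cong[OF refl])
      fix a assume "a \<in> Pre i c \<times> Suf j r"
      then obtain P Q where a: "a = (P, Q)" and PQ: "P \<in> Pre i c" "Q \<in> Suf j r" by auto
      have ne: "P \<noteq> []" "Q \<noteq> []" and T: "?T = s + int (length Q)" and e: "last P = e" "hd Q = e'"
        using PQ by (auto simp: Pre_def Suf_def)
      have "?d (P @ Q) = head_gain x i P s * t * tail_gain x j Q s - head_gain x i P s * x ?v * tail_gain x j Q s"
        unfolding path_gain_append[OF ne T] head tail e by (simp add: lec_mid_def)
      also have "\<dots> = head_gain x i P s * ((t - x ?v) * tail_gain x j Q s)" by (simp add: algebra_simps)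
      finally show "(case a of (P, Q) \<Rightarrow> ?d (P @ Q))
          = (case a of (P, Q) \<Rightarrow> head_gain x i P s * ((t - x ?v) * tail_gain x j Q s))"
        unfolding a by simp
    qed
    also have "\<dots> = (\<Sum>P\<in>Pre i c. head_gain x i P s) * (\<Sum>Q\<in>Suf j r. (t - x ?v) * tail_gain x j Q s)"
      by (simp only: sum_product sum.cartesian_product)
    also have "\<dots> = w i c * u j r" unfolding w_def u_def by (simp only: sum_distrib_left)
    finally show ?thesis by (simp add: algebra_simps)
  qed
  show ?thesis by (intro exI[of _ u] exI[of _ w] ballI allI impI main)
qed

section \<open>The pencil B adj(D) E - c det(D) A and its kernels\<close>

lemma smult_mat_mult_vec:
  fixes A :: "'a::comm_ring_1 mat"
  assumes "A \<in> carrier_mat a b" "v \<in> carrier_vec b"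
  shows "(c \<cdot>\<^sub>m A) *\<^sub>v v = c \<cdot>\<^sub>v (A *\<^sub>v v)"
  using assms by (intro eq_vecI) (auto simp: scalar_prod_def sum_distrib_left algebra_simps)

text \<open>For invertible \<open>D\<close> this is \<open>det D\<close> times B D^-1 E - c A. The
  adjugate form is polynomial in all entries and is defined at every point.\<close>

definition pencil :: "'a::comm_ring_1 mat \<Rightarrow> 'a mat \<Rightarrow> 'a mat \<Rightarrow> 'a mat \<Rightarrow> 'a \<Rightarrow> 'a mat" where
  "pencil A B D E c = B * adj_mat D * E - (c * det D) \<cdot>\<^sub>m A"

lemma pencil_carrier [simp]:
  assumes "A \<in> carrier_mat n n" "B \<in> carrier_mat n n" "D \<in> carrier_mat n n" "E \<in> carrier_mat n n"
  shows "pencil A B D E c \<in> carrier_mat n n"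
  unfolding pencil_def using assms by (intro minus_carrier_mat smult_carrier_mat)

lemma pencil_mult_vec:
  assumes M: "A \<in> carrier_mat n n" "B \<in> carrier_mat n n" "D \<in> carrier_mat n n" "E \<in> carrier_mat n n"
    and y: "y \<in> carrier_vec n"
  shows "pencil A B D E c *\<^sub>v y = B *\<^sub>v (adj_mat D *\<^sub>v (E *\<^sub>v y)) - (c * det D) \<cdot>\<^sub>v (A *\<^sub>v y)"
proof -
  have aD: "adj_mat D \<in> carrier_mat n n" by (rule adj_mat(1)[OF M(3)])
  have S: "B * adj_mat D * E \<in> carrier_mat n n" using M aD by simp
  have "pencil A B D E c *\<^sub>v y = (B * adj_mat D * E) *\<^sub>v y - ((c * det D) \<cdot>\<^sub>m A) *\<^sub>v y"
    unfolding pencil_def using S M(1) y by (intro minus_mult_distrib_mat_vec[of _ n n]) simp_all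
  then show ?thesis using mult3_mat_vec[OF M(2) aD M(4) y] M(1) y by (simp add: smult_mat_mult_vec[of _ n n])
qed

lemma vec_minus_eq_zero_iff:
  fixes u v :: "'a::ab_group_add vec"
  assumes "u \<in> carrier_vec n" "v \<in> carrier_vec n"
  shows "u - v = 0\<^sub>v n \<longleftrightarrow> u = v"
proof
  assume *: "u - v = 0\<^sub>v n"
  show "u = v"
  proof (rule eq_vecI)
    fix i assume "i < dim_vec v"
    then have "(u - v) $ i = 0" "i < n" using * assms by auto
    then show "u $ i = v $ i" using assms by simp
  qed (use assms in simp)
qed (use assms in simp)

text \<open>The vector \<open>z\<close> is D^-1 E y. With it, membership in the kernel becomes two
  equations that are linear in each of the four matrices, so perturbations can be followed. The
  explicit formula for \<open>z\<close> allows a linear condition on \<open>z\<close> to be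
  rewritten as one on \<open>y\<close>.\<close>

lemma pencil_kernel_iff:
  fixes A :: "'a::field mat"
  assumes M: "A \<in> carrier_mat n n" "B \<in> carrier_mat n n" "D \<in> carrier_mat n n" "E \<in> carrier_mat n n"
    and d: "det D \<noteq> 0" and y: "y \<in> carrier_vec n"
  shows "pencil A B D E c *\<^sub>v y = 0\<^sub>v n \<longleftrightarrow>
    (\<exists>z\<in>carrier_vec n. D *\<^sub>v z = E *\<^sub>v y \<and> B *\<^sub>v z = c \<cdot>\<^sub>v (A *\<^sub>v y)
      \<and> z = inverse (det D) \<cdot>\<^sub>v ((adj_mat D * E) *\<^sub>v y))"
proof -
  have aD: "adj_mat D \<in> carrier_mat n n" by (rule adj_mat(1)[OF M(3)])
  define q where "q = adj_mat D *\<^sub>v (E *\<^sub>v y)"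
  define z where "z = inverse (det D) \<cdot>\<^sub>v q"
  have q: "q \<in> carrier_vec n" using aD M y by (simp add: q_def)
  have z: "z \<in> carrier_vec n" using q by (simp add: z_def)
  have z_eq: "z = inverse (det D) \<cdot>\<^sub>v ((adj_mat D * E) *\<^sub>v y)"
    unfolding z_def q_def using assoc_mult_mat_vec[OF aD M(4) y] by simp
  have Ey: "E *\<^sub>v y \<in> carrier_vec n" using M y by simp
  have "D *\<^sub>v q = (D * adj_mat D) *\<^sub>v (E *\<^sub>v y)" unfolding q_def using assoc_mult_mat_vec[OF M(3) aD Ey] by simp
  also have "\<dots> = det D \<cdot>\<^sub>v (E *\<^sub>v y)"
    unfolding adj_mat(2)[OF M(3)] using Ey by (simp add: smult_mat_mult_vec[of _ n n])
  finally have "D *\<^sub>v z = E *\<^sub>v y"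
    unfolding z_def using d Ey q M(3) by (simp add: mult_mat_vec[of _ n n] smult_smult_assoc)
  moreover have "pencil A B D E c *\<^sub>v y = 0\<^sub>v n \<longleftrightarrow> B *\<^sub>v z = c \<cdot>\<^sub>v (A *\<^sub>v y)"
  proof -
    have Bq: "B *\<^sub>v q \<in> carrier_vec n" and Ay: "A *\<^sub>v y \<in> carrier_vec n" using M q y by simp_all
    have "pencil A B D E c *\<^sub>v y = 0\<^sub>v n \<longleftrightarrow> B *\<^sub>v q = (c * det D) \<cdot>\<^sub>v (A *\<^sub>v y)"
      unfolding pencil_mult_vec[OF M y] q_def[symmetric]
      by (rule vec_minus_eq_zero_iff) (use Bq Ay in simp_all)
    also have "\<dots> \<longleftrightarrow> inverse (det D) \<cdot>\<^sub>v (B *\<^sub>v q) = c \<cdot>\<^sub>v (A *\<^sub>v y)"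
    proof
      assume "B *\<^sub>v q = (c * det D) \<cdot>\<^sub>v (A *\<^sub>v y)"
      moreover have "inverse (det D) * (c * det D) = c" using d by simp
      ultimately show "inverse (det D) \<cdot>\<^sub>v (B *\<^sub>v q) = c \<cdot>\<^sub>v (A *\<^sub>v y)"
        by (simp only: smult_smult_assoc)
    next
      assume *: "inverse (det D) \<cdot>\<^sub>v (B *\<^sub>v q) = c \<cdot>\<^sub>v (A *\<^sub>v y)"
      have "B *\<^sub>v q = det D \<cdot>\<^sub>v (inverse (det D) \<cdot>\<^sub>v (B *\<^sub>v q))" using d by (simp add: smult_smult_assoc)
      also have "\<dots> = (c * det D) \<cdot>\<^sub>v (A *\<^sub>v y)" unfolding * by (simp add: smult_smult_assoc mult.commute)
      finally show "B *\<^sub>v q = (c * det D) \<cdot>\<^sub>v (A *\<^sub>v y)" .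
    qed
    also have "inverse (det D) \<cdot>\<^sub>v (B *\<^sub>v q) = B *\<^sub>v z"
      unfolding z_def using M(2) q by (simp add: mult_mat_vec[of _ n n])
    finally show ?thesis .
  qed
  ultimately show ?thesis using z z_eq by auto
qed

lemma pencil_kernelI:
  fixes A :: "'a::field mat"
  assumes M: "A \<in> carrier_mat n n" "B \<in> carrier_mat n n" "D \<in> carrier_mat n n" "E \<in> carrier_mat n n"
    and y: "y \<in> carrier_vec n" and z: "z \<in> carrier_vec n"
    and eq: "D *\<^sub>v z = E *\<^sub>v y" "B *\<^sub>v z = c \<cdot>\<^sub>v (A *\<^sub>v y)"
  shows "pencil A B D E c *\<^sub>v y = 0\<^sub>v n"
proof -
  have aD: "adj_mat D \<in> carrier_mat n n" by (rule adj_mat(1)[OF M(3)])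
  have "adj_mat D *\<^sub>v (E *\<^sub>v y) = (adj_mat D * D) *\<^sub>v z"
    unfolding eq(1)[symmetric] using assoc_mult_mat_vec[OF aD M(3) z] by simp
  also have "\<dots> = det D \<cdot>\<^sub>v z"
    unfolding adj_mat(3)[OF M(3)] using z by (simp add: smult_mat_mult_vec[of _ n n])
  finally have "B *\<^sub>v (adj_mat D *\<^sub>v (E *\<^sub>v y)) = det D \<cdot>\<^sub>v (B *\<^sub>v z)"
    using M(2) z by (simp add: mult_mat_vec[of _ n n])
  also have "\<dots> = (c * det D) \<cdot>\<^sub>v (A *\<^sub>v y)" unfolding eq(2) by (simp add: smult_smult_assoc mult.commute)
  finally show ?thesis unfolding pencil_mult_vec[OF M y] using M y by simp
qed

lemma mat_kernel_trivial:
  fixes A :: "'a::field mat"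
  assumes "A \<in> carrier_mat n n" "det A \<noteq> 0" "y \<in> carrier_vec n" "A *\<^sub>v y = 0\<^sub>v n"
  shows "y = 0\<^sub>v n"
  using det_0_iff_vec_prod_zero_field[OF assms(1)] assms(2-4) by blast

lemma pencil_eigenvalue_unique:
  fixes A :: "'a::field mat"
  assumes M: "A \<in> carrier_mat n n" "B \<in> carrier_mat n n" "D \<in> carrier_mat n n" "E \<in> carrier_mat n n"
    and d: "det A \<noteq> 0" "det D \<noteq> 0" and y: "y \<in> carrier_vec n" "y \<noteq> 0\<^sub>v n"
    and ker: "pencil A B D E c *\<^sub>v y = 0\<^sub>v n" "pencil A B D E c' *\<^sub>v y = 0\<^sub>v n"
  shows "c = c'"
proof (rule ccontr)
  assume ne: "c \<noteq> c'"
  let ?s = "B *\<^sub>v (adj_mat D *\<^sub>v (E *\<^sub>v y))"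
  have aD: "adj_mat D \<in> carrier_mat n n" by (rule adj_mat(1)[OF M(3)])
  have s: "?s \<in> carrier_vec n" and Ay: "A *\<^sub>v y \<in> carrier_vec n" using M aD y by simp_all
  have 1: "?s = (c * det D) \<cdot>\<^sub>v (A *\<^sub>v y)" and 2: "?s = (c' * det D) \<cdot>\<^sub>v (A *\<^sub>v y)"
    using ker vec_minus_eq_zero_iff[of ?s n] s Ay unfolding pencil_mult_vec[OF M y(1)] by simp_all
  have "A *\<^sub>v y = 0\<^sub>v n"
  proof (rule eq_vecI)
    fix i assume "i < dim_vec (0\<^sub>v n :: 'a vec)"
    then have i: "i < n" by simp
    have e1: "?s $ i = c * det D * (A *\<^sub>v y) $ i" by (subst 1) (use i Ay M(1) in simp)
    have e2: "?s $ i = c' * det D * (A *\<^sub>v y) $ i" by (subst 2) (use i Ay M(1) in simp)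
    have "(c - c') * det D * (A *\<^sub>v y) $ i = 0"
      by (simp only: left_diff_distrib trans[OF e1[symmetric] e2] diff_self)
    then show "(A *\<^sub>v y) $ i = 0\<^sub>v n $ i" using ne d(2) i by simp
  qed (use M(1) in simp)
  then show False using mat_kernel_trivial[OF M(1) d(1) y(1)] y(2) by blast
qed

text \<open>The equations of both kernels and the extra condition \<open>l\<close> number at most
  \<open>2 * (k - 1) + 1 < n\<close>, which leaves a common nonzero vector. At the second point it
  is an eigenvector for both scalars.\<close>

lemma pencil_value_stable:
  fixes A :: "'a::field mat"
  assumes M': "A' \<in> carrier_mat n n" "B' \<in> carrier_mat n n" "D' \<in> carrier_mat n n" "E' \<in> carrier_mat n n"
    and d': "det A' \<noteq> 0" "det D' \<noteq> 0" and l: "l \<in> carrier_vec n"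
    and trans: "\<And>y. y \<in> carrier_vec n \<Longrightarrow> l \<bullet> y = 0 \<Longrightarrow> pencil A B D E c *\<^sub>v y = 0\<^sub>v n
      \<Longrightarrow> pencil A' B' D' E' c *\<^sub>v y = 0\<^sub>v n"
    and rk: "rk_lt n k (pencil A B D E c)" "rk_lt n k (pencil A' B' D' E' c')" and k: "2 * k \<le> n"
  shows "c = c'"
proof -
  obtain F where F: "finite F" "F \<subseteq> carrier_vec n" "card F < k"
    "\<And>y. y \<in> carrier_vec n \<Longrightarrow> (\<forall>f\<in>F. f \<bullet> y = 0) \<Longrightarrow> pencil A B D E c *\<^sub>v y = 0\<^sub>v n"
    using rk(1) by (rule rk_ltE) blast
  obtain F' where F': "finite F'" "F' \<subseteq> carrier_vec n" "card F' < k"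
    "\<And>y. y \<in> carrier_vec n \<Longrightarrow> (\<forall>f\<in>F'. f \<bullet> y = 0) \<Longrightarrow> pencil A' B' D' E' c' *\<^sub>v y = 0\<^sub>v n"
    using rk(2) by (rule rk_ltE) blast
  have "card (insert l (F \<union> F')) \<le> Suc (card F + card F')"
    using card_insert_le_m1[of "Suc (card F + card F')" "F \<union> F'" l] card_Un_le[of F F'] by simp
  then have "card (insert l (F \<union> F')) < n" using F(3) F'(3) k by linarith
  then obtain y where y: "y \<in> carrier_vec n" "y \<noteq> 0\<^sub>v n" "\<forall>f\<in>insert l (F \<union> F'). f \<bullet> y = 0"
    using nonzero_solution[of "insert l (F \<union> F')" n] F F' l by auto
  have "pencil A' B' D' E' c *\<^sub>v y = 0\<^sub>v n" using trans[OF y(1)] F(4)[OF y(1)] y(3) by simp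
  moreover have "pencil A' B' D' E' c' *\<^sub>v y = 0\<^sub>v n" using F'(4)[OF y(1)] y(3) by simp
  ultimately show ?thesis using pencil_eigenvalue_unique[OF M' d' y(1,2)] by blast
qed

text \<open>Three eigenspaces of one pencil that are cut out by k - 1, k + 1 and k + 1 equations cannot be
independent when 3 k + 1 < 2 n.\<close>

lemma pencil_no_three_values:
  fixes A :: "'a::field mat"
  assumes M: "A \<in> carrier_mat n n" "B \<in> carrier_mat n n" "D \<in> carrier_mat n n" "E \<in> carrier_mat n n"
    and d: "det A \<noteq> 0" "det D \<noteq> 0"
    and F: "finite F1" "finite F2" "finite F3" "F1 \<subseteq> carrier_vec n" "F2 \<subseteq> carrier_vec n" "F3 \<subseteq> carrier_vec n"
    and cardF: "card F1 + card F2 + card F3 < 2 * n"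
    and ker1: "\<And>y. y \<in> carrier_vec n \<Longrightarrow> (\<forall>f\<in>F1. f \<bullet> y = 0) \<Longrightarrow> pencil A B D E c1 *\<^sub>v y = 0\<^sub>v n"
    and ker2: "\<And>y. y \<in> carrier_vec n \<Longrightarrow> (\<forall>f\<in>F2. f \<bullet> y = 0) \<Longrightarrow> pencil A B D E c2 *\<^sub>v y = 0\<^sub>v n"
    and ker3: "\<And>y. y \<in> carrier_vec n \<Longrightarrow> (\<forall>f\<in>F3. f \<bullet> y = 0) \<Longrightarrow> pencil A B D E c3 *\<^sub>v y = 0\<^sub>v n"
  shows "c1 = c2 \<or> c1 = c3 \<or> c2 = c3"
proof (rule ccontr)
  assume "\<not> ?thesis"
  then have ne: "c1 \<noteq> c2" "c1 \<noteq> c3" "c2 \<noteq> c3" by simp_all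
  \<comment> \<open>One vector \<open>w\<close> of length \<open>2 * n\<close> holds both
    \<open>y\<close> and \<open>z\<close>; the three groups of functionals put \<open>y\<close>,
    \<open>z\<close> and \<open>y + z\<close> into the three kernels.\<close>
  define G where "G = (\<lambda>f. f @\<^sub>v 0\<^sub>v n) ` F1 \<union> (\<lambda>f. 0\<^sub>v n @\<^sub>v f) ` F2 \<union> (\<lambda>f. f @\<^sub>v f) ` F3"
  have finG: "finite G" using F by (simp add: G_def)
  have "card G \<le> card ((\<lambda>f. f @\<^sub>v 0\<^sub>v n) ` F1) + card ((\<lambda>f. 0\<^sub>v n @\<^sub>v f) ` F2) + card ((\<lambda>f. f @\<^sub>v f) ` F3)"
    unfolding G_def by (intro card_Un_le[THEN order_trans] add_mono order_refl)
  also have "\<dots> \<le> card F1 + card F2 + card F3" using F by (intro add_mono card_image_le)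
  finally have cG: "card G < n + n" using cardF by simp
  have subG: "G \<subseteq> carrier_vec (n + n)" using F by (auto simp: G_def)
  obtain w where w: "w \<in> carrier_vec (n + n)" "w \<noteq> 0\<^sub>v (n + n)" "\<forall>g\<in>G. g \<bullet> w = 0"
    using nonzero_solution[OF finG subG cG] by auto
  define y where "y = vec_first w n"
  define z where "z = vec_last w n"
  have y: "y \<in> carrier_vec n" and z: "z \<in> carrier_vec n" and wyz: "w = y @\<^sub>v z"
    unfolding y_def z_def using w(1) by simp_all
  have app: "(a @\<^sub>v b) \<bullet> w = a \<bullet> y + b \<bullet> z" if "a \<in> carrier_vec n" "b \<in> carrier_vec n" for a b
    unfolding wyz using scalar_prod_append[OF that y z] .
  have "f \<bullet> y = 0" if "f \<in> F1" for f
  proof -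
    have "f \<in> carrier_vec n" "(f @\<^sub>v 0\<^sub>v n) \<bullet> w = 0" using that F w(3) by (auto simp: G_def)
    then show ?thesis using app[of f "0\<^sub>v n"] z by simp
  qed
  then have k1: "pencil A B D E c1 *\<^sub>v y = 0\<^sub>v n" using ker1[OF y] by blast
  have "f \<bullet> z = 0" if "f \<in> F2" for f
  proof -
    have "f \<in> carrier_vec n" "(0\<^sub>v n @\<^sub>v f) \<bullet> w = 0" using that F w(3) by (auto simp: G_def)
    then show ?thesis using app[of "0\<^sub>v n" f] y by simp
  qed
  then have k2: "pencil A B D E c2 *\<^sub>v z = 0\<^sub>v n" using ker2[OF z] by blast
  have yz: "y + z \<in> carrier_vec n" using y z by simp
  have "f \<bullet> (y + z) = 0" if "f \<in> F3" for f
  proof -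
    have f: "f \<in> carrier_vec n" and "(f @\<^sub>v f) \<bullet> w = 0" using that F w(3) by (auto simp: G_def)
    then show ?thesis using app[of f f] scalar_prod_add_distrib[OF f y z] by simp
  qed
  then have k3: "pencil A B D E c3 *\<^sub>v (y + z) = 0\<^sub>v n" using ker3[OF yz] by blast
  define s where "s v = B *\<^sub>v (adj_mat D *\<^sub>v (E *\<^sub>v v))" for v
  have aD: "adj_mat D \<in> carrier_mat n n" by (rule adj_mat(1)[OF M(3)])
  have sc: "s v \<in> carrier_vec n" if "v \<in> carrier_vec n" for v using that M aD by (simp add: s_def)
  have eig: "s v = (c * det D) \<cdot>\<^sub>v (A *\<^sub>v v)" if "v \<in> carrier_vec n" "pencil A B D E c *\<^sub>v v = 0\<^sub>v n" for v c
  proof -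
    have "(c * det D) \<cdot>\<^sub>v (A *\<^sub>v v) \<in> carrier_vec n" using M(1) that(1) by simp
    then show ?thesis
      using that(2) vec_minus_eq_zero_iff[OF sc[OF that(1)]] unfolding pencil_mult_vec[OF M that(1)] s_def by simp
  qed
  have sadd: "s (y + z) = s y + s z"
    using y z M aD by (simp add: s_def mult_add_distrib_mat_vec[of _ n n])
  have Aadd: "A *\<^sub>v (y + z) = A *\<^sub>v y + A *\<^sub>v z" using y z M by (simp add: mult_add_distrib_mat_vec[of _ n n])
  \<comment> \<open>Expanding the image of \<open>y + z\<close> in two ways leaves a linear relation
    between the images of \<open>y\<close> and \<open>z\<close> under \<open>A\<close>. Since
    \<open>A\<close> is invertible, \<open>z\<close> is a multiple of \<open>y\<close>, and a
    nonzero vector belonging to both \<open>c1\<close> and \<open>c2\<close> is left over.\<close>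
  have idx: "(c1 - c3) * (A *\<^sub>v y) $ i + (c2 - c3) * (A *\<^sub>v z) $ i = 0" if i: "i < n" for i
  proof -
    have di: "dim_vec (A *\<^sub>v y) = n" "dim_vec (A *\<^sub>v z) = n" using M(1) by simp_all
    have "s (y + z) $ i = c3 * det D * ((A *\<^sub>v y) $ i + (A *\<^sub>v z) $ i)"
      unfolding eig[OF yz k3] Aadd using i di M(1) by simp
    moreover have "s (y + z) $ i = c1 * det D * (A *\<^sub>v y) $ i + c2 * det D * (A *\<^sub>v z) $ i"
      unfolding sadd eig[OF y k1] eig[OF z k2] using i di M(1) by simp
    ultimately have "det D * ((c1 - c3) * (A *\<^sub>v y) $ i + (c2 - c3) * (A *\<^sub>v z) $ i) = 0"
      by (simp add: algebra_simps)
    then show ?thesis using d(2) by simp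
  qed
  have "A *\<^sub>v ((c1 - c3) \<cdot>\<^sub>v y + (c2 - c3) \<cdot>\<^sub>v z) = 0\<^sub>v n"
  proof (rule eq_vecI)
    fix i assume "i < dim_vec (0\<^sub>v n :: 'a vec)"
    then have i: "i < n" by simp
    have "A *\<^sub>v ((c1 - c3) \<cdot>\<^sub>v y + (c2 - c3) \<cdot>\<^sub>v z) = (c1 - c3) \<cdot>\<^sub>v (A *\<^sub>v y) + (c2 - c3) \<cdot>\<^sub>v (A *\<^sub>v z)"
      using M(1) y z by (simp add: mult_add_distrib_mat_vec[of _ n n] mult_mat_vec[of _ n n])
    then show "(A *\<^sub>v ((c1 - c3) \<cdot>\<^sub>v y + (c2 - c3) \<cdot>\<^sub>v z)) $ i = 0\<^sub>v n $ i"
      using idx[OF i] i M(1) by simp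
  qed (use M(1) in simp)
  then have lin: "(c1 - c3) \<cdot>\<^sub>v y + (c2 - c3) \<cdot>\<^sub>v z = 0\<^sub>v n"
    using mat_kernel_trivial[OF M(1) d(1)] y z by simp
  define h where "h = - ((c1 - c3) / (c2 - c3))"
  have zh: "z = h \<cdot>\<^sub>v y"
  proof (rule eq_vecI)
    fix i assume "i < dim_vec (h \<cdot>\<^sub>v y)"
    then have i: "i < n" using y by simp
    have "((c1 - c3) \<cdot>\<^sub>v y + (c2 - c3) \<cdot>\<^sub>v z) $ i = 0" unfolding lin using i by simp
    then have "(c1 - c3) * y $ i + (c2 - c3) * z $ i = 0" using i y z by simp
    then show "z $ i = (h \<cdot>\<^sub>v y) $ i" using ne(3) i y by (simp add: h_def field_simps eq_neg_iff_add_eq_0)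
  qed (use y z in simp)
  have h0: "h \<noteq> 0" using ne by (simp add: h_def)
  show False
  proof (cases "y = 0\<^sub>v n")
    case True
    then have "z = 0\<^sub>v n" unfolding zh by (intro eq_vecI) simp_all
    then have "w = 0\<^sub>v n @\<^sub>v 0\<^sub>v n" using wyz True by simp
    also have "\<dots> = 0\<^sub>v (n + n)" by (intro eq_vecI) auto
    finally show False using w(2) by simp
  next
    case False
    have "pencil A B D E c2 *\<^sub>v z = h \<cdot>\<^sub>v (pencil A B D E c2 *\<^sub>v y)"
      unfolding zh using pencil_carrier[OF M] y by (intro mult_mat_vec) auto
    then have hz: "h \<cdot>\<^sub>v (pencil A B D E c2 *\<^sub>v y) = 0\<^sub>v n" using k2 by simp
    have pc: "pencil A B D E c2 *\<^sub>v y \<in> carrier_vec n" using mult_mat_vec_carrier[OF pencil_carrier[OF M] y] .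
    have "pencil A B D E c2 *\<^sub>v y = 0\<^sub>v n"
    proof (rule eq_vecI)
      fix i assume "i < dim_vec (0\<^sub>v n :: 'a vec)"
      then have i: "i < n" by simp
      have "i < dim_vec (pencil A B D E c2 *\<^sub>v y)" using i by (simp only: carrier_vecD[OF pc])
      from index_smult_vec(1)[OF this, of h]
      have "h * (pencil A B D E c2 *\<^sub>v y) $ i = 0" unfolding hz using i by simp
      then show "(pencil A B D E c2 *\<^sub>v y) $ i = 0\<^sub>v n $ i" using h0 i by simp
    qed (simp only: carrier_vecD[OF pc] index_zero_vec)
    then show False using pencil_eigenvalue_unique[OF M d y False k1] ne(1) by blast
  qed
qed

section \<open>Constancy of the exceptional scalar of a network\<close>

lemma mult_vec_agree_off_col:
  assumes "A \<in> carrier_mat n n" "A' \<in> carrier_mat n n" "y \<in> carrier_vec n" "y $ c0 = 0"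
    and "\<And>r c. r < n \<Longrightarrow> c < n \<Longrightarrow> c \<noteq> c0 \<Longrightarrow> A' $$ (r, c) = A $$ (r, c)"
  shows "A' *\<^sub>v y = A *\<^sub>v y"
proof (rule eq_vecI)
  fix r assume "r < dim_vec (A *\<^sub>v y)"
  then have r: "r < n" using assms(1) by simp
  have "(\<Sum>c\<in>{0..<n}. A' $$ (r, c) * y $ c) = (\<Sum>c\<in>{0..<n}. A $$ (r, c) * y $ c)"
  proof (rule sum.cong[OF refl])
    fix c assume "c \<in> {0..<n}"
    then show "A' $$ (r, c) * y $ c = A $$ (r, c) * y $ c"
      using assms(4) assms(5)[OF r, of c] by (cases "c = c0") simp_all
  qed
  then show "(A' *\<^sub>v y) $ r = (A *\<^sub>v y) $ r" using r assms(1-3) by (simp add: scalar_prod_def)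
qed (use assms in simp)

lemma mult_vec_agree_rank_one:
  fixes A :: "'a::comm_ring_1 mat"
  assumes "A \<in> carrier_mat n n" "A' \<in> carrier_mat n n" "y \<in> carrier_vec n" "vec n w \<bullet> y = 0"
    and "\<And>r c. r < n \<Longrightarrow> c < n \<Longrightarrow> A' $$ (r, c) = A $$ (r, c) + u r * w c"
  shows "A' *\<^sub>v y = A *\<^sub>v y"
proof (rule eq_vecI)
  fix r assume "r < dim_vec (A *\<^sub>v y)"
  then have r: "r < n" using assms(1) by simp
  have 0: "(\<Sum>c\<in>{0..<n}. w c * y $ c) = 0" using assms(3,4) by (simp add: scalar_prod_def)
  have "(\<Sum>c\<in>{0..<n}. A' $$ (r, c) * y $ c) = (\<Sum>c\<in>{0..<n}. A $$ (r, c) * y $ c + u r * (w c * y $ c))"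
    using assms(5)[OF r] by (intro sum.cong) (simp_all add: algebra_simps)
  also have "\<dots> = (\<Sum>c\<in>{0..<n}. A $$ (r, c) * y $ c)"
    unfolding sum.distrib sum_distrib_left[symmetric] 0 by simp
  finally show "(A' *\<^sub>v y) $ r = (A *\<^sub>v y) $ r" using r assms(1-3) by (simp add: scalar_prod_def)
qed (use assms in simp)

lemma polymat_pencil:
  assumes "polymat n n A" "polymat n n B" "polymat n n D" "polymat n n E"
  shows "polymat n n (\<lambda>x. pencil (A x) (B x) (D x) (E x) c)"
  unfolding pencil_def
  by (intro polymat_diff polymat_mult[where b = n] polymat_smult polymat_adj polyfun.mult
      polyfun.const polyfun_det[where n = n] assms)

lemma polymat_finite_support:
  assumes "polymat a b A" shows "\<exists>S. finite S \<and> (\<forall>x y. (\<forall>v\<in>S. x v = y v) \<longrightarrow> A x = A y)"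
proof -
  have "\<forall>p\<in>{..<a} \<times> {..<b}. \<exists>S. finite S \<and> (\<forall>x y. (\<forall>v\<in>S. x v = y v) \<longrightarrow> A x $$ p = A y $$ p)"
  proof
    fix p assume "p \<in> {..<a} \<times> {..<b}"
    then have "polyfun (\<lambda>x. A x $$ p)" using assms by (auto simp: polymat_def)
    then show "\<exists>S. finite S \<and> (\<forall>x y. (\<forall>v\<in>S. x v = y v) \<longrightarrow> A x $$ p = A y $$ p)"
      by (rule polyfun_finite_support)
  qed
  from bchoice[OF this] obtain S where S: "\<forall>p\<in>{..<a} \<times> {..<b}. finite (S p) \<and>
      (\<forall>x y. (\<forall>v\<in>S p. x v = y v) \<longrightarrow> A x $$ p = A y $$ p)" by (elim exE)
  define T where "T = (\<Union>p\<in>{..<a} \<times> {..<b}. S p)"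
  have car: "A x \<in> carrier_mat a b" for x using assms by (simp add: polymat_def)
  have "A x = A y" if xy: "\<forall>v\<in>T. x v = y v" for x y
  proof (rule eq_matI)
    fix i j assume "i < dim_row (A y)" "j < dim_col (A y)"
    then have p: "(i, j) \<in> {..<a} \<times> {..<b}" using car[of y] by simp
    have "\<forall>v\<in>S (i, j). x v = y v" using xy p unfolding T_def by blast
    then show "A x $$ (i, j) = A y $$ (i, j)" using S[rule_format, OF p] by simp
  qed (use car[of x] car[of y] in simp_all)
  moreover have "finite (S p)" if "p \<in> {..<a} \<times> {..<b}" for p using S that by blast
  then have "finite T" unfolding T_def by (intro finite_UN_I) simp_all
  ultimately show ?thesis by (intro exI[of _ T]) simp
qed

text \<open>Source a is precoded through destination b' and observed at b. The triples (3, 1, 2), (2, 2, 3)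
and (3, 3, 2) for (a, b, b') belong to the rank conditions of T_1, T_2 and T_3.\<close>

locale net_square =
  fixes N :: "'v net" and n n1 k a b b' :: nat and TK :: "'k::field itself"
  assumes inf: "infinite (UNIV :: 'k set)"
    and dag: "finite_dag N" and n_gt: "dmax N < n"
    and idx: "a \<in> {2,3}" "b \<in> {1,2,3}" "b' \<in> {1,2,3}" "b \<noteq> b'"
    and dims: "n = n1 + k" "k \<le> n1" "0 < k"
    and paths: "\<exists>es. is_path N (src N 1) (dst N b) es" "\<exists>es. is_path N (src N a) (dst N b) es"
      "\<exists>es. is_path N (src N a) (dst N b') es" "\<exists>es. is_path N (src N 1) (dst N b') es"
begin

abbreviation "MA x \<equiv> Mmat N x n 1 b :: 'k mat"
abbreviation "MB x \<equiv> Mmat N x n a b :: 'k mat"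
abbreviation "MD x \<equiv> Mmat N x n a b' :: 'k mat"
abbreviation "ME x \<equiv> Mmat N x n 1 b' :: 'k mat"

definition Z :: "(var \<Rightarrow> 'k) \<Rightarrow> 'k \<Rightarrow> 'k mat" where
  "Z x c = pencil (MA x) (MB x) (MD x) (ME x) c"

text \<open>Its nonvanishing marks the open set where all four matrices are invertible; there the
  exceptional scalar is unique and is compared along lines.\<close>

definition disc :: "(var \<Rightarrow> 'k) \<Rightarrow> 'k" where
  "disc x = det (MA x) * det (MB x) * det (MD x) * det (ME x)"

lemma Z_carrier [simp]: "Z x c \<in> carrier_mat n n"
  by (simp add: Z_def)

lemma disc_nonzero:
  assumes "disc x \<noteq> 0"
  shows "det (MA x) \<noteq> 0" "det (MB x) \<noteq> 0" "det (MD x) \<noteq> 0" "det (ME x) \<noteq> 0"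
  using assms by (auto simp: disc_def)

lemma two_k: "2 * k \<le> n" using dims by simp

lemma a3: "a \<in> {1,2,3}" "(1::nat) \<in> {1,2,3}" "a \<noteq> 1" using idx by auto

lemma polyfun_disc: "polyfun disc"
proof -
  have "polyfun (\<lambda>x. det (MA x) * det (MB x) * det (MD x) * det (ME x))"
    by (intro polyfun.mult polyfun_det[where n = n] polymat_Mmat)
  then show ?thesis unfolding disc_def[abs_def] .
qed

lemma polyfun_Z_minor:
  assumes "R \<in> carrier_mat k n" "C \<in> carrier_mat n k"
  shows "polyfun (\<lambda>x. det (R * Z x c * C))"
  unfolding Z_def
  by (intro polyfun_det[where n = k] polymat_mult[where b = n] polymat_pencil polymat_Mmat polymat_const assms)

lemma exists_disc_nonzero: "\<exists>x. disc x \<noteq> 0"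
proof -
  have pf: "polyfun (\<lambda>x. det (Mmat N x n i j :: 'k mat))" for i j
    by (rule polyfun_det[where n = n], rule polymat_Mmat)
  have ex: "\<exists>x. det (Mmat N x n i j :: 'k mat) \<noteq> 0"
    if "\<exists>es. is_path N (src N i) (dst N j) es" "i \<in> {1,2,3}" "j \<in> {1,2,3}" for i j
    using exists_invertible_Mmat[OF dag that(2,3) n_gt] that(1) by blast
  obtain x1 where x1: "det (MA x1) \<noteq> 0" using ex[OF paths(1)] a3 idx by blast
  obtain x2 where x2: "det (MB x2) \<noteq> 0" using ex[OF paths(2)] a3 idx by blast
  obtain x3 where x3: "det (MD x3) \<noteq> 0" using ex[OF paths(3)] a3 idx by blast
  obtain x4 where x4: "det (ME x4) \<noteq> 0" using ex[OF paths(4)] a3 idx by blast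
  from polyfun_common_nonzero[where f = "\<lambda>x. det (MA x)" and g = "\<lambda>x. det (MB x)" and x = x1 and y = x2,
      OF inf pf pf x1 x2]
  obtain y1 where y1: "det (MA y1) * det (MB y1) \<noteq> 0" by auto
  from polyfun_common_nonzero[where f = "\<lambda>x. det (MA x) * det (MB x)" and g = "\<lambda>x. det (MD x)" and x = y1 and y = x3,
      OF inf polyfun.mult[OF pf pf] pf y1 x3]
  obtain y2 where y2: "det (MA y2) * det (MB y2) * det (MD y2) \<noteq> 0" by auto
  from polyfun_common_nonzero[where f = "\<lambda>x. det (MA x) * det (MB x) * det (MD x)" and g = "\<lambda>x. det (ME x)"
      and x = y2 and y = x4, OF inf polyfun.mult[OF polyfun.mult[OF pf pf] pf] pf y2 x4]
  show ?thesis unfolding disc_def by auto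
qed

text \<open>The same pair of vectors \<open>y\<close>, \<open>z\<close> is tested at the new point,
  so it suffices that the two equations survive the change of the matrices. No new inverse of
  \<open>MD\<close> enters.\<close>

lemma kernel_transfer:
  assumes d: "disc x \<noteq> 0" and y: "y \<in> carrier_vec n" and ker: "Z x c *\<^sub>v y = 0\<^sub>v n"
    and step: "\<And>z. z \<in> carrier_vec n \<Longrightarrow> MD x *\<^sub>v z = ME x *\<^sub>v y \<Longrightarrow> MB x *\<^sub>v z = c \<cdot>\<^sub>v (MA x *\<^sub>v y)
      \<Longrightarrow> z = inverse (det (MD x)) \<cdot>\<^sub>v ((adj_mat (MD x) * ME x) *\<^sub>v y)
      \<Longrightarrow> MD x' *\<^sub>v z = ME x' *\<^sub>v y \<and> MB x' *\<^sub>v z = c \<cdot>\<^sub>v (MA x' *\<^sub>v y)"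
  shows "Z x' c *\<^sub>v y = 0\<^sub>v n"
proof -
  have "\<exists>z\<in>carrier_vec n. MD x *\<^sub>v z = ME x *\<^sub>v y \<and> MB x *\<^sub>v z = c \<cdot>\<^sub>v (MA x *\<^sub>v y)
      \<and> z = inverse (det (MD x)) \<cdot>\<^sub>v ((adj_mat (MD x) * ME x) *\<^sub>v y)"
    using ker unfolding Z_def
    by (rule pencil_kernel_iff[OF Mmat_carrier Mmat_carrier Mmat_carrier Mmat_carrier disc_nonzero(3)[OF d] y, THEN iffD1])
  then obtain z where z: "z \<in> carrier_vec n" "MD x *\<^sub>v z = ME x *\<^sub>v y" "MB x *\<^sub>v z = c \<cdot>\<^sub>v (MA x *\<^sub>v y)"
    "z = inverse (det (MD x)) \<cdot>\<^sub>v ((adj_mat (MD x) * ME x) *\<^sub>v y)" by (elim bexE conjE)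
  have "MD x' *\<^sub>v z = ME x' *\<^sub>v y \<and> MB x' *\<^sub>v z = c \<cdot>\<^sub>v (MA x' *\<^sub>v y)" by (rule step[OF z])
  then show ?thesis
    unfolding Z_def by (intro pencil_kernelI[OF Mmat_carrier Mmat_carrier Mmat_carrier Mmat_carrier y z(1)]) simp_all
qed

text \<open>A functional \<open>w\<close> on \<open>z\<close> is pulled back to a functional on
  \<open>y\<close> through the map that sends \<open>y\<close> to \<open>z\<close>; this is what
  lets a condition on \<open>z\<close> count as one equation on \<open>y\<close>.\<close>

lemma adj_row_scalar:
  assumes "y \<in> carrier_vec n" "w \<in> carrier_vec n"
    and "(transpose_mat (adj_mat (MD x) * ME x) *\<^sub>v w) \<bullet> y = 0"
    and "z = inverse (det (MD x)) \<cdot>\<^sub>v ((adj_mat (MD x) * ME x) *\<^sub>v y)"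
  shows "w \<bullet> z = 0"
proof -
  have J: "adj_mat (MD x) * ME x \<in> carrier_mat n n"
    using adj_mat(1)[OF Mmat_carrier[of N x n a b']] by simp
  have "w \<bullet> ((adj_mat (MD x) * ME x) *\<^sub>v y) = 0"
    using assms(3) transpose_vec_mult_scalar[OF J assms(1,2)] by simp
  then show ?thesis unfolding assms(4) using J assms(1,2) by simp
qed

lemma value_stable_one_condition:
  assumes d: "disc x \<noteq> 0" "disc x' \<noteq> 0" and l: "l \<in> carrier_vec n"
    and trans: "\<And>y. y \<in> carrier_vec n \<Longrightarrow> l \<bullet> y = 0 \<Longrightarrow> Z x c *\<^sub>v y = 0\<^sub>v n \<Longrightarrow> Z x' c *\<^sub>v y = 0\<^sub>v n"
    and rk: "rk_lt n k (Z x c)" "rk_lt n k (Z x' c')"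
  shows "c = c'"
  using trans rk unfolding Z_def
  by (rule pencil_value_stable[OF Mmat_carrier Mmat_carrier Mmat_carrier Mmat_carrier
        disc_nonzero(1)[OF d(2)] disc_nonzero(3)[OF d(2)] l _ _ _ two_k])

text \<open>A point compared with itself, with the zero functional as extra condition.\<close>

lemma value_unique:
  assumes "disc x \<noteq> 0" "rk_lt n k (Z x c)" "rk_lt n k (Z x c')"
  shows "c = c'"
  by (rule value_stable_one_condition[OF assms(1,1) zero_carrier_vec _ assms(2,3)])

text \<open>Only column \<open>c0\<close> of the matrices of source \<open>i0\<close> changes. For
  source 1 this affects \<open>MA\<close> and \<open>ME\<close>, which act on \<open>y\<close>, and
  the condition is \<open>y $ c0 = 0\<close>. Otherwise only \<open>MB\<close> and \<open>MD\<close>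
  can be affected, which act on \<open>z\<close>, and the condition is \<open>z $ c0 = 0\<close>,
  pulled back to \<open>y\<close>.\<close>

lemma value_stable_src:
  assumes d: "disc x \<noteq> 0" "disc (x((0, i0, e, s) := t)) \<noteq> 0"
    and rk: "rk_lt n k (Z x c)" "rk_lt n k (Z (x((0, i0, e, s) := t)) c')"
  shows "c = c'"
proof -
  let ?x = "x((0, i0, e, s) := t)"
  have n0: "0 < n" using n_gt by simp
  define c0 where "c0 = nat ((int n - 1 - s) mod int n)"
  have c0: "int c0 = (int n - 1 - s) mod int n" "c0 < n" using n0 by (simp_all add: c0_def nat_less_iff)
  have off: "Mmat N ?x n i j $$ (r, q) = Mmat N x n i j $$ (r, q)"
    if "i \<in> {1,2,3}" "j \<in> {1,2,3}" "r < n" "q < n" "q \<noteq> c0" for i j r q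
    by (rule Mmat_upd_src_col[OF dag that(1-4)]) (use that(5) c0 in simp)
  have agree: "Mmat N ?x n i j *\<^sub>v y = Mmat N x n i j *\<^sub>v y"
    if "i \<in> {1,2,3}" "j \<in> {1,2,3}" "y \<in> carrier_vec n" "y $ c0 = 0" for i j y
    by (rule mult_vec_agree_off_col[OF Mmat_carrier Mmat_carrier that(3,4)]) (rule off[OF that(1,2)])
  have other: "Mmat N ?x n i j = Mmat N x n i j" if "i \<noteq> i0" for i j
    by (rule Mmat_upd_src_other[OF that])
  show ?thesis
  proof (cases "i0 = 1")
    case True
    have BD: "MB ?x = MB x" "MD ?x = MD x" using other True a3 by simp_all
    show ?thesis
    proof (rule value_stable_one_condition[OF d _ _ rk])
      show "unit_vec n c0 \<in> carrier_vec n" by simp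
      fix y assume y: "y \<in> carrier_vec n" "unit_vec n c0 \<bullet> y = 0" and ker: "Z x c *\<^sub>v y = 0\<^sub>v n"
      have y0: "y $ c0 = 0" using y c0(2) by simp
      show "Z ?x c *\<^sub>v y = 0\<^sub>v n"
      proof (rule kernel_transfer[OF d(1) y(1) ker])
        fix z assume "MD x *\<^sub>v z = ME x *\<^sub>v y" "MB x *\<^sub>v z = c \<cdot>\<^sub>v (MA x *\<^sub>v y)"
        then show "MD ?x *\<^sub>v z = ME ?x *\<^sub>v y \<and> MB ?x *\<^sub>v z = c \<cdot>\<^sub>v (MA ?x *\<^sub>v y)"
          unfolding BD agree[OF a3(2) idx(2) y(1) y0] agree[OF a3(2) idx(3) y(1) y0] by simp
      qed
    qed
  next
    case False
    have AE: "MA ?x = MA x" "ME ?x = ME x" using other False by simp_all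
    let ?l = "transpose_mat (adj_mat (MD x) * ME x) *\<^sub>v unit_vec n c0"
    have J: "adj_mat (MD x) * ME x \<in> carrier_mat n n"
      using adj_mat(1)[OF Mmat_carrier[of N x n a b']] by simp
    show ?thesis
    proof (rule value_stable_one_condition[OF d _ _ rk])
      show "?l \<in> carrier_vec n" using J by simp
      fix y assume y: "y \<in> carrier_vec n" "?l \<bullet> y = 0" and ker: "Z x c *\<^sub>v y = 0\<^sub>v n"
      show "Z ?x c *\<^sub>v y = 0\<^sub>v n"
      proof (rule kernel_transfer[OF d(1) y(1) ker])
        fix z assume z: "z \<in> carrier_vec n" "MD x *\<^sub>v z = ME x *\<^sub>v y" "MB x *\<^sub>v z = c \<cdot>\<^sub>v (MA x *\<^sub>v y)"
          "z = inverse (det (MD x)) \<cdot>\<^sub>v ((adj_mat (MD x) * ME x) *\<^sub>v y)"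
        have "unit_vec n c0 \<bullet> z = 0" by (rule adj_row_scalar[OF y(1) _ y(2) z(4)]) simp
        then have z0: "z $ c0 = 0" using z(1) c0(2) by simp
        show "MD ?x *\<^sub>v z = ME ?x *\<^sub>v y \<and> MB ?x *\<^sub>v z = c \<cdot>\<^sub>v (MA ?x *\<^sub>v y)"
          unfolding AE agree[OF a3(1) idx(2) z(1) z0] agree[OF a3(1) idx(3) z(1) z0] using z(2,3) by simp
      qed
    qed
  qed
qed

text \<open>Only row \<open>r0\<close> of the matrices at destination \<open>j0\<close> changes.
  Because \<open>b\<close> and \<open>b'\<close> differ, at most one of the two vector equations for
  \<open>y\<close> and \<open>z\<close> is affected, and only in one coordinate, so a single linear
  condition on \<open>y\<close> restores it.\<close>

lemma value_stable_snk:
  assumes d: "disc x \<noteq> 0" "disc (x((2, e, j0, s) := t)) \<noteq> 0"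
    and rk: "rk_lt n k (Z x c)" "rk_lt n k (Z (x((2, e, j0, s) := t)) c')"
  shows "c = c'"
proof -
  let ?x = "x((2, e, j0, s) := t)"
  \<comment> \<open>\<open>nat\<close> sends a negative value to 0. In that case no row below
    \<open>n\<close> changes, and the condition imposed on row 0 does no harm.\<close>
  define r0 where "r0 = nat (int n - 1 - s)"
  have off: "(Mmat N ?x n i j *\<^sub>v y) $ r = (Mmat N x n i j *\<^sub>v y) $ r"
    if r: "r < n" "r \<noteq> r0" and y: "y \<in> carrier_vec n" for i j r y
  proof -
    have "int n - 1 - int r \<noteq> s" using r by (auto simp: r0_def)
    then have "row (Mmat N ?x n i j) r = row (Mmat N x n i j) r"
      using r by (intro eq_vecI) (simp_all add: Mmat_upd_snk_row carrier_matD[OF Mmat_carrier])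
    then show ?thesis using r by (simp add: carrier_matD[OF Mmat_carrier])
  qed
  have other: "Mmat N ?x n i j = Mmat N x n i j" if "j \<noteq> j0" for i j
    by (rule Mmat_upd_snk_other[OF that])
  have aD: "adj_mat (MD x) \<in> carrier_mat n n" by (rule adj_mat(1)[OF Mmat_carrier])
  \<comment> \<open>At \<open>b\<close> the condition is coordinate \<open>r0\<close> of the new
    kernel equation itself. Elsewhere it is coordinate \<open>r0\<close> of the equation between
    \<open>MD\<close> and \<open>ME\<close> at the new point, with \<open>z\<close> replaced by its
    formula at the old point and the denominator cleared.\<close>
  define l where "l = (if r0 < n then if j0 = b then row (Z ?x c) r0
      else row (MD ?x * adj_mat (MD x) * ME x - det (MD x) \<cdot>\<^sub>m ME ?x) r0 else 0\<^sub>v n)"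
  have W1: "MD ?x * adj_mat (MD x) * ME x - det (MD x) \<cdot>\<^sub>m ME ?x \<in> carrier_mat n n"
    by (intro minus_carrier_mat smult_carrier_mat Mmat_carrier)
  have l: "l \<in> carrier_vec n"
  proof (cases "r0 < n")
    case True
    then show ?thesis
      unfolding l_def using row_carrier_vec[OF True Z_carrier[of ?x c]] row_carrier_vec[OF True W1]
      by (cases "j0 = b") (simp_all only: if_True if_False simp_thms)
  next
    case False
    then show ?thesis unfolding l_def by (simp only: if_False zero_carrier_vec)
  qed
  show ?thesis
  proof (rule value_stable_one_condition[OF d l _ rk])
    fix y assume y: "y \<in> carrier_vec n" and ly: "l \<bullet> y = 0" and ker: "Z x c *\<^sub>v y = 0\<^sub>v n"
    show "Z ?x c *\<^sub>v y = 0\<^sub>v n"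
    proof (cases "j0 = b")
      case True
      then have DE: "MD ?x = MD x" "ME ?x = ME x" using other idx(4) by simp_all
      show ?thesis
      proof (rule eq_vecI)
        fix r assume "r < dim_vec (0\<^sub>v n :: 'k vec)"
        then have r: "r < n" by simp
        show "(Z ?x c *\<^sub>v y) $ r = 0\<^sub>v n $ r"
        proof (cases "r = r0")
          case r0: True
          then have "(Z ?x c *\<^sub>v y) $ r = l \<bullet> y"
            using r True Z_carrier[of ?x c] unfolding l_def by (simp add: carrier_matD[OF Z_carrier])
          then show ?thesis using ly r by simp
        next
          case False
          let ?q = "adj_mat (MD x) *\<^sub>v (ME x *\<^sub>v y)"
          have q: "?q \<in> carrier_vec n" by (intro mult_mat_vec_carrier[of _ n n] aD Mmat_carrier y)
          have "(Z ?x c *\<^sub>v y) $ r = (MB ?x *\<^sub>v ?q - (c * det (MD x)) \<cdot>\<^sub>v (MA ?x *\<^sub>v y)) $ r"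
            unfolding Z_def pencil_mult_vec[OF Mmat_carrier Mmat_carrier Mmat_carrier Mmat_carrier y] DE ..
          also have "\<dots> = (MB ?x *\<^sub>v ?q) $ r - c * det (MD x) * (MA ?x *\<^sub>v y) $ r"
            using r by (simp add: carrier_matD[OF Mmat_carrier])
          also have "\<dots> = (MB x *\<^sub>v ?q) $ r - c * det (MD x) * (MA x *\<^sub>v y) $ r"
            unfolding off[OF r False q] off[OF r False y] ..
          also have "\<dots> = (MB x *\<^sub>v ?q - (c * det (MD x)) \<cdot>\<^sub>v (MA x *\<^sub>v y)) $ r"
            using r by (simp add: carrier_matD[OF Mmat_carrier])
          also have "\<dots> = (Z x c *\<^sub>v y) $ r"
            unfolding Z_def pencil_mult_vec[OF Mmat_carrier Mmat_carrier Mmat_carrier Mmat_carrier y] ..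
          finally show ?thesis using ker by simp
        qed
      qed (simp add: carrier_matD[OF Z_carrier])
    next
      case False
      then have AB: "MA ?x = MA x" "MB ?x = MB x" using other by simp_all
      show ?thesis
      proof (rule kernel_transfer[OF d(1) y ker])
        fix z assume z: "z \<in> carrier_vec n" "MD x *\<^sub>v z = ME x *\<^sub>v y" "MB x *\<^sub>v z = c \<cdot>\<^sub>v (MA x *\<^sub>v y)"
          "z = inverse (det (MD x)) \<cdot>\<^sub>v ((adj_mat (MD x) * ME x) *\<^sub>v y)"
        have "MD ?x *\<^sub>v z = ME ?x *\<^sub>v y"
        proof (rule eq_vecI)
          fix r assume "r < dim_vec (ME ?x *\<^sub>v y)"
          then have r: "r < n" by (simp add: carrier_matD[OF Mmat_carrier])
          show "(MD ?x *\<^sub>v z) $ r = (ME ?x *\<^sub>v y) $ r"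
          proof (cases "r = r0")
            case r0: True
            let ?W = "MD ?x * adj_mat (MD x) * ME x" and ?q = "(adj_mat (MD x) * ME x) *\<^sub>v y"
            have W: "?W \<in> carrier_mat n n" by (intro mult_carrier_mat[of _ n n] aD Mmat_carrier)
            have J: "adj_mat (MD x) * ME x \<in> carrier_mat n n" by (intro mult_carrier_mat[of _ n n] aD Mmat_carrier)
            have q: "?q \<in> carrier_vec n" using J y by (rule mult_mat_vec_carrier)
            have Wy: "?W *\<^sub>v y = MD ?x *\<^sub>v ?q"
              unfolding mult3_mat_vec[OF Mmat_carrier aD Mmat_carrier y]
                assoc_mult_mat_vec[OF aD Mmat_carrier y] ..
            have "((?W - det (MD x) \<cdot>\<^sub>m ME ?x) *\<^sub>v y) $ r = 0"
              using ly r r0 False unfolding l_def by (simp add: carrier_matD[OF Mmat_carrier])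
            moreover have "(?W - det (MD x) \<cdot>\<^sub>m ME ?x) *\<^sub>v y = MD ?x *\<^sub>v ?q - det (MD x) \<cdot>\<^sub>v (ME ?x *\<^sub>v y)"
              unfolding Wy[symmetric] smult_mat_mult_vec[OF Mmat_carrier y, symmetric]
              by (rule minus_mult_distrib_mat_vec[OF W _ y]) simp
            ultimately have "(MD ?x *\<^sub>v ?q - det (MD x) \<cdot>\<^sub>v (ME ?x *\<^sub>v y)) $ r = 0" by (simp only:)
            then have eq: "(MD ?x *\<^sub>v ?q) $ r = det (MD x) * (ME ?x *\<^sub>v y) $ r"
              using r by (simp add: carrier_matD[OF Mmat_carrier] del: index_mult_mat_vec)
            have "MD ?x *\<^sub>v z = inverse (det (MD x)) \<cdot>\<^sub>v (MD ?x *\<^sub>v ?q)"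
              unfolding z(4) by (rule mult_mat_vec[OF Mmat_carrier q])
            then have "(MD ?x *\<^sub>v z) $ r = inverse (det (MD x)) * (MD ?x *\<^sub>v ?q) $ r"
              using r by (simp add: carrier_matD[OF Mmat_carrier])
            then show ?thesis unfolding eq using disc_nonzero(3)[OF d(1)] by simp
          next
            case ne: False
            show ?thesis unfolding off[OF r ne z(1)] off[OF r ne y] z(2) ..
          qed
        qed (simp add: carrier_matD[OF Mmat_carrier])
        then show "MD ?x *\<^sub>v z = ME ?x *\<^sub>v y \<and> MB ?x *\<^sub>v z = c \<cdot>\<^sub>v (MA ?x *\<^sub>v y)"
          unfolding AB using z(3) by simp
      qed
    qed
  qed
qed

text \<open>The rank-one change of the four matrices has a row factor \<open>w 1\<close> for source
  1 and \<open>w a\<close> for source \<open>a\<close>. All four products survive if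
  \<open>w 1\<close> kills \<open>y\<close> and \<open>w a\<close> kills \<open>z\<close>; these are
  the two conditions.\<close>

lemma kernel_transfer_mid:
  assumes d: "disc x \<noteq> 0"
  shows "\<exists>l1\<in>carrier_vec n. \<exists>l2\<in>carrier_vec n. \<forall>c. \<forall>y\<in>carrier_vec n. l1 \<bullet> y = 0 \<longrightarrow> l2 \<bullet> y = 0 \<longrightarrow>
    Z x c *\<^sub>v y = 0\<^sub>v n \<longrightarrow> Z (x((1, e, e', s) := t)) c *\<^sub>v y = 0\<^sub>v n"
proof -
  let ?x = "x((1, e, e', s) := t)"
  obtain u w where uw: "\<forall>i\<in>{1,2,3}. \<forall>j\<in>{1,2,3}. \<forall>r<n. \<forall>c<n.
      Mmat N ?x n i j $$ (r, c) = Mmat N x n i j $$ (r, c) + u j r * w i c"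
    using Mmat_upd_mid[OF dag, of n x e e' s t] by (elim exE)
  have agree: "Mmat N ?x n i j *\<^sub>v y = Mmat N x n i j *\<^sub>v y"
    if "i \<in> {1,2,3}" "j \<in> {1,2,3}" "y \<in> carrier_vec n" "vec n (w i) \<bullet> y = 0" for i j y
    by (rule mult_vec_agree_rank_one[where u = "u j" and w = "w i", OF Mmat_carrier Mmat_carrier that(3,4)])
      (rule uw[rule_format, OF that(1,2)])
  have J: "adj_mat (MD x) * ME x \<in> carrier_mat n n"
    using adj_mat(1)[OF Mmat_carrier[of N x n a b']] by simp
  let ?l = "transpose_mat (adj_mat (MD x) * ME x) *\<^sub>v vec n (w a)"
  have ker: "Z ?x c *\<^sub>v y = 0\<^sub>v n"
    if y: "y \<in> carrier_vec n" and l: "vec n (w 1) \<bullet> y = 0" "?l \<bullet> y = 0" and ker: "Z x c *\<^sub>v y = 0\<^sub>v n" for y c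
  proof (rule kernel_transfer[OF d y ker])
    fix z assume z: "z \<in> carrier_vec n" "MD x *\<^sub>v z = ME x *\<^sub>v y" "MB x *\<^sub>v z = c \<cdot>\<^sub>v (MA x *\<^sub>v y)"
      "z = inverse (det (MD x)) \<cdot>\<^sub>v ((adj_mat (MD x) * ME x) *\<^sub>v y)"
    have z0: "vec n (w a) \<bullet> z = 0" by (rule adj_row_scalar[OF y _ l(2) z(4)]) simp
    show "MD ?x *\<^sub>v z = ME ?x *\<^sub>v y \<and> MB ?x *\<^sub>v z = c \<cdot>\<^sub>v (MA ?x *\<^sub>v y)"
      unfolding agree[OF a3(1) idx(2) z(1) z0] agree[OF a3(1) idx(3) z(1) z0]
        agree[OF a3(2) idx(2) y l(1)] agree[OF a3(2) idx(3) y l(1)] using z(2,3) by simp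
  qed
  have "?l \<in> carrier_vec n" using J by simp
  then show ?thesis
    by (intro bexI[of _ "vec n (w 1)"] bexI[of _ ?l] allI ballI impI) (rule ker, simp_all)
qed

text \<open>The kernels at the second and third point are brought back to \<open>x1\<close> at the
  price of two equations each. There they are cut out by at most \<open>k - 1\<close>,
  \<open>k + 1\<close> and \<open>k + 1\<close> equations, and three different eigenvalues would be
  too many.\<close>

lemma values_on_mid_line:
  assumes n3: "3 \<le> n"
    and d: "disc x1 \<noteq> 0" "disc (x1((1, e, e', s) := t2)) \<noteq> 0" "disc (x1((1, e, e', s) := t3)) \<noteq> 0"
    and rk: "rk_lt n k (Z x1 c1)" "rk_lt n k (Z (x1((1, e, e', s) := t2)) c2)" "rk_lt n k (Z (x1((1, e, e', s) := t3)) c3)"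
  shows "c1 = c2 \<or> c1 = c3 \<or> c2 = c3"
proof -
  have pull: "\<exists>F. finite F \<and> F \<subseteq> carrier_vec n \<and> card F \<le> k + 1 \<and>
      (\<forall>y\<in>carrier_vec n. (\<forall>f\<in>F. f \<bullet> y = 0) \<longrightarrow> Z x1 c *\<^sub>v y = 0\<^sub>v n)"
    if dt: "disc (x1((1, e, e', s) := t)) \<noteq> 0" and rkt: "rk_lt n k (Z (x1((1, e, e', s) := t)) c)" for t c
  proof -
    let ?y = "x1((1, e, e', s) := t)"
    \<comment> \<open>Resetting the variable to its old value undoes the move, so the transfer runs
      from the moved point back to \<open>x1\<close>.\<close>
    have x1: "?y((1, e, e', s) := x1 (1, e, e', s)) = x1" by simp
    obtain l1 l2 where l: "l1 \<in> carrier_vec n" "l2 \<in> carrier_vec n"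
      "\<forall>c. \<forall>y\<in>carrier_vec n. l1 \<bullet> y = 0 \<longrightarrow> l2 \<bullet> y = 0 \<longrightarrow> Z ?y c *\<^sub>v y = 0\<^sub>v n \<longrightarrow> Z x1 c *\<^sub>v y = 0\<^sub>v n"
      using kernel_transfer_mid[OF dt, of e e' s "x1 (1, e, e', s)"] unfolding x1 by (elim bexE)
    obtain F where F: "finite F" "F \<subseteq> carrier_vec n" "card F < k"
      "\<And>y. y \<in> carrier_vec n \<Longrightarrow> (\<forall>f\<in>F. f \<bullet> y = 0) \<Longrightarrow> Z ?y c *\<^sub>v y = 0\<^sub>v n"
      using rkt by (rule rk_ltE) blast
    have "card (insert l1 (insert l2 F)) \<le> k + 1"
      using card_insert_le_m1[of "k + 1" "insert l2 F" l1] card_insert_le_m1[of k F l2] F(3) by simp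
    moreover have "Z x1 c *\<^sub>v y = 0\<^sub>v n" if "y \<in> carrier_vec n" "\<forall>f\<in>insert l1 (insert l2 F). f \<bullet> y = 0" for y
      using l(3) F(4)[OF that(1)] that by simp
    moreover have "finite (insert l1 (insert l2 F))" "insert l1 (insert l2 F) \<subseteq> carrier_vec n" using F l by simp_all
    ultimately show ?thesis by (intro exI[of _ "insert l1 (insert l2 F)"]) simp
  qed
  obtain F1 where F1: "finite F1" "F1 \<subseteq> carrier_vec n" "card F1 < k"
    "\<And>y. y \<in> carrier_vec n \<Longrightarrow> (\<forall>f\<in>F1. f \<bullet> y = 0) \<Longrightarrow> Z x1 c1 *\<^sub>v y = 0\<^sub>v n"
    using rk(1) by (rule rk_ltE) blast
  from pull[OF d(2) rk(2)] obtain F2 where F2: "finite F2" "F2 \<subseteq> carrier_vec n" "card F2 \<le> k + 1"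
    "\<forall>y\<in>carrier_vec n. (\<forall>f\<in>F2. f \<bullet> y = 0) \<longrightarrow> Z x1 c2 *\<^sub>v y = 0\<^sub>v n" by (elim exE conjE)
  from pull[OF d(3) rk(3)] obtain F3 where F3: "finite F3" "F3 \<subseteq> carrier_vec n" "card F3 \<le> k + 1"
    "\<forall>y\<in>carrier_vec n. (\<forall>f\<in>F3. f \<bullet> y = 0) \<longrightarrow> Z x1 c3 *\<^sub>v y = 0\<^sub>v n" by (elim exE conjE)
  have F2': "Z x1 c2 *\<^sub>v y = 0\<^sub>v n" if "y \<in> carrier_vec n" "\<forall>f\<in>F2. f \<bullet> y = 0" for y
    using F2(4) that by simp
  have F3': "Z x1 c3 *\<^sub>v y = 0\<^sub>v n" if "y \<in> carrier_vec n" "\<forall>f\<in>F3. f \<bullet> y = 0" for y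
    using F3(4) that by simp
  \<comment> \<open>This is \<open>3 * k + 1 < 2 * n\<close>, which follows from
    \<open>2 * k \<le> n\<close> once \<open>3 \<le> n\<close>; it fails for \<open>n = 2\<close>
    and \<open>k = 1\<close>.\<close>
  have "card F1 + card F2 + card F3 < 2 * n" using F1(3) F2(3) F3(3) two_k n3 dims by linarith
  then show ?thesis
    using F1(4) F2' F3' unfolding Z_def
    by (rule pencil_no_three_values[OF Mmat_carrier Mmat_carrier Mmat_carrier Mmat_carrier
          disc_nonzero(1)[OF d(1)] disc_nonzero(3)[OF d(1)] F1(1) F2(1) F3(1) F1(2) F2(2) F3(2)])
qed

end

context net_square
begin

text \<open>If \<open>c\<close> and \<open>c'\<close> differed, every admissible point of the line
  would have one of these two scalars. All but finitely many points are admissible, so one scalar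
  \<open>g\<close> occurs infinitely often; being a polynomial condition, its rank bound then holds
  on the whole line, in particular at both given points.\<close>

lemma value_stable_mid:
  assumes ex: "\<And>x. disc x \<noteq> 0 \<Longrightarrow> \<exists>c. rk_lt n k (Z x c)"
    and d: "disc x \<noteq> 0" "disc (x((1, e, e', s) := t)) \<noteq> 0"
    and rk: "rk_lt n k (Z x c)" "rk_lt n k (Z (x((1, e, e', s) := t)) c')"
  shows "c = c'"
proof (cases "n \<le> 2")
  case True
  then have "dmax N \<le> 1" using n_gt by simp
  then have "Z (x((1, e, e', s) := t)) c' = Z x c'" unfolding Z_def by (simp only: Mmat_upd_mid_short)
  then show ?thesis using value_unique[OF d(1) rk(1)] rk(2) by simp
next
  case False
  then have n3: "3 \<le> n" by simp
  let ?x = "\<lambda>\<tau>. x((1, e, e', s) := \<tau>)"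
  show ?thesis
  proof (rule ccontr)
    assume ne: "c \<noteq> c'"
    obtain p where p: "\<forall>\<tau>. disc (?x \<tau>) = poly p \<tau>" using polyfun_on_line[OF polyfun_disc, of x "(1, e, e', s)"] by (elim exE)
    have "p \<noteq> 0" using p[rule_format, of t] d(2) by auto
    define T where "T = {\<tau>. disc (?x \<tau>) \<noteq> 0}"
    have "finite {\<tau>. poly p \<tau> = 0}" using poly_roots_finite[OF \<open>p \<noteq> 0\<close>] .
    moreover have "T = UNIV - {\<tau>. poly p \<tau> = 0}" unfolding T_def using p by auto
    ultimately have infT: "infinite T" using inf by (simp add: Diff_infinite_finite)
    let ?V = "\<lambda>g. {\<tau>. rk_lt n k (Z (?x \<tau>) g)}"
    have "T \<subseteq> ?V c \<union> ?V c'"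
    proof
      fix \<tau> assume "\<tau> \<in> T"
      then have d3: "disc (?x \<tau>) \<noteq> 0" by (simp add: T_def)
      obtain g where g: "rk_lt n k (Z (?x \<tau>) g)" using ex[OF d3] by (elim exE)
      have "c = c' \<or> c = g \<or> c' = g" by (rule values_on_mid_line[OF n3 d d3 rk g])
      then show "\<tau> \<in> ?V c \<union> ?V c'" using ne g by auto
    qed
    then have "infinite (?V c \<union> ?V c')" using infT finite_subset by blast
    then have "infinite (?V c) \<or> infinite (?V c')" by simp
    then obtain g where g: "infinite (?V g)" by (elim disjE)
    \<comment> \<open>Each minor is a polynomial in the moved variable with infinitely many zeros,
      hence zero.\<close>
    have all: "rk_lt n k (Z (?x \<tau>) g)" for \<tau>
    proof (rule det_zero_imp_rk_lt[OF Z_carrier])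
      fix R C :: "'k mat" assume R: "R \<in> carrier_mat k n" and C: "C \<in> carrier_mat n k"
      obtain q where q: "\<forall>\<tau>. det (R * Z (?x \<tau>) g * C) = poly q \<tau>"
        using polyfun_on_line[OF polyfun_Z_minor[OF R C], of x "(1, e, e', s)" g] by (elim exE)
      have "q = 0"
      proof (rule ccontr)
        assume "q \<noteq> 0"
        then have "finite {\<tau>. poly q \<tau> = 0}" by (rule poly_roots_finite)
        moreover have "?V g \<subseteq> {\<tau>. poly q \<tau> = 0}"
        proof
          fix \<tau> assume "\<tau> \<in> ?V g"
          then have "rk_lt n k (Z (?x \<tau>) g)" by (simp only: mem_Collect_eq)
          then have "det (R * Z (?x \<tau>) g * C) = 0" by (rule rk_lt_imp_det_zero[OF Z_carrier _ R C])
          then show "\<tau> \<in> {\<tau>. poly q \<tau> = 0}" using q by simp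
        qed
        ultimately show False using g finite_subset by blast
      qed
      then show "det (R * Z (?x \<tau>) g * C) = 0" using q by simp
    qed
    have "rk_lt n k (Z x g)" using all[of "x (1, e, e', s)"] by simp
    then have "g = c" using value_unique[OF d(1) _ rk(1)] by simp
    moreover have "g = c'" by (rule value_unique[OF d(2) all rk(2)])
    ultimately show False using ne by simp
  qed
qed

text \<open>The scalar is unchanged along every coordinate line, with one case for each kind of LEC.
  The entries of V1, A and B do not occur in the pencil. The passage from lines to the whole open
  set needs dependence on finitely many variables only.\<close>

lemma value_const:
  assumes ex: "\<And>x. disc x \<noteq> 0 \<Longrightarrow> \<exists>c. rk_lt n k (Z x c)"
  shows "\<exists>c. \<forall>x. disc x \<noteq> 0 \<longrightarrow> rk_lt n k (Z x c)"
proof -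
  \<comment> \<open>The choice is a function of \<open>Z x\<close>, so it depends on
    \<open>x\<close> only through the four matrices and hence on finitely many variables.\<close>
  define cv where "cv x = (SOME c. rk_lt n k (Z x c))" for x
  have cv: "rk_lt n k (Z x (cv x))" if "disc x \<noteq> 0" for x
    unfolding cv_def using ex[OF that] by (rule someI_ex)
  have sup: "\<exists>S. finite S \<and> (\<forall>x y. (\<forall>v\<in>S. x v = y v) \<longrightarrow> Mmat N x n i j = (Mmat N y n i j :: 'k mat))" for i j
    by (rule polymat_finite_support[OF polymat_Mmat])
  obtain S1 where S1: "finite S1" "\<forall>x y. (\<forall>v\<in>S1. x v = y v) \<longrightarrow> MA x = MA y"
    using sup[of 1 b] by (elim exE conjE)
  obtain S2 where S2: "finite S2" "\<forall>x y. (\<forall>v\<in>S2. x v = y v) \<longrightarrow> MB x = MB y"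
    using sup[of a b] by (elim exE conjE)
  obtain S3 where S3: "finite S3" "\<forall>x y. (\<forall>v\<in>S3. x v = y v) \<longrightarrow> MD x = MD y"
    using sup[of a b'] by (elim exE conjE)
  obtain S4 where S4: "finite S4" "\<forall>x y. (\<forall>v\<in>S4. x v = y v) \<longrightarrow> ME x = ME y"
    using sup[of 1 b'] by (elim exE conjE)
  define S where "S = S1 \<union> S2 \<union> S3 \<union> S4"
  have eqs: "MA x = MA y" "MB x = MB y" "MD x = MD y" "ME x = ME y" if "\<forall>v\<in>S. x v = y v" for x y
    by (rule S1(2)[rule_format], use that in \<open>simp add: S_def\<close>)
      (rule S2(2)[rule_format], use that in \<open>simp add: S_def\<close>,
       rule S3(2)[rule_format], use that in \<open>simp add: S_def\<close>,
       rule S4(2)[rule_format], use that in \<open>simp add: S_def\<close>)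
  have cvS: "cv x = cv y" if "\<forall>v\<in>S. x v = y v" for x y
    unfolding cv_def Z_def by (simp only: eqs[OF that])
  have discS: "disc x = disc y" if "\<forall>v\<in>S. x v = y v" for x y
    unfolding disc_def by (simp only: eqs[OF that])
  have line: "cv (x(v := t)) = cv x" if d: "disc x \<noteq> 0" "disc (x(v := t)) \<noteq> 0" for x v t
  proof -
    obtain v1 v2 v3 s where v: "v = (v1, v2, v3, s)" by (cases v) auto
    note rk = cv[OF d(1)] cv[OF d(2)]
    consider "v1 = 0" | "v1 = 1" | "v1 = 2" | "3 \<le> v1" by linarith
    then have "cv x = cv (x(v := t))"
    proof cases
      case 1
      show ?thesis using d rk unfolding v 1 by (rule value_stable_src)
    next
      case 2
      show ?thesis using d rk unfolding v 2 by (intro value_stable_mid[OF ex])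
    next
      case 3
      show ?thesis using d rk unfolding v 3 by (rule value_stable_snk)
    next
      case 4
      then show ?thesis unfolding cv_def Z_def v by (simp only: Mmat_upd_indet)
    qed
    then show ?thesis by simp
  qed
  obtain x0 where x0: "disc x0 \<noteq> 0" using exists_disc_nonzero by (elim exE)
  have "rk_lt n k (Z x (cv x0))" if "disc x \<noteq> 0" for x
  proof -
    have "finite S" using S1(1) S2(1) S3(1) S4(1) by (simp add: S_def)
    then have "cv x = cv x0"
      by (rule constant_if_constant_on_lines[where c = cv and f = disc, OF inf polyfun_disc _ cvS discS line that x0])
    then show ?thesis using cv[OF that] by simp
  qed
  then show ?thesis by (intro exI[of _ "cv x0"]) simp
qed

text \<open>\<open>low_rank_shift\<close> is applied to \<open>U\<close>, the product of the inverse
  of \<open>MA\<close> with \<open>S\<close>. Multiplication by the invertible \<open>MA\<close>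
  carries joint injectivity for \<open>U\<close> to the form excluded by the hypothesis.\<close>

lemma exists_value:
  assumes no: "\<And>V C. V \<in> carrier_mat n n1 \<Longrightarrow> C \<in> carrier_mat n1 k
      \<Longrightarrow> \<not> jinj (MA x * V) (MB x * adj_mat (MD x) * ME x * V * C)"
    and d: "disc x \<noteq> 0"
  shows "\<exists>c. rk_lt n k (Z x c)"
proof -
  note dA = disc_nonzero(1)[OF d] and dD = disc_nonzero(3)[OF d]
  define A where "A = MA x"
  define S where "S = MB x * adj_mat (MD x) * ME x"
  have aD: "adj_mat (MD x) \<in> carrier_mat n n" by (rule adj_mat(1)[OF Mmat_carrier])
  have A: "A \<in> carrier_mat n n" by (simp add: A_def)
  have S: "S \<in> carrier_mat n n" unfolding S_def by (intro mult_carrier_mat[of _ n n] aD Mmat_carrier)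
  obtain J where J: "J \<in> carrier_mat n n" "A * J = 1\<^sub>m n"
    using det_non_zero_imp_unit[OF A, of "()"] dA unfolding A_def by (auto simp: Units_def ring_mat_simps)
  define U where "U = J * S"
  have U: "U \<in> carrier_mat n n" unfolding U_def by (rule mult_carrier_mat[OF J(1) S])
  have "A * U = A * J * S" unfolding U_def by (rule assoc_mult_mat[OF A J(1) S, symmetric])
  then have AU: "A * U = S" unfolding J(2) using S by simp
  have "\<exists>c. rk_lt n k (U - c \<cdot>\<^sub>m 1\<^sub>m n)"
  proof (rule low_rank_shift[OF inf U dims(1,2)])
    fix V C :: "'k mat" assume V: "V \<in> carrier_mat n n1" and C: "C \<in> carrier_mat n1 k"
    show "\<not> jinj V (U * V * C)"
    proof
      assume j: "jinj V (U * V * C)"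
      have UVC: "U * V * C \<in> carrier_mat n k" by (rule mult_carrier_mat[OF mult_carrier_mat[OF U V] C])
      have AV: "A * V \<in> carrier_mat n n1" by (rule mult_carrier_mat[OF A V])
      have SVC: "S * V * C \<in> carrier_mat n k" by (rule mult_carrier_mat[OF mult_carrier_mat[OF S V] C])
      have "S * V * C = A * U * V * C" by (simp only: AU)
      also have "\<dots> = A * (U * V) * C" by (simp only: assoc_mult_mat[OF A U V])
      also have "\<dots> = A * (U * V * C)" by (rule assoc_mult_mat[OF A mult_carrier_mat[OF U V] C])
      finally have eq: "S * V * C = A * (U * V * C)" .
      have "jinj (A * V) (S * V * C)" unfolding jinj_def
      proof (intro ballI impI)
        fix p q assume "p \<in> carrier_vec (dim_col (A * V))" "q \<in> carrier_vec (dim_col (S * V * C))"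
          and 0: "A * V *\<^sub>v p + S * V * C *\<^sub>v q = 0\<^sub>v (dim_row (A * V))"
        then have p: "p \<in> carrier_vec n1" and q: "q \<in> carrier_vec k"
          using carrier_matD[OF AV] carrier_matD[OF SVC] by simp_all
        let ?y = "V *\<^sub>v p + U * V * C *\<^sub>v q"
        have Vp: "V *\<^sub>v p \<in> carrier_vec n" by (rule mult_mat_vec_carrier[OF V p])
        have Uq: "U * V * C *\<^sub>v q \<in> carrier_vec n" by (rule mult_mat_vec_carrier[OF UVC q])
        have "A *\<^sub>v ?y = A *\<^sub>v (V *\<^sub>v p) + A *\<^sub>v (U * V * C *\<^sub>v q)" by (rule mult_add_distrib_mat_vec[OF A Vp Uq])
        also have "\<dots> = A * V *\<^sub>v p + S * V * C *\<^sub>v q"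
          unfolding eq assoc_mult_mat_vec[OF A V p] assoc_mult_mat_vec[OF A UVC q] ..
        also have "\<dots> = 0\<^sub>v n" using 0 carrier_matD(1)[OF AV] by simp
        finally have "?y = 0\<^sub>v n"
          using mat_kernel_trivial[OF A _ add_carrier_vec[OF Vp Uq]] dA unfolding A_def by simp
        then have "p = 0\<^sub>v n1 \<and> q = 0\<^sub>v k"
          using j p q unfolding jinj_def carrier_matD[OF V] carrier_matD[OF UVC] by simp
        then show "p = 0\<^sub>v (dim_col (A * V)) \<and> q = 0\<^sub>v (dim_col (S * V * C))"
          using carrier_matD[OF AV] carrier_matD[OF SVC] by simp
      qed
      then show False using no[OF V C] unfolding A_def S_def by simp
    qed
  qed
  then obtain c where c: "rk_lt n k (U - c \<cdot>\<^sub>m 1\<^sub>m n)" by (elim exE)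
  obtain F where F: "finite F" "F \<subseteq> carrier_vec n" "card F < k"
    "\<And>y. y \<in> carrier_vec n \<Longrightarrow> (\<forall>f\<in>F. f \<bullet> y = 0) \<Longrightarrow> (U - c \<cdot>\<^sub>m 1\<^sub>m n) *\<^sub>v y = 0\<^sub>v n"
    using c by (rule rk_ltE) blast
  have "Z x (c / det (MD x)) *\<^sub>v y = 0\<^sub>v n" if y: "y \<in> carrier_vec n" and f: "\<forall>f\<in>F. f \<bullet> y = 0" for y
  proof -
    have Uy: "U *\<^sub>v y \<in> carrier_vec n" by (rule mult_mat_vec_carrier[OF U y])
    have "(U - c \<cdot>\<^sub>m 1\<^sub>m n) *\<^sub>v y = U *\<^sub>v y - (c \<cdot>\<^sub>m 1\<^sub>m n) *\<^sub>v y"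
      by (rule minus_mult_distrib_mat_vec[OF U _ y]) simp
    also have "(c \<cdot>\<^sub>m 1\<^sub>m n) *\<^sub>v y = c \<cdot>\<^sub>v y" unfolding smult_mat_mult_vec[OF one_carrier_mat y] using y by simp
    finally have "U *\<^sub>v y = c \<cdot>\<^sub>v y"
      using F(4)[OF y f] vec_minus_eq_zero_iff[OF Uy, of "c \<cdot>\<^sub>v y"] y by simp
    then have "A *\<^sub>v (U *\<^sub>v y) = c \<cdot>\<^sub>v (A *\<^sub>v y)" using mult_mat_vec[OF A y] by simp
    then have Sy: "S *\<^sub>v y = c \<cdot>\<^sub>v (A *\<^sub>v y)" using assoc_mult_mat_vec[OF A U y] unfolding AU by simp
    \<comment> \<open>The pencil multiplies its scalar by the determinant of \<open>MD\<close>, so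
      the eigenvalue \<open>c\<close> of \<open>U\<close> is divided by it.\<close>
    have cd: "c / det (MD x) * det (MD x) = c" using dD by simp
    have cAy: "c \<cdot>\<^sub>v (A *\<^sub>v y) \<in> carrier_vec n" using A y by simp
    have "Z x (c / det (MD x)) *\<^sub>v y = S *\<^sub>v y - c \<cdot>\<^sub>v (A *\<^sub>v y)"
      unfolding Z_def pencil_mult_vec[OF Mmat_carrier Mmat_carrier Mmat_carrier Mmat_carrier y] cd S_def
        mult3_mat_vec[OF Mmat_carrier aD Mmat_carrier y] A_def ..
    then show ?thesis unfolding Sy using cAy by simp
  qed
  then have "rk_lt n k (Z x (c / det (MD x)))" unfolding rk_lt_def using F(1-3) by (intro exI[of _ F]) simp
  then show ?thesis by (rule exI)
qed

text \<open>A minor of the pencil vanishes wherever \<open>disc\<close> does not. As two nonzero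
  polynomial functions have a common point of nonvanishing, the minor vanishes everywhere, also
  where the four matrices are singular.\<close>

lemma singular_everywhere_imp_low_rank:
  assumes no: "\<And>x V C. V \<in> carrier_mat n n1 \<Longrightarrow> C \<in> carrier_mat n1 k
      \<Longrightarrow> \<not> jinj (MA x * V) (MB x * adj_mat (MD x) * ME x * V * C)"
  shows "\<exists>c. c \<noteq> 0 \<and> (\<forall>x. \<forall>R\<in>carrier_mat k n. \<forall>C\<in>carrier_mat n k.
    det (R * pencil (MA x) (MB x) (MD x) (ME x) c * C) = 0)"
proof -
  have "\<exists>c. \<forall>x. disc x \<noteq> 0 \<longrightarrow> rk_lt n k (Z x c)"
    by (rule value_const) (rule exists_value[OF no])
  then obtain c where c: "\<forall>x. disc x \<noteq> 0 \<longrightarrow> rk_lt n k (Z x c)" by (elim exE)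
  obtain x0 where x0: "disc x0 \<noteq> 0" using exists_disc_nonzero by (elim exE)
  \<comment> \<open>With scalar 0 the pencil at \<open>x0\<close> is a product of invertible
    matrices, whereas a rank below \<open>k \<le> n\<close> provides a nonzero kernel
    vector.\<close>
  have "c \<noteq> 0"
  proof
    assume c0: "c = 0"
    have "rk_lt n k (Z x0 0)" using c x0 c0 by simp
    then obtain F where F: "finite F" "F \<subseteq> carrier_vec n" "card F < k"
      "\<And>y. y \<in> carrier_vec n \<Longrightarrow> (\<forall>f\<in>F. f \<bullet> y = 0) \<Longrightarrow> Z x0 0 *\<^sub>v y = 0\<^sub>v n"
      by (rule rk_ltE) blast
    have "card F < n" using F(3) dims by simp
    then obtain y where y: "y \<in> carrier_vec n" "y \<noteq> 0\<^sub>v n" "\<forall>f\<in>F. f \<bullet> y = 0"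
      using nonzero_solution[OF F(1,2)] by auto
    have "Z x0 0 *\<^sub>v y = 0\<^sub>v n" by (rule F(4)[OF y(1,3)])
    then obtain z where z: "z \<in> carrier_vec n" "MD x0 *\<^sub>v z = ME x0 *\<^sub>v y" "MB x0 *\<^sub>v z = 0 \<cdot>\<^sub>v (MA x0 *\<^sub>v y)"
      unfolding Z_def pencil_kernel_iff[OF Mmat_carrier Mmat_carrier Mmat_carrier Mmat_carrier disc_nonzero(3)[OF x0] y(1)]
      by (elim bexE conjE)
    have "MB x0 *\<^sub>v z = 0\<^sub>v n" unfolding z(3) by (intro eq_vecI) (simp_all add: carrier_matD[OF Mmat_carrier])
    then have "z = 0\<^sub>v n" by (rule mat_kernel_trivial[OF Mmat_carrier disc_nonzero(2)[OF x0] z(1)])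
    then have "MD x0 *\<^sub>v z = 0\<^sub>v n"
      by (intro eq_vecI) (simp_all add: carrier_matD[OF Mmat_carrier])
    then have "ME x0 *\<^sub>v y = 0\<^sub>v n" using z(2) by simp
    then show False using mat_kernel_trivial[OF Mmat_carrier disc_nonzero(4)[OF x0] y(1)] y(2) by simp
  qed
  moreover have "det (R * Z x c * C) = 0" if R: "R \<in> carrier_mat k n" and C: "C \<in> carrier_mat n k" for x R C
  proof (rule ccontr)
    assume nz: "det (R * Z x c * C) \<noteq> 0"
    from polyfun_common_nonzero[where f = disc and g = "\<lambda>x. det (R * Z x c * C)" and x = x0 and y = x,
        OF inf polyfun_disc polyfun_Z_minor[OF R C] x0 nz]
    obtain z where z: "disc z \<noteq> 0" "det (R * Z z c * C) \<noteq> 0" by (elim exE conjE)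
    then show False using rk_lt_imp_det_zero[OF Z_carrier _ R C] c by simp
  qed
  ultimately show ?thesis unfolding Z_def by (intro exI[of _ c]) simp
qed

end

section \<open>Passing between rational functions and points\<close>

lemma hcat_map_mat:
  assumes "A \<in> carrier_mat n a" "B \<in> carrier_mat n b"
  shows "hcat (map_mat h A) (map_mat h B) = map_mat h (hcat A B)"
  using assms by (intro eq_matI) (auto simp: hcat_def)

lemma adj_mat_map_mat:
  assumes "comm_ring_hom h" and A: "A \<in> carrier_mat n n"
  shows "adj_mat (map_mat h A) = map_mat h (adj_mat A)"
proof -
  interpret comm_ring_hom h by (rule assms(1))
  have del: "mat_delete (map_mat h A) i j = map_mat h (mat_delete A i j)" if "i < n" "j < n" for i j
    using A that by (intro eq_matI) (auto simp: mat_delete_def)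
  show ?thesis
  proof (rule eq_matI)
    fix i j assume "i < dim_row (map_mat h (adj_mat A))" "j < dim_col (map_mat h (adj_mat A))"
    then have ij: "i < n" "j < n" using A by (simp_all add: adj_mat_def)
    then show "adj_mat (map_mat h A) $$ (i, j) = map_mat h (adj_mat A) $$ (i, j)"
      using A by (simp add: adj_mat_def cofactor_def del hom_mult hom_power hom_uminus)
  qed (use A in \<open>simp_all add: adj_mat_def\<close>)
qed

lemma to_fract_hom: "comm_ring_hom (to_fract :: 'a::idom \<Rightarrow> 'a fract)"
  by unfold_locales simp_all

lemma common_denominator:
  fixes S :: "'a::idom fract set"
  assumes "finite S"
  shows "\<exists>d. d \<noteq> 0 \<and> (\<forall>s\<in>S. \<exists>a. s * to_fract d = to_fract a)"
  using assms
proof (induction S rule: finite_induct)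
  case empty
  show ?case by (rule exI[of _ 1]) simp
next
  case (insert s S)
  then obtain d where d: "d \<noteq> 0" "\<forall>s\<in>S. \<exists>a. s * to_fract d = to_fract a" by blast
  obtain a b where ab: "s = Fract a b" "b \<noteq> 0" by (cases s) auto
  have sb: "s * to_fract b = to_fract a" using ab by (simp add: to_fract_def eq_fract)
  have "\<exists>a. u * to_fract (b * d) = to_fract a" if u: "u \<in> insert s S" for u
  proof (cases "u = s")
    case True
    have "u * to_fract (b * d) = to_fract (a * d)" using True sb by (simp add: mult.assoc[symmetric])
    then show ?thesis by blast
  next
    case False
    then obtain a' where "u * to_fract d = to_fract a'" using d(2) u by blast
    then have "u * to_fract (b * d) = to_fract (a' * b)" by (simp add: algebra_simps)
    then show ?thesis by blast
  qed
  then show ?case using d(1) ab(2) by (intro exI[of _ "b * d"]) auto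
qed

text \<open>A left inverse over the rational functions, multiplied by a common denominator
  \<open>d\<close>, becomes a polynomial matrix \<open>L'\<close> with
  \<open>L' * H = d \<cdot>\<^sub>m 1\<^sub>m m\<close>. This identity can be evaluated, and it
  proves injectivity wherever \<open>d\<close> does not vanish.\<close>

lemma jinj_generic_imp_jinj_at_points:
  fixes A B :: "(('x::linorder \<Rightarrow>\<^sub>0 nat) \<Rightarrow>\<^sub>0 'a::field) mat"
  assumes A: "A \<in> carrier_mat n a" and B: "B \<in> carrier_mat n b"
    and j: "jinj (map_mat to_fract A) (map_mat to_fract B)"
  shows "\<exists>d. d \<noteq> 0 \<and> (\<forall>\<alpha>. ac_eval \<alpha> d \<noteq> 0 \<longrightarrow> jinj (map_mat (ac_eval \<alpha>) A) (map_mat (ac_eval \<alpha>) B))"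
proof -
  interpret F: comm_ring_hom "to_fract :: (('x \<Rightarrow>\<^sub>0 nat) \<Rightarrow>\<^sub>0 'a) \<Rightarrow> _" by (rule to_fract_hom)
  define H where "H = hcat A B"
  define m where "m = a + b"
  have H: "H \<in> carrier_mat n m" unfolding H_def m_def by (rule hcat_carrier[OF A B])
  have mA: "map_mat h A \<in> carrier_mat n a" and mB: "map_mat h B \<in> carrier_mat n b" for h using A B by simp_all
  have HF: "map_mat to_fract H \<in> carrier_mat n m" using H by simp
  have hc: "hcat (map_mat h A) (map_mat h B) = map_mat h H" for h
    unfolding H_def by (rule hcat_map_mat[OF A B])
  have "\<exists>L\<in>carrier_mat m n. L * map_mat to_fract H = 1\<^sub>m m"
  proof (rule injective_left_inverse[OF HF])
    fix v assume "v \<in> carrier_vec m" "map_mat to_fract H *\<^sub>v v = 0\<^sub>v n"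
    then show "v = 0\<^sub>v m" using j unfolding jinj_iff_hcat[OF mA mB] hc m_def by simp
  qed
  then obtain L where L: "L \<in> carrier_mat m n" "L * map_mat to_fract H = 1\<^sub>m m" by (elim bexE)
  have "finite ((\<lambda>p. L $$ p) ` ({..<m} \<times> {..<n}))" by simp
  from common_denominator[OF this] obtain d where d: "d \<noteq> 0"
    and den: "\<forall>s\<in>(\<lambda>p. L $$ p) ` ({..<m} \<times> {..<n}). \<exists>a. s * to_fract d = to_fract a" by (elim exE conjE)
  have "\<forall>p\<in>{..<m} \<times> {..<n}. \<exists>a. L $$ p * to_fract d = to_fract a" using den by simp
  from bchoice[OF this] obtain f where f: "\<forall>p\<in>{..<m} \<times> {..<n}. L $$ p * to_fract d = to_fract (f p)" by (elim exE)
  define L' where "L' = mat m n f"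
  have L': "L' \<in> carrier_mat m n" by (simp add: L'_def)
  have mL': "map_mat to_fract L' = to_fract d \<cdot>\<^sub>m L"
    using L(1) f by (intro eq_matI) (auto simp: L'_def mult.commute)
  have "map_mat to_fract (L' * H) = map_mat to_fract L' * map_mat to_fract H" by (rule F.mat_hom_mult[OF L' H])
  also have "\<dots> = to_fract d \<cdot>\<^sub>m (L * map_mat to_fract H)" unfolding mL' by (rule mult_smult_assoc_mat[OF L(1) HF])
  also have "\<dots> = map_mat to_fract (d \<cdot>\<^sub>m 1\<^sub>m m)" unfolding L(2) by (intro eq_matI) auto
  finally have "map_mat to_fract (L' * H) = map_mat to_fract (d \<cdot>\<^sub>m 1\<^sub>m m)" .
  then have L'H: "L' * H = d \<cdot>\<^sub>m 1\<^sub>m m"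
  proof (intro eq_matI)
    fix i j assume eq: "map_mat to_fract (L' * H) = map_mat to_fract (d \<cdot>\<^sub>m 1\<^sub>m m)"
      and "i < dim_row (d \<cdot>\<^sub>m 1\<^sub>m m)" "j < dim_col (d \<cdot>\<^sub>m 1\<^sub>m m)"
    then have ij: "i < m" "j < m" by simp_all
    have "to_fract ((L' * H) $$ (i, j)) = map_mat to_fract (L' * H) $$ (i, j)" using ij L' H by simp
    also have "\<dots> = to_fract ((d \<cdot>\<^sub>m 1\<^sub>m m) $$ (i, j))" unfolding eq using ij by simp
    finally show "(L' * H) $$ (i, j) = (d \<cdot>\<^sub>m 1\<^sub>m m) $$ (i, j)" by (simp only: to_fract_eq_iff)
  qed (use L' H in simp_all)
  have "jinj (map_mat (ac_eval \<alpha>) A) (map_mat (ac_eval \<alpha>) B)" if nz: "ac_eval \<alpha> d \<noteq> 0" for \<alpha>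
    unfolding jinj_iff_hcat[OF mA mB] hc
  proof (intro ballI impI)
    interpret E: comm_ring_hom "ac_eval \<alpha>" by (rule ac_eval_hom)
    fix v assume v: "v \<in> carrier_vec (a + b)" and 0: "map_mat (ac_eval \<alpha>) H *\<^sub>v v = 0\<^sub>v n"
    have v': "v \<in> carrier_vec m" using v by (simp add: m_def)
    have EH: "map_mat (ac_eval \<alpha>) H \<in> carrier_mat n m" and EL: "map_mat (ac_eval \<alpha>) L' \<in> carrier_mat m n"
      using H L' by simp_all
    have "map_mat (ac_eval \<alpha>) L' * map_mat (ac_eval \<alpha>) H = map_mat (ac_eval \<alpha>) (d \<cdot>\<^sub>m 1\<^sub>m m)"
      unfolding E.mat_hom_mult[OF L' H, symmetric] L'H ..
    also have "\<dots> = ac_eval \<alpha> d \<cdot>\<^sub>m 1\<^sub>m m" by (intro eq_matI) auto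
    finally have *: "map_mat (ac_eval \<alpha>) L' * map_mat (ac_eval \<alpha>) H = ac_eval \<alpha> d \<cdot>\<^sub>m 1\<^sub>m m" .
    have "ac_eval \<alpha> d \<cdot>\<^sub>v v = (map_mat (ac_eval \<alpha>) L' * map_mat (ac_eval \<alpha>) H) *\<^sub>v v"
      unfolding * smult_mat_mult_vec[OF one_carrier_mat v'] using v' by simp
    also have "\<dots> = map_mat (ac_eval \<alpha>) L' *\<^sub>v 0\<^sub>v n"
      unfolding assoc_mult_mat_vec[OF EL EH v'] 0 ..
    also have "\<dots> = 0\<^sub>v m" using EL by (intro eq_vecI) auto
    finally have z: "ac_eval \<alpha> d \<cdot>\<^sub>v v = 0\<^sub>v m" .
    show "v = 0\<^sub>v (a + b)"
    proof (rule eq_vecI)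
      fix i assume "i < dim_vec (0\<^sub>v (a + b) :: 'a alg_closure vec)"
      then have i: "i < m" by (simp add: m_def)
      have "(ac_eval \<alpha> d \<cdot>\<^sub>v v) $ i = 0" unfolding z using i by simp
      then show "v $ i = 0\<^sub>v (a + b) $ i" using nz i v' by (simp add: m_def)
    qed (use v in simp)
  qed
  then show ?thesis using d by (intro exI[of _ d]) simp
qed

text \<open>In the square case injectivity is the nonvanishing of one determinant, and a polynomial
  with a nonzero value is nonzero. This is where the necessity part uses that the block dimensions
  add up to \<open>n\<close>.\<close>

lemma jinj_at_point_imp_jinj_generic:
  fixes A B :: "(('x::linorder \<Rightarrow>\<^sub>0 nat) \<Rightarrow>\<^sub>0 'a::field) mat"
  assumes A: "A \<in> carrier_mat n a" and B: "B \<in> carrier_mat n b" and ab: "a + b = n"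
    and j: "jinj (map_mat (ac_eval \<alpha>) A) (map_mat (ac_eval \<alpha>) B)"
  shows "jinj (map_mat to_fract A) (map_mat to_fract B)"
proof -
  interpret F: comm_ring_hom "to_fract :: (('x \<Rightarrow>\<^sub>0 nat) \<Rightarrow>\<^sub>0 'a) \<Rightarrow> _" by (rule to_fract_hom)
  interpret E: comm_ring_hom "ac_eval \<alpha>" by (rule ac_eval_hom)
  have mA: "map_mat h A \<in> carrier_mat n a" and mB: "map_mat h B \<in> carrier_mat n b" for h using A B by simp_all
  have "ac_eval \<alpha> (det (hcat A B)) \<noteq> 0"
    using j unfolding jinj_square_iff_det[OF mA mB ab] hcat_map_mat[OF A B] E.hom_det .
  then have "det (hcat A B) \<noteq> 0" by (auto simp: ac_eval_zero)
  then show ?thesis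
    unfolding jinj_square_iff_det[OF mA mB ab] hcat_map_mat[OF A B] F.hom_det by simp
qed

lemma minv:
  assumes A: "A \<in> carrier_mat n n" and d: "det A \<noteq> 0"
  shows "minv A \<in> carrier_mat n n" "A * minv A = 1\<^sub>m n" "minv A * A = 1\<^sub>m n"
proof -
  have "mat_inverse A \<noteq> None"
    using mat_inverse(1)[OF A, of "()"] det_non_zero_imp_unit[OF A d, of "()"] by auto
  then obtain B where "mat_inverse A = Some B" by auto
  then show "minv A \<in> carrier_mat n n" "A * minv A = 1\<^sub>m n" "minv A * A = 1\<^sub>m n"
    using mat_inverse(2)[OF A] by (simp_all add: minv_def)
qed

lemma minv_eq_adj:
  assumes A: "A \<in> carrier_mat n n" and d: "det A \<noteq> 0"
  shows "minv A = inverse (det A) \<cdot>\<^sub>m adj_mat A"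
proof -
  note aA = adj_mat[OF A]
  have "inverse (det A) \<cdot>\<^sub>m (A * adj_mat A) = 1\<^sub>m n"
    unfolding aA(2) by (intro eq_matI) (use d in simp_all)
  then have "minv A = minv A * (inverse (det A) \<cdot>\<^sub>m (A * adj_mat A))"
    using right_mult_one_mat[OF minv(1)[OF A d]] by simp
  also have "\<dots> = inverse (det A) \<cdot>\<^sub>m (minv A * (A * adj_mat A))"
    by (rule mult_smult_distrib[OF minv(1)[OF A d] mult_carrier_mat[OF A aA(1)]])
  also have "minv A * (A * adj_mat A) = minv A * A * adj_mat A"
    by (rule assoc_mult_mat[OF minv(1)[OF A d] A aA(1), symmetric])
  also have "\<dots> = adj_mat A" unfolding minv(3)[OF A d] using aA(1) by simp
  finally show ?thesis .
qed

lemma jinj_mult_left: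
  fixes A :: "'a::field mat"
  assumes A: "A \<in> carrier_mat n n" and d: "det A \<noteq> 0"
    and V: "V \<in> carrier_mat n a" and W: "W \<in> carrier_mat n b"
  shows "jinj (A * V) (A * W) \<longleftrightarrow> jinj V W"
proof -
  have "A * V *\<^sub>v p + A * W *\<^sub>v q = 0\<^sub>v n \<longleftrightarrow> V *\<^sub>v p + W *\<^sub>v q = 0\<^sub>v n"
    if p: "p \<in> carrier_vec a" and q: "q \<in> carrier_vec b" for p q
  proof -
    have Vp: "V *\<^sub>v p \<in> carrier_vec n" and Wq: "W *\<^sub>v q \<in> carrier_vec n"
      using mult_mat_vec_carrier[OF V p] mult_mat_vec_carrier[OF W q] .
    have "A * V *\<^sub>v p + A * W *\<^sub>v q = A *\<^sub>v (V *\<^sub>v p + W *\<^sub>v q)"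
      unfolding assoc_mult_mat_vec[OF A V p] assoc_mult_mat_vec[OF A W q] mult_add_distrib_mat_vec[OF A Vp Wq] ..
    moreover have "A *\<^sub>v 0\<^sub>v n = 0\<^sub>v n" using A by (intro eq_vecI) auto
    ultimately show ?thesis using mat_kernel_trivial[OF A d add_carrier_vec[OF Vp Wq]] by auto
  qed
  then show ?thesis using A V W unfolding jinj_def by simp
qed

lemma jinj_smult_right:
  fixes V :: "'a::field mat"
  assumes V: "V \<in> carrier_mat n a" and W: "W \<in> carrier_mat n b" and c: "c \<noteq> 0" and j: "jinj V W"
  shows "jinj V (c \<cdot>\<^sub>m W)"
  unfolding jinj_def
proof (intro ballI impI)
  fix p q assume "p \<in> carrier_vec (dim_col V)" "q \<in> carrier_vec (dim_col (c \<cdot>\<^sub>m W))"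
    and 0: "V *\<^sub>v p + c \<cdot>\<^sub>m W *\<^sub>v q = 0\<^sub>v (dim_row V)"
  then have p: "p \<in> carrier_vec a" and q: "q \<in> carrier_vec b" using V W by simp_all
  have "c \<cdot>\<^sub>m W *\<^sub>v q = W *\<^sub>v (c \<cdot>\<^sub>v q)" unfolding smult_mat_mult_vec[OF W q] mult_mat_vec[OF W q] ..
  then have "V *\<^sub>v p + W *\<^sub>v (c \<cdot>\<^sub>v q) = 0\<^sub>v n" using 0 V by simp
  moreover have "\<forall>p\<in>carrier_vec a. \<forall>q\<in>carrier_vec b. V *\<^sub>v p + W *\<^sub>v q = 0\<^sub>v n \<longrightarrow> p = 0\<^sub>v a \<and> q = 0\<^sub>v b"
    using j V W unfolding jinj_def by simp
  moreover have "c \<cdot>\<^sub>v q \<in> carrier_vec b" using q by simp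
  ultimately have pq: "p = 0\<^sub>v a \<and> c \<cdot>\<^sub>v q = 0\<^sub>v b" using p by blast
  have "q = 0\<^sub>v b"
  proof (rule eq_vecI)
    fix i assume "i < dim_vec (0\<^sub>v b :: 'a vec)"
    then have i: "i < b" by simp
    have "(c \<cdot>\<^sub>v q) $ i = 0" using pq i by simp
    then show "q $ i = 0\<^sub>v b $ i" using c i q by simp
  qed (use q in simp)
  then show "p = 0\<^sub>v (dim_col V) \<and> q = 0\<^sub>v (dim_col (c \<cdot>\<^sub>m W))" using pq V W by simp
qed

lemma jinj_smult_right_iff:
  fixes V :: "'a::field mat"
  assumes V: "V \<in> carrier_mat n a" and W: "W \<in> carrier_mat n b" and c: "c \<noteq> 0"
  shows "jinj V (c \<cdot>\<^sub>m W) \<longleftrightarrow> jinj V W"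
proof
  assume "jinj V (c \<cdot>\<^sub>m W)"
  from jinj_smult_right[OF V smult_carrier_mat[OF W] _ this, of "inverse c"]
  have "jinj V (inverse c \<cdot>\<^sub>m (c \<cdot>\<^sub>m W))" using c by simp
  moreover have "inverse c \<cdot>\<^sub>m (c \<cdot>\<^sub>m W) = W" using c by (intro eq_matI) simp_all
  ultimately show "jinj V W" by simp
qed (rule jinj_smult_right[OF V W c])

text \<open>Replaces the inverse in the precoder by the adjugate at the cost of a nonzero scalar,
  which does not affect joint injectivity and makes the block polynomial.\<close>

lemma precoder_eq:
  fixes B :: "'a::field mat"
  assumes B: "B \<in> carrier_mat m n" and D: "D \<in> carrier_mat n n" and E: "E \<in> carrier_mat n n"
    and V: "V \<in> carrier_mat n a" and C: "C \<in> carrier_mat a b" and d: "det D \<noteq> 0"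
  shows "B * (minv D * E * V * C) = inverse (det D) \<cdot>\<^sub>m (B * adj_mat D * E * V * C)"
proof -
  have aD: "adj_mat D \<in> carrier_mat n n" by (rule adj_mat(1)[OF D])
  have EVC: "E * V * C \<in> carrier_mat n b" by (rule mult_carrier_mat[OF mult_carrier_mat[OF E V] C])
  have mD: "minv D \<in> carrier_mat n n" by (rule minv(1)[OF D d])
  have r: "M * E * V * C = M * (E * V * C)" if M: "M \<in> carrier_mat q n" for M :: "'a mat" and q
    unfolding assoc_mult_mat[OF M E V] assoc_mult_mat[OF M mult_carrier_mat[OF E V] C] ..
  have BaD: "B * adj_mat D \<in> carrier_mat m n" by (rule mult_carrier_mat[OF B aD])
  have "minv D * E * V * C = inverse (det D) \<cdot>\<^sub>m (adj_mat D * (E * V * C))"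
    unfolding r[OF mD] unfolding minv_eq_adj[OF D d] by (rule mult_smult_assoc_mat[OF aD EVC])
  then have "B * (minv D * E * V * C) = inverse (det D) \<cdot>\<^sub>m (B * (adj_mat D * (E * V * C)))"
    using mult_smult_distrib[OF B mult_carrier_mat[OF aD EVC]] by simp
  then show ?thesis unfolding r[OF BaD] assoc_mult_mat[OF B aD EVC] .
qed

lemma jinj_precoder_iff:
  fixes A :: "'a::field mat"
  assumes A: "A \<in> carrier_mat n n" and B: "B \<in> carrier_mat n n" and D: "D \<in> carrier_mat n n" and E: "E \<in> carrier_mat n n"
    and V: "V \<in> carrier_mat n a" and C: "C \<in> carrier_mat a b" and d: "det D \<noteq> 0"
  shows "jinj (A * V) (B * (minv D * E * V * C)) \<longleftrightarrow> jinj (A * V) (B * adj_mat D * E * V * C)"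
proof -
  have aD: "adj_mat D \<in> carrier_mat n n" by (rule adj_mat(1)[OF D])
  have Y: "B * adj_mat D * E * V * C \<in> carrier_mat n b"
    by (rule mult_carrier_mat[OF mult_carrier_mat[OF mult_carrier_mat[OF mult_carrier_mat[OF B aD] E] V] C])
  show ?thesis
    unfolding precoder_eq[OF B D E V C d]
    by (rule jinj_smult_right_iff[OF mult_carrier_mat[OF A V] Y]) (use d in simp)
qed

text \<open>Multiplication by the invertible \<open>A\<close> removes the inverse from a rank
  condition and turns it into a statement about the signals that arrive at one receiver.\<close>

lemma jinj_receiver_iff:
  fixes A :: "'a::field mat"
  assumes A: "A \<in> carrier_mat n n" and B: "B \<in> carrier_mat n n" and d: "det A \<noteq> 0"
    and V: "V \<in> carrier_mat n a" and W: "W \<in> carrier_mat n b"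
  shows "jinj V (minv A * B * W) \<longleftrightarrow> jinj (A * V) (B * W)"
proof -
  note mA = minv[OF A d]
  have BW: "B * W \<in> carrier_mat n b" by (rule mult_carrier_mat[OF B W])
  have Y: "minv A * B * W = minv A * (B * W)" by (rule assoc_mult_mat[OF mA(1) B W])
  have "A * (minv A * B * W) = A * minv A * (B * W)"
    unfolding Y by (rule assoc_mult_mat[OF A mA(1) BW, symmetric])
  also have "\<dots> = B * W" unfolding mA(2) by (rule left_mult_one_mat[OF BW])
  finally have eq: "A * (minv A * B * W) = B * W" .
  have "minv A * B * W \<in> carrier_mat n b" unfolding Y by (rule mult_carrier_mat[OF mA(1) BW])
  from jinj_mult_left[OF A d V this] show ?thesis unfolding eq by simp
qed

section \<open>The rank conditions as conditions on polynomial matrices\<close>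

definition poly_var :: "var \<Rightarrow> ((var \<Rightarrow>\<^sub>0 nat) \<Rightarrow>\<^sub>0 'a::field)" where
  "poly_var v = Poly_Mapping.single (Poly_Mapping.single v 1) 1"

lemma ac_eval_poly_var: "ac_eval \<alpha> (poly_var v) = \<alpha> v"
  by (simp add: poly_var_def ac_eval_single mono_eval_def)

lemma to_fract_poly_var: "to_fract (poly_var v) = (indet v :: 'p::prime_card ratfun)"
  by (simp add: poly_var_def indet_def to_fract_def)

lemma Mmat_cong_lec:
  assumes "\<And>a b c t. a < 3 \<Longrightarrow> x (a, b, c, t) = y (a, b, c, t)"
  shows "Mmat N x n i j = Mmat N y n i j"
proof -
  have "path_gain x i j es t = path_gain y i j es t" for es t
    using assms by (simp add: path_gain_def lec_src_def lec_mid_def lec_snk_def)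
  then have "Mresp N x i j = Mresp N y i j" by (intro ext) (simp add: Mresp_def)
  then show ?thesis by (simp only: Mmat_def)
qed

text \<open>One description for V1, A and B, which have the tags 3, 4 and 5; the three rank
  conditions can then share their proofs.\<close>

definition tag_mat :: "nat \<Rightarrow> (var \<Rightarrow> 'r) \<Rightarrow> nat \<Rightarrow> nat \<Rightarrow> 'r mat" where
  "tag_mat g x p q = mat p q (\<lambda>(a, b). x (g, a, b, 0))"

lemma tag_mat_simps:
  "V1mat x n n1 = tag_mat 3 x n n1" "Amat x n1 n2 = tag_mat 4 x n1 n2" "Bmat x n1 n3 = tag_mat 5 x n1 n3"
  by (simp_all add: V1mat_def Amat_def Bmat_def tag_mat_def theta_var_def a_var_def b_var_def)

lemma tag_mat_carrier [simp]: "tag_mat g x p q \<in> carrier_mat p q"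
  by (simp add: tag_mat_def)

lemma tag_mat_hom: "tag_mat g (\<lambda>v. h (x v)) p q = map_mat h (tag_mat g x p q)"
  by (intro eq_matI) (auto simp: tag_mat_def)

text \<open>The signal of S_1 as received at T_b. It is wanted at T_1 only; at T_2 and T_3 it spans
  the space into which the interference is aligned.\<close>

definition wanted :: "'v net \<Rightarrow> (var \<Rightarrow> 'r::comm_ring_1) \<Rightarrow> nat \<Rightarrow> nat \<Rightarrow> nat \<Rightarrow> 'r mat" where
  "wanted N x n n1 b = Mmat N x n 1 b * tag_mat 3 x n n1"

text \<open>The polynomial matrix det (M a b') (M a b V_a) of the precoder V_a defined through b'.\<close>

definition aligned :: "'v net \<Rightarrow> (var \<Rightarrow> 'r::comm_ring_1) \<Rightarrow> nat \<Rightarrow> nat \<Rightarrow> nat \<Rightarrow> nat \<Rightarrow> nat \<Rightarrow> nat \<Rightarrow> nat \<Rightarrow> 'r mat" where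
  "aligned N x n n1 g k a b b' = Mmat N x n a b * adj_mat (Mmat N x n a b') * Mmat N x n 1 b'
     * tag_mat 3 x n n1 * tag_mat g x n1 k"

lemma wanted_carrier [simp]: "wanted N x n n1 b \<in> carrier_mat n n1"
  unfolding wanted_def by (rule mult_carrier_mat[OF Mmat_carrier tag_mat_carrier])

lemma aligned_carrier [simp]: "aligned N x n n1 g k a b b' \<in> carrier_mat n k"
  unfolding aligned_def
  by (rule mult_carrier_mat[OF mult_carrier_mat[OF mult_carrier_mat[OF mult_carrier_mat[OF
        Mmat_carrier adj_mat(1)[OF Mmat_carrier]] Mmat_carrier] tag_mat_carrier] tag_mat_carrier])

lemma wanted_hom:
  assumes "comm_ring_hom h"
  shows "wanted N (\<lambda>v. h (x v)) n n1 b = map_mat h (wanted N x n n1 b)"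
proof -
  interpret comm_ring_hom h by (rule assms)
  show ?thesis
    unfolding wanted_def tag_mat_hom Mmat_hom[OF assms]
    by (rule mat_hom_mult[OF Mmat_carrier tag_mat_carrier, symmetric])
qed

lemma aligned_hom:
  assumes "comm_ring_hom h"
  shows "aligned N (\<lambda>v. h (x v)) n n1 g k a b b' = map_mat h (aligned N x n n1 g k a b b')"
proof -
  interpret comm_ring_hom h by (rule assms)
  note aD = adj_mat(1)[OF Mmat_carrier[of N x n a b']]
  note c1 = mult_carrier_mat[OF Mmat_carrier aD]
  note c2 = mult_carrier_mat[OF c1 Mmat_carrier]
  note c3 = mult_carrier_mat[OF c2 tag_mat_carrier]
  show ?thesis
    unfolding aligned_def tag_mat_hom Mmat_hom[OF assms] adj_mat_map_mat[OF assms Mmat_carrier]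
      mat_hom_mult[OF c3 tag_mat_carrier] mat_hom_mult[OF c2 tag_mat_carrier]
      mat_hom_mult[OF c1 Mmat_carrier] mat_hom_mult[OF Mmat_carrier aD] ..
qed

lemma wanted_eval: "wanted N \<alpha> n n1 b = map_mat (ac_eval \<alpha>) (wanted N poly_var n n1 b)"
  using wanted_hom[OF ac_eval_hom[of \<alpha>], of N poly_var n n1 b] by (simp add: ac_eval_poly_var)

lemma aligned_eval:
  "aligned N \<alpha> n n1 g k a b b' = map_mat (ac_eval \<alpha>) (aligned N poly_var n n1 g k a b b')"
  using aligned_hom[OF ac_eval_hom[of \<alpha>], of N poly_var n n1 g k a b b'] by (simp add: ac_eval_poly_var)

lemma wanted_indet:
  "wanted N (indet :: var \<Rightarrow> 'p::prime_card ratfun) n n1 b = map_mat to_fract (wanted N poly_var n n1 b)"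
  using wanted_hom[OF to_fract_hom, of N "poly_var :: var \<Rightarrow> (var \<Rightarrow>\<^sub>0 nat) \<Rightarrow>\<^sub>0 'p mod_ring" n n1 b] by (simp add: to_fract_poly_var)

lemma aligned_indet:
  "aligned N (indet :: var \<Rightarrow> 'p::prime_card ratfun) n n1 g k a b b' = map_mat to_fract (aligned N poly_var n n1 g k a b b')"
  using aligned_hom[OF to_fract_hom, of N "poly_var :: var \<Rightarrow> (var \<Rightarrow>\<^sub>0 nat) \<Rightarrow>\<^sub>0 'p mod_ring" n n1 g k a b b'] by (simp add: to_fract_poly_var)

lemma det_Mmat_eval: "det (Mmat N \<alpha> n i j) = ac_eval \<alpha> (det (Mmat N poly_var n i j))"
proof -
  interpret comm_ring_hom "ac_eval \<alpha>" by (rule ac_eval_hom)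
  have "Mmat N \<alpha> n i j = map_mat (ac_eval \<alpha>) (Mmat N poly_var n i j)"
    using Mmat_hom[OF ac_eval_hom[of \<alpha>], of N poly_var n i j] by (simp add: ac_eval_poly_var)
  then show ?thesis by simp
qed

lemma det_Mmat_poly_var_nonzero:
  assumes "finite_dag N" "i \<in> {1,2,3}" "j \<in> {1,2,3}" "dmax N < n" "is_path N (src N i) (dst N j) es"
  shows "det (Mmat N (poly_var :: var \<Rightarrow> (var \<Rightarrow>\<^sub>0 nat) \<Rightarrow>\<^sub>0 'a::field) n i j) \<noteq> 0"
proof
  assume 0: "det (Mmat N (poly_var :: var \<Rightarrow> (var \<Rightarrow>\<^sub>0 nat) \<Rightarrow>\<^sub>0 'a) n i j) = 0"
  obtain \<alpha> :: "var \<Rightarrow> 'a alg_closure" where "det (Mmat N \<alpha> n i j) \<noteq> 0"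
    using exists_invertible_Mmat[OF assms] by (elim exE)
  then show False unfolding det_Mmat_eval 0 by (simp add: ac_eval_zero)
qed

lemma det_Mmat_indet_nonzero:
  assumes "finite_dag N" "i \<in> {1,2,3}" "j \<in> {1,2,3}" "dmax N < n" "is_path N (src N i) (dst N j) es"
  shows "det (Mmat N (indet :: var \<Rightarrow> 'p::prime_card ratfun) n i j) \<noteq> 0"
proof -
  interpret comm_ring_hom "to_fract :: ((var \<Rightarrow>\<^sub>0 nat) \<Rightarrow>\<^sub>0 'p mod_ring) \<Rightarrow> _" by (rule to_fract_hom)
  have "Mmat N (indet :: var \<Rightarrow> 'p ratfun) n i j = map_mat to_fract (Mmat N poly_var n i j)"
    using Mmat_hom[OF to_fract_hom, of N "poly_var :: var \<Rightarrow> (var \<Rightarrow>\<^sub>0 nat) \<Rightarrow>\<^sub>0 'p mod_ring" n i j] by (simp add: to_fract_poly_var)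
  then show ?thesis using det_Mmat_poly_var_nonzero[OF assms, where 'a = "'p mod_ring"] by simp
qed

lemma Vmat_simps:
  "Vmat N x n n1 n2 n3 1 = tag_mat 3 x n n1"
  "Vmat N x n n1 n2 n3 2 = minv (Mmat N x n 2 3) * Mmat N x n 1 3 * tag_mat 3 x n n1 * tag_mat 4 x n1 n2"
  "Vmat N x n n1 n2 n3 3 = minv (Mmat N x n 3 2) * Mmat N x n 1 2 * tag_mat 3 x n n1 * tag_mat 5 x n1 n3"
  by (simp_all add: Vmat_def tag_mat_simps)

lemma precoder_carrier:
  assumes "det (Mmat N x n a b' :: 'r::field mat) \<noteq> 0"
  shows "minv (Mmat N x n a b') * Mmat N x n 1 b' * tag_mat 3 x n n1 * tag_mat g x n1 k \<in> carrier_mat n k"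
  by (rule mult_carrier_mat[OF mult_carrier_mat[OF mult_carrier_mat[OF minv(1)[OF Mmat_carrier assms]
        Mmat_carrier] tag_mat_carrier] tag_mat_carrier])

lemma jinj_received_iff:
  fixes x :: "var \<Rightarrow> 'r::field"
  assumes "det (Mmat N x n a b') \<noteq> 0"
  shows "jinj (Mmat N x n 1 b * tag_mat 3 x n n1)
      (Mmat N x n a b * (minv (Mmat N x n a b') * Mmat N x n 1 b' * tag_mat 3 x n n1 * tag_mat g x n1 k))
    \<longleftrightarrow> jinj (wanted N x n n1 b) (aligned N x n n1 g k a b b')"
  unfolding wanted_def aligned_def
  by (rule jinj_precoder_iff[OF Mmat_carrier Mmat_carrier Mmat_carrier Mmat_carrier tag_mat_carrier tag_mat_carrier assms])

lemma rank_condition_iff: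
  fixes x :: "var \<Rightarrow> 'r::field"
  assumes d: "det (Mmat N x n a b') \<noteq> 0" "det (Mmat N x n 1 b) \<noteq> 0"
    and V: "V = minv (Mmat N x n a b') * Mmat N x n 1 b' * tag_mat 3 x n n1 * tag_mat g x n1 k"
  shows "jinj (tag_mat 3 x n n1) (minv (Mmat N x n 1 b) * Mmat N x n a b * V)
    \<longleftrightarrow> jinj (wanted N x n n1 b) (aligned N x n n1 g k a b b')"
  and "minv (Mmat N x n 1 b) * Mmat N x n a b * V \<in> carrier_mat n k"
proof -
  have Vc: "V \<in> carrier_mat n k" unfolding V by (rule precoder_carrier[OF d(1)])
  show "minv (Mmat N x n 1 b) * Mmat N x n a b * V \<in> carrier_mat n k"
    by (rule mult_carrier_mat[OF mult_carrier_mat[OF minv(1)[OF Mmat_carrier d(2)] Mmat_carrier] Vc])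
  show "jinj (tag_mat 3 x n n1) (minv (Mmat N x n 1 b) * Mmat N x n a b * V)
    \<longleftrightarrow> jinj (wanted N x n n1 b) (aligned N x n n1 g k a b b')"
    unfolding jinj_receiver_iff[OF Mmat_carrier Mmat_carrier d(2) tag_mat_carrier Vc]
    unfolding V by (rule jinj_received_iff[OF d(1)])
qed

section \<open>Decoders and their effect on the pencil\<close>

lemma mat_eqI_vec:
  fixes A :: "'a::comm_ring_1 mat"
  assumes A: "A \<in> carrier_mat m k" and B: "B \<in> carrier_mat m k"
    and eq: "\<And>v. v \<in> carrier_vec k \<Longrightarrow> A *\<^sub>v v = B *\<^sub>v v"
  shows "A = B"
proof (rule eq_matI)
  fix i j assume "i < dim_row B" "j < dim_col B"
  then have ij: "i < m" "j < k" using B by simp_all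
  have "(A *\<^sub>v unit_vec k j) $ i = (B *\<^sub>v unit_vec k j) $ i" by (simp only: eq[OF unit_vec_carrier])
  then show "A $$ (i, j) = B $$ (i, j)" using ij A B by simp
qed (use A B in simp_all)

lemma mult_sum3_vec:
  fixes G :: "'a::comm_ring_1 mat"
  assumes G: "G \<in> carrier_mat m n" and W: "W1 \<in> carrier_mat n a1" "W2 \<in> carrier_mat n a2" "W3 \<in> carrier_mat n a3"
    and v: "v1 \<in> carrier_vec a1" "v2 \<in> carrier_vec a2" "v3 \<in> carrier_vec a3"
  shows "G *\<^sub>v (W1 *\<^sub>v v1 + W2 *\<^sub>v v2 + W3 *\<^sub>v v3) = (G * W1) *\<^sub>v v1 + (G * W2) *\<^sub>v v2 + (G * W3) *\<^sub>v v3"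
proof -
  have c1: "W1 *\<^sub>v v1 \<in> carrier_vec n" and c2: "W2 *\<^sub>v v2 \<in> carrier_vec n" and c3: "W3 *\<^sub>v v3 \<in> carrier_vec n"
    by (rule mult_mat_vec_carrier[OF W(1) v(1)], rule mult_mat_vec_carrier[OF W(2) v(2)], rule mult_mat_vec_carrier[OF W(3) v(3)])
  show ?thesis
    unfolding mult_add_distrib_mat_vec[OF G add_carrier_vec[OF c1 c2] c3] mult_add_distrib_mat_vec[OF G c1 c2]
      assoc_mult_mat_vec[OF G W(1) v(1)] assoc_mult_mat_vec[OF G W(2) v(2)] assoc_mult_mat_vec[OF G W(3) v(3)] ..
qed

text \<open>Testing the identity with two of the three inputs equal to zero isolates each
  product.\<close>

lemma decoder_iff:
  fixes G :: "'a::comm_ring_1 mat"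
  assumes G: "G \<in> carrier_mat m n" and W: "W1 \<in> carrier_mat n m" "W2 \<in> carrier_mat n a2" "W3 \<in> carrier_mat n a3"
  shows "(\<forall>v1\<in>carrier_vec m. \<forall>v2\<in>carrier_vec a2. \<forall>v3\<in>carrier_vec a3.
      (G * W1) *\<^sub>v v1 + (G * W2) *\<^sub>v v2 + (G * W3) *\<^sub>v v3 = v1)
    \<longleftrightarrow> G * W1 = 1\<^sub>m m \<and> G * W2 = 0\<^sub>m m a2 \<and> G * W3 = 0\<^sub>m m a3" (is "?L \<longleftrightarrow> ?R")
proof
  note GW = mult_carrier_mat[OF G W(1)] mult_carrier_mat[OF G W(2)] mult_carrier_mat[OF G W(3)]
  have z: "M *\<^sub>v 0\<^sub>v q = 0\<^sub>v m" if "M \<in> carrier_mat m q" for M :: "'a mat" and q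
    using that by (intro eq_vecI) auto
  have z0: "(0\<^sub>m m q :: 'a mat) *\<^sub>v v = 0\<^sub>v m" if "v \<in> carrier_vec q" for v :: "'a vec" and q
    using that by (intro eq_vecI) auto
  {
    assume L: ?L
    have "(G * W1) *\<^sub>v v = 1\<^sub>m m *\<^sub>v v" if v: "v \<in> carrier_vec m" for v
      using L[rule_format, OF v zero_carrier_vec zero_carrier_vec] v mult_mat_vec_carrier[OF GW(1) v]
      by (simp add: z[OF GW(2)] z[OF GW(3)])
    moreover have "(G * W2) *\<^sub>v v = 0\<^sub>m m a2 *\<^sub>v v" if v: "v \<in> carrier_vec a2" for v
      using L[rule_format, OF zero_carrier_vec v zero_carrier_vec] v mult_mat_vec_carrier[OF GW(2) v]
      by (simp add: z[OF GW(1)] z[OF GW(3)] z0)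
    moreover have "(G * W3) *\<^sub>v v = 0\<^sub>m m a3 *\<^sub>v v" if v: "v \<in> carrier_vec a3" for v
      using L[rule_format, OF zero_carrier_vec zero_carrier_vec v] v mult_mat_vec_carrier[OF GW(3) v]
      by (simp add: z[OF GW(1)] z[OF GW(2)] z0)
    ultimately show ?R
      by (intro conjI mat_eqI_vec[OF GW(1)] mat_eqI_vec[OF GW(2)] mat_eqI_vec[OF GW(3)]) simp_all
  }
  assume R: ?R
  show ?L
  proof (intro ballI)
    fix v1 v2 v3 :: "'a vec" assume v: "v1 \<in> carrier_vec m" "v2 \<in> carrier_vec a2" "v3 \<in> carrier_vec a3"
    show "(G * W1) *\<^sub>v v1 + (G * W2) *\<^sub>v v2 + (G * W3) *\<^sub>v v3 = v1" using R v by (simp add: z0)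
  qed
qed

text \<open>Applied to \<open>V * C\<close>, the pencil compares two received signals: that of the
  precoder defined through \<open>D\<close>, and \<open>c\<close> times that of S_1 precoded by
  \<open>V * C\<close>. A decoder \<open>G\<close> sees them separately, which links decodability to
  minors of the pencil.\<close>

lemma pencil_signal:
  fixes A :: "'a::field mat"
  assumes G: "G \<in> carrier_mat m n" and A: "A \<in> carrier_mat n n" and B: "B \<in> carrier_mat n n"
    and D: "D \<in> carrier_mat n n" and E: "E \<in> carrier_mat n n"
    and V: "V \<in> carrier_mat n n1" and C: "C \<in> carrier_mat n1 k" and d: "det D \<noteq> 0"
  shows "G * pencil A B D E c * (V * C)
    = det D \<cdot>\<^sub>m (G * (B * (minv D * E * V * C))) - (c * det D) \<cdot>\<^sub>m (G * (A * V) * C)"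
proof -
  have aD: "adj_mat D \<in> carrier_mat n n" by (rule adj_mat(1)[OF D])
  have VC: "V * C \<in> carrier_mat n k" by (rule mult_carrier_mat[OF V C])
  define S where "S = B * adj_mat D * E"
  have S: "S \<in> carrier_mat n n" unfolding S_def by (rule mult_carrier_mat[OF mult_carrier_mat[OF B aD] E])
  have SVC: "S * (V * C) \<in> carrier_mat n k" by (rule mult_carrier_mat[OF S VC])
  have AVC: "A * (V * C) \<in> carrier_mat n k" by (rule mult_carrier_mat[OF A VC])
  have cA: "(c * det D) \<cdot>\<^sub>m A \<in> carrier_mat n n" by (rule smult_carrier_mat[OF A])
  have "G * pencil A B D E c * (V * C) = G * (pencil A B D E c * (V * C))"
    by (rule assoc_mult_mat[OF G pencil_carrier[OF A B D E] VC])
  also have "pencil A B D E c * (V * C) = S * (V * C) - (c * det D) \<cdot>\<^sub>m (A * (V * C))"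
    unfolding pencil_def S_def[symmetric] minus_mult_distrib_mat[OF S cA VC] mult_smult_assoc_mat[OF A VC] ..
  also have "G * \<dots> = G * (S * (V * C)) - (c * det D) \<cdot>\<^sub>m (G * (A * (V * C)))"
    unfolding mult_minus_distrib_mat[OF G SVC smult_carrier_mat[OF AVC]] mult_smult_distrib[OF G AVC] ..
  also have "G * (A * (V * C)) = G * (A * V) * C"
    unfolding assoc_mult_mat[OF A V C, symmetric] assoc_mult_mat[OF G mult_carrier_mat[OF A V] C] ..
  also have "G * (S * (V * C)) = det D \<cdot>\<^sub>m (G * (B * (minv D * E * V * C)))"
  proof -
    have "B * (minv D * E * V * C) = inverse (det D) \<cdot>\<^sub>m (S * (V * C))"
      unfolding precoder_eq[OF B D E V C d] S_def[symmetric] assoc_mult_mat[OF S V C] ..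
    then have "G * (B * (minv D * E * V * C)) = inverse (det D) \<cdot>\<^sub>m (G * (S * (V * C)))"
      using mult_smult_distrib[OF G SVC] by simp
    moreover have "det D \<cdot>\<^sub>m (inverse (det D) \<cdot>\<^sub>m (G * (S * (V * C)))) = G * (S * (V * C))"
      using d by (intro eq_matI) simp_all
    ultimately show ?thesis by simp
  qed
  finally show ?thesis .
qed

text \<open>The situation at T_2 and T_3, where the decoder recovers the aligned precoder and kills
  the signal of S_1; the minor is a power of \<open>det D\<close>.\<close>

lemma pencil_minor_wanted:
  fixes A :: "'a::field mat"
  assumes G: "G \<in> carrier_mat k n" and A: "A \<in> carrier_mat n n" and B: "B \<in> carrier_mat n n"
    and D: "D \<in> carrier_mat n n" and E: "E \<in> carrier_mat n n"
    and V: "V \<in> carrier_mat n n1" and C: "C \<in> carrier_mat n1 k" and d: "det D \<noteq> 0"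
    and 1: "G * (B * (minv D * E * V * C)) = 1\<^sub>m k" and 0: "G * (A * V) = 0\<^sub>m k n1"
  shows "det (G * pencil A B D E c * (V * C)) \<noteq> 0"
proof -
  have "0\<^sub>m k n1 * C = 0\<^sub>m k k" using C by simp
  then have "G * pencil A B D E c * (V * C) = det D \<cdot>\<^sub>m 1\<^sub>m k"
    unfolding pencil_signal[OF G A B D E V C d] 1 0 by (intro eq_matI) simp_all
  then show ?thesis using d by (simp add: det_smult)
qed

text \<open>The situation at T_1, where the roles are exchanged: the interference is killed and only
  the term with the factor \<open>c\<close> survives.\<close>

lemma pencil_minor_interference:
  fixes A :: "'a::field mat"
  assumes G: "G \<in> carrier_mat k n" and A: "A \<in> carrier_mat n n" and B: "B \<in> carrier_mat n n"
    and D: "D \<in> carrier_mat n n" and E: "E \<in> carrier_mat n n"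
    and V: "V \<in> carrier_mat n n1" and C: "C \<in> carrier_mat n1 k" and d: "det D \<noteq> 0" and c: "c \<noteq> 0"
    and 0: "G * (B * (minv D * E * V * C)) = 0\<^sub>m k k" and 1: "G * (A * V) * C = 1\<^sub>m k"
  shows "det (G * pencil A B D E c * (V * C)) \<noteq> 0"
proof -
  have "G * pencil A B D E c * (V * C) = (- (c * det D)) \<cdot>\<^sub>m 1\<^sub>m k"
    unfolding pencil_signal[OF G A B D E V C d] 1 0 by (intro eq_matI) simp_all
  then show ?thesis using d c by (simp add: det_smult)
qed

text \<open>If the generic condition fails, it fails for every choice of LECs, \<open>V\<close> and
  \<open>C\<close>, and the pencil has a nonzero scalar with all its minors of size \<open>k\<close>
  zero. For that scalar the assumption supplies a nonzero minor.\<close>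

lemma jinj_generic_if_no_low_rank:
  fixes N :: "'v net"
  assumes sq: "net_square TYPE('p::prime_card mod_ring alg_closure) N n n1 k a b b'" and g: "g \<in> {4,5}"
    and nz: "\<And>c. c \<noteq> 0 \<Longrightarrow> \<exists>\<alpha> :: var \<Rightarrow> 'p mod_ring alg_closure. \<exists>R\<in>carrier_mat k n. \<exists>C\<in>carrier_mat n k.
      det (R * pencil (Mmat N \<alpha> n 1 b) (Mmat N \<alpha> n a b) (Mmat N \<alpha> n a b') (Mmat N \<alpha> n 1 b') c * C) \<noteq> 0"
  shows "jinj (wanted N (indet :: var \<Rightarrow> 'p ratfun) n n1 b) (aligned N indet n n1 g k a b b')"
proof (rule ccontr)
  interpret net_square N n n1 k a b b' "TYPE('p mod_ring alg_closure)" by (rule sq)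
  assume not: "\<not> jinj (wanted N (indet :: var \<Rightarrow> 'p ratfun) n n1 b) (aligned N indet n n1 g k a b b')"
  have no: "\<not> jinj (MA x * V) (MB x * adj_mat (MD x) * ME x * V * C)"
    if V: "V \<in> carrier_mat n n1" and C: "C \<in> carrier_mat n1 k" for x and V C :: "'p mod_ring alg_closure mat"
  proof
    assume j: "jinj (MA x * V) (MB x * adj_mat (MD x) * ME x * V * C)"
    \<comment> \<open>Arbitrary matrices \<open>V\<close> and \<open>C\<close> are written into the
      positions of the indeterminates while all LECs keep their values, so the transfer matrices do
      not change.\<close>
    define y where "y v = (case v of (tag, p, q, t) \<Rightarrow>
        if tag = 3 then V $$ (p, q) else if tag = g then C $$ (p, q) else x v)" for v
    have "y (tag, p, q, t) = x (tag, p, q, t)" if "tag < 3" for tag p q t using that g by (auto simp: y_def)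
    then have M: "Mmat N y n i j = Mmat N x n i j" for i j by (rule Mmat_cong_lec)
    have Vy: "tag_mat 3 y n n1 = V" using V by (intro eq_matI) (auto simp: tag_mat_def y_def)
    have Cy: "tag_mat g y n1 k = C" using C g by (intro eq_matI) (auto simp: tag_mat_def y_def)
    have "jinj (wanted N y n n1 b) (aligned N y n n1 g k a b b')"
      unfolding wanted_def aligned_def M Vy Cy by (rule j)
    then have "jinj (map_mat to_fract (wanted N (poly_var :: var \<Rightarrow> (var \<Rightarrow>\<^sub>0 nat) \<Rightarrow>\<^sub>0 'p mod_ring) n n1 b))
        (map_mat to_fract (aligned N poly_var n n1 g k a b b'))"
      unfolding wanted_eval[of N y] aligned_eval[of N y]
      by (rule jinj_at_point_imp_jinj_generic[OF wanted_carrier aligned_carrier dims(1)[symmetric]])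
    then show False using not unfolding wanted_indet aligned_indet by simp
  qed
  have "\<exists>c. c \<noteq> 0 \<and> (\<forall>x. \<forall>R\<in>carrier_mat k n. \<forall>C\<in>carrier_mat n k.
      det (R * pencil (MA x) (MB x) (MD x) (ME x) c * C) = 0)"
    by (rule singular_everywhere_imp_low_rank) (rule no)
  then obtain c where c: "c \<noteq> 0" "\<forall>x. \<forall>R\<in>carrier_mat k n. \<forall>C\<in>carrier_mat n k.
      det (R * pencil (MA x) (MB x) (MD x) (ME x) c * C) = 0" by (elim exE conjE)
  obtain \<alpha> R C where "R \<in> carrier_mat k n" "C \<in> carrier_mat n k"
    "det (R * pencil (MA \<alpha>) (MB \<alpha>) (MD \<alpha>) (ME \<alpha>) c * C) \<noteq> 0"
    using nz[OF c(1)] by (elim exE bexE)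
  then show False using c(2) by simp
qed

lemma invertible_mat_iff_det:
  fixes A :: "'a::field mat"
  assumes A: "A \<in> carrier_mat n n"
  shows "invertible_mat A \<longleftrightarrow> det A \<noteq> 0"
proof
  assume "invertible_mat A"
  then obtain B where B: "A * B = 1\<^sub>m n" "B * A = 1\<^sub>m (dim_row B)"
    using A unfolding invertible_mat_def inverts_mat_def by auto
  have "dim_col (A * B) = n" "dim_col (B * A) = dim_row B" unfolding B by simp_all
  then have "B \<in> carrier_mat n n" using A by auto
  from det_mult[OF A this] show "det A \<noteq> 0" unfolding B(1) by auto
next
  assume d: "det A \<noteq> 0"
  have "inverts_mat A (minv A)" "inverts_mat (minv A) A"
    using minv[OF A d] A unfolding inverts_mat_def by auto
  then show "invertible_mat A" using A unfolding invertible_mat_def by auto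
qed

lemma rank_conditions_imp_jinj:
  assumes d: "det (Mmat N (indet :: var \<Rightarrow> 'p::prime_card ratfun) n 2 3) \<noteq> 0" "det (Mmat N (indet :: var \<Rightarrow> 'p ratfun) n 3 2) \<noteq> 0"
    "det (Mmat N (indet :: var \<Rightarrow> 'p ratfun) n 1 1) \<noteq> 0" "det (Mmat N (indet :: var \<Rightarrow> 'p ratfun) n 1 2) \<noteq> 0"
    "det (Mmat N (indet :: var \<Rightarrow> 'p ratfun) n 1 3) \<noteq> 0"
    and rc: "rank_conditions TYPE('p) N n n1 n2 n3"
  shows "jinj (wanted N (indet :: var \<Rightarrow> 'p ratfun) n n1 1) (aligned N indet n n1 5 n3 3 1 2)"
    "jinj (wanted N (indet :: var \<Rightarrow> 'p ratfun) n n1 2) (aligned N indet n n1 4 n2 2 2 3)"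
    "jinj (wanted N (indet :: var \<Rightarrow> 'p ratfun) n n1 3) (aligned N indet n n1 5 n3 3 3 2)"
proof -
  let ?x = "indet :: var \<Rightarrow> 'p ratfun"
  note V2 = Vmat_simps(2)[of N ?x n n1 n2 n3] and V3 = Vmat_simps(3)[of N ?x n n1 n2 n3]
  note R1 = rank_condition_iff[OF d(2,3) V3] and R2 = rank_condition_iff[OF d(1,4) V2] and R3 = rank_condition_iff[OF d(2,5) V3]
  have r: "vec_space.rank n (hcat (tag_mat 3 ?x n n1) (minv (Mmat N ?x n 1 1) * Mmat N ?x n 3 1 * Vmat N ?x n n1 n2 n3 3)) = n1 + n3"
    "vec_space.rank n (hcat (minv (Mmat N ?x n 1 2) * Mmat N ?x n 2 2 * Vmat N ?x n n1 n2 n3 2) (tag_mat 3 ?x n n1)) = n2 + n1"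
    "vec_space.rank n (hcat (minv (Mmat N ?x n 1 3) * Mmat N ?x n 3 3 * Vmat N ?x n n1 n2 n3 3) (tag_mat 3 ?x n n1)) = n3 + n1"
    using rc unfolding rank_conditions_def Let_def Vmat_simps(1) by simp_all
  show "jinj (wanted N ?x n n1 1) (aligned N ?x n n1 5 n3 3 1 2)"
    using rank_hcat_imp_jinj[OF tag_mat_carrier R1(2) r(1)] R1(1) by simp
  show "jinj (wanted N ?x n n1 2) (aligned N ?x n n1 4 n2 2 2 3)"
    using rank_hcat_imp_jinj[OF R2(2) tag_mat_carrier r(2)] R2(1) jinj_commute[OF R2(2) tag_mat_carrier] by simp
  show "jinj (wanted N ?x n n1 3) (aligned N ?x n n1 5 n3 3 3 2)"
    using rank_hcat_imp_jinj[OF R3(2) tag_mat_carrier r(3)] R3(1) jinj_commute[OF R3(2) tag_mat_carrier] by simp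
qed

lemma jinj_imp_rank_conditions:
  assumes d: "det (Mmat N (indet :: var \<Rightarrow> 'p::prime_card ratfun) n 2 3) \<noteq> 0" "det (Mmat N (indet :: var \<Rightarrow> 'p ratfun) n 3 2) \<noteq> 0"
    "det (Mmat N (indet :: var \<Rightarrow> 'p ratfun) n 1 1) \<noteq> 0" "det (Mmat N (indet :: var \<Rightarrow> 'p ratfun) n 1 2) \<noteq> 0"
    "det (Mmat N (indet :: var \<Rightarrow> 'p ratfun) n 1 3) \<noteq> 0"
    and dim: "n1 + n2 = n" "n1 + n3 = n"
    and J: "jinj (wanted N (indet :: var \<Rightarrow> 'p ratfun) n n1 1) (aligned N indet n n1 5 n3 3 1 2)"
      "jinj (wanted N (indet :: var \<Rightarrow> 'p ratfun) n n1 2) (aligned N indet n n1 4 n2 2 2 3)"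
      "jinj (wanted N (indet :: var \<Rightarrow> 'p ratfun) n n1 3) (aligned N indet n n1 5 n3 3 3 2)"
  shows "rank_conditions TYPE('p) N n n1 n2 n3"
proof -
  let ?x = "indet :: var \<Rightarrow> 'p ratfun"
  note V2 = Vmat_simps(2)[of N ?x n n1 n2 n3] and V3 = Vmat_simps(3)[of N ?x n n1 n2 n3]
  note R1 = rank_condition_iff[OF d(2,3) V3] and R2 = rank_condition_iff[OF d(1,4) V2] and R3 = rank_condition_iff[OF d(2,5) V3]
  have dim': "n2 + n1 = n" "n3 + n1 = n" using dim by simp_all
  have "vec_space.rank n (hcat (tag_mat 3 ?x n n1) (minv (Mmat N ?x n 1 1) * Mmat N ?x n 3 1 * Vmat N ?x n n1 n2 n3 3)) = n1 + n3"
    by (rule jinj_imp_rank_hcat_square[OF tag_mat_carrier R1(2) dim(2) R1(1)[THEN iffD2, OF J(1)]])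
  moreover have "vec_space.rank n (hcat (minv (Mmat N ?x n 1 2) * Mmat N ?x n 2 2 * Vmat N ?x n n1 n2 n3 2) (tag_mat 3 ?x n n1)) = n2 + n1"
    by (rule jinj_imp_rank_hcat_square[OF R2(2) tag_mat_carrier dim'(1)
          jinj_commute[OF R2(2) tag_mat_carrier, THEN iffD2, OF R2(1)[THEN iffD2, OF J(2)]]])
  moreover have "vec_space.rank n (hcat (minv (Mmat N ?x n 1 3) * Mmat N ?x n 3 3 * Vmat N ?x n n1 n2 n3 3) (tag_mat 3 ?x n n1)) = n3 + n1"
    by (rule jinj_imp_rank_hcat_square[OF R3(2) tag_mat_carrier dim'(2)
          jinj_commute[OF R3(2) tag_mat_carrier, THEN iffD2, OF R3(1)[THEN iffD2, OF J(3)]]])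
  ultimately show ?thesis unfolding rank_conditions_def Let_def Vmat_simps(1) by simp
qed

lemma jinj_indet_imp_jinj_at_points:
  assumes "jinj (wanted N (indet :: var \<Rightarrow> 'p::prime_card ratfun) n n1 b) (aligned N indet n n1 g k a b b')"
  shows "\<exists>d :: (var \<Rightarrow>\<^sub>0 nat) \<Rightarrow>\<^sub>0 'p mod_ring. d \<noteq> 0 \<and> (\<forall>\<alpha>. ac_eval \<alpha> d \<noteq> 0 \<longrightarrow>
    jinj (wanted N \<alpha> n n1 b) (aligned N \<alpha> n n1 g k a b b'))"
  using jinj_generic_imp_jinj_at_points[OF wanted_carrier aligned_carrier assms[unfolded wanted_indet aligned_indet]]
  unfolding wanted_eval[symmetric] aligned_eval[symmetric] .

context
  fixes N :: "'v net" and x :: "var \<Rightarrow> 'r::field" and n n1 n2 n3 :: nat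
  assumes D: "det (Mmat N x n 2 3) \<noteq> 0" "det (Mmat N x n 3 2) \<noteq> 0"
begin

abbreviation "V1 \<equiv> tag_mat 3 x n n1"
abbreviation "V2 \<equiv> minv (Mmat N x n 2 3) * Mmat N x n 1 3 * V1 * tag_mat 4 x n1 n2"
abbreviation "V3 \<equiv> minv (Mmat N x n 3 2) * Mmat N x n 1 2 * V1 * tag_mat 5 x n1 n3"

lemma received_carrier:
  "Mmat N x n i j * V1 \<in> carrier_mat n n1" "Mmat N x n i j * V2 \<in> carrier_mat n n2" "Mmat N x n i j * V3 \<in> carrier_mat n n3"
  by (rule mult_carrier_mat[OF Mmat_carrier tag_mat_carrier],
      rule mult_carrier_mat[OF Mmat_carrier precoder_carrier[OF D(1)]],
      rule mult_carrier_mat[OF Mmat_carrier precoder_carrier[OF D(2)]])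

lemma recoverable_iff:
  "recoverable N x n n1 n2 n3 j \<longleftrightarrow> (\<exists>G\<in>carrier_mat (ndim n1 n2 n3 j) n.
    \<forall>v1\<in>carrier_vec n1. \<forall>v2\<in>carrier_vec n2. \<forall>v3\<in>carrier_vec n3.
      (G * (Mmat N x n 1 j * V1)) *\<^sub>v v1 + (G * (Mmat N x n 2 j * V2)) *\<^sub>v v2 + (G * (Mmat N x n 3 j * V3)) *\<^sub>v v3
      = (if j = 1 then v1 else if j = 2 then v2 else v3))"
  unfolding recoverable_def Let_def Vmat_simps
  by (intro bex_cong ball_cong refl) (simp only: mult_sum3_vec[OF _ received_carrier])

lemma recoverable_1_iff:
  "recoverable N x n n1 n2 n3 1 \<longleftrightarrow> (\<exists>G\<in>carrier_mat n1 n. G * (Mmat N x n 1 1 * V1) = 1\<^sub>m n1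
    \<and> G * (Mmat N x n 2 1 * V2) = 0\<^sub>m n1 n2 \<and> G * (Mmat N x n 3 1 * V3) = 0\<^sub>m n1 n3)"
proof -
  have eqs: "((1::nat) = 1) = True" by simp
  show ?thesis
    unfolding recoverable_iff ndim_def eqs if_True
    by (intro bex_cong refl) (simp only: decoder_iff[OF _ received_carrier])
qed

lemma recoverable_2_iff:
  "recoverable N x n n1 n2 n3 2 \<longleftrightarrow> (\<exists>G\<in>carrier_mat n2 n. G * (Mmat N x n 2 2 * V2) = 1\<^sub>m n2
    \<and> G * (Mmat N x n 1 2 * V1) = 0\<^sub>m n2 n1 \<and> G * (Mmat N x n 3 2 * V3) = 0\<^sub>m n2 n3)"
proof -
  \<comment> \<open>The recovered block is moved to the front, where \<open>decoder_iff\<close>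
    expects it.\<close>
  have "(\<forall>v1\<in>carrier_vec n1. \<forall>v2\<in>carrier_vec n2. \<forall>v3\<in>carrier_vec n3.
      (G * (Mmat N x n 1 2 * V1)) *\<^sub>v v1 + (G * (Mmat N x n 2 2 * V2)) *\<^sub>v v2 + (G * (Mmat N x n 3 2 * V3)) *\<^sub>v v3 = v2)
    \<longleftrightarrow> (\<forall>v2\<in>carrier_vec n2. \<forall>v1\<in>carrier_vec n1. \<forall>v3\<in>carrier_vec n3.
      (G * (Mmat N x n 2 2 * V2)) *\<^sub>v v2 + (G * (Mmat N x n 1 2 * V1)) *\<^sub>v v1 + (G * (Mmat N x n 3 2 * V3)) *\<^sub>v v3 = v2)"
    if G: "G \<in> carrier_mat n2 n" for G
  proof -
    have "(G * (Mmat N x n 1 2 * V1)) *\<^sub>v v1 + (G * (Mmat N x n 2 2 * V2)) *\<^sub>v v2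
        = (G * (Mmat N x n 2 2 * V2)) *\<^sub>v v2 + (G * (Mmat N x n 1 2 * V1)) *\<^sub>v v1"
      if "v1 \<in> carrier_vec n1" "v2 \<in> carrier_vec n2" for v1 v2
      by (rule comm_add_vec[OF mult_mat_vec_carrier[OF mult_carrier_mat[OF G received_carrier(1)] that(1)]
            mult_mat_vec_carrier[OF mult_carrier_mat[OF G received_carrier(2)] that(2)]])
    then show ?thesis by auto
  qed
  note swap = this
  have eqs: "((2::nat) = 1) = False" "((2::nat) = 2) = True" by simp_all
  show ?thesis
    unfolding recoverable_iff ndim_def eqs if_False if_True
    by (intro bex_cong refl) (simp only: swap decoder_iff[OF _ received_carrier(2,1,3)])
qed

lemma recoverable_3_iff:
  "recoverable N x n n1 n2 n3 3 \<longleftrightarrow> (\<exists>G\<in>carrier_mat n3 n. G * (Mmat N x n 3 3 * V3) = 1\<^sub>m n3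
    \<and> G * (Mmat N x n 1 3 * V1) = 0\<^sub>m n3 n1 \<and> G * (Mmat N x n 2 3 * V2) = 0\<^sub>m n3 n2)"
proof -
  have "(\<forall>v1\<in>carrier_vec n1. \<forall>v2\<in>carrier_vec n2. \<forall>v3\<in>carrier_vec n3.
      (G * (Mmat N x n 1 3 * V1)) *\<^sub>v v1 + (G * (Mmat N x n 2 3 * V2)) *\<^sub>v v2 + (G * (Mmat N x n 3 3 * V3)) *\<^sub>v v3 = v3)
    \<longleftrightarrow> (\<forall>v3\<in>carrier_vec n3. \<forall>v1\<in>carrier_vec n1. \<forall>v2\<in>carrier_vec n2.
      (G * (Mmat N x n 3 3 * V3)) *\<^sub>v v3 + (G * (Mmat N x n 1 3 * V1)) *\<^sub>v v1 + (G * (Mmat N x n 2 3 * V2)) *\<^sub>v v2 = v3)"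
    if G: "G \<in> carrier_mat n3 n" for G
  proof -
    have "(G * (Mmat N x n 1 3 * V1)) *\<^sub>v v1 + (G * (Mmat N x n 2 3 * V2)) *\<^sub>v v2 + (G * (Mmat N x n 3 3 * V3)) *\<^sub>v v3
        = (G * (Mmat N x n 3 3 * V3)) *\<^sub>v v3 + (G * (Mmat N x n 1 3 * V1)) *\<^sub>v v1 + (G * (Mmat N x n 2 3 * V2)) *\<^sub>v v2"
      if "v1 \<in> carrier_vec n1" "v2 \<in> carrier_vec n2" "v3 \<in> carrier_vec n3" for v1 v2 v3
    proof -
      note c1 = mult_mat_vec_carrier[OF mult_carrier_mat[OF G received_carrier(1)] that(1), of 1 3]
      note c2 = mult_mat_vec_carrier[OF mult_carrier_mat[OF G received_carrier(2)] that(2), of 2 3]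
      note c3 = mult_mat_vec_carrier[OF mult_carrier_mat[OF G received_carrier(3)] that(3), of 3 3]
      show ?thesis unfolding comm_add_vec[OF add_carrier_vec[OF c1 c2] c3] assoc_add_vec[OF c3 c1 c2] ..
    qed
    then show ?thesis by auto
  qed
  note swap = this
  have eqs: "((3::nat) = 1) = False" "((3::nat) = 2) = False" by simp_all
  show ?thesis
    unfolding recoverable_iff ndim_def eqs if_False
    by (intro bex_cong refl) (simp only: swap decoder_iff[OF _ received_carrier(3,1,2)] simp_thms)
qed

lemma aligned_at_receiver:
  "Mmat N x n 3 2 * V3 = Mmat N x n 1 2 * V1 * tag_mat 5 x n1 n3"
  "Mmat N x n 2 3 * V2 = Mmat N x n 1 3 * V1 * tag_mat 4 x n1 n2"
proof -
  have *: "M * (minv M * E * W * C) = E * W * C"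
    if M: "M \<in> carrier_mat n n" "det M \<noteq> 0" and E: "E \<in> carrier_mat n n" and W: "W \<in> carrier_mat n n1"
      and C: "C \<in> carrier_mat n1 k" for M E W C :: "'r mat" and k
  proof -
    note mM = minv[OF M]
    have EW: "E * W \<in> carrier_mat n n1" by (rule mult_carrier_mat[OF E W])
    have EWC: "E * W * C \<in> carrier_mat n k" by (rule mult_carrier_mat[OF EW C])
    have "minv M * E * W * C = minv M * (E * W * C)"
      unfolding assoc_mult_mat[OF mM(1) E W] assoc_mult_mat[OF mM(1) EW C] ..
    then have "M * (minv M * E * W * C) = M * minv M * (E * W * C)"
      using assoc_mult_mat[OF M(1) mM(1) EWC] by simp
    also have "\<dots> = E * W * C" unfolding mM(2) by (rule left_mult_one_mat[OF EWC])
    finally show ?thesis .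
  qed
  show "Mmat N x n 3 2 * V3 = Mmat N x n 1 2 * V1 * tag_mat 5 x n1 n3"
    by (rule *[OF Mmat_carrier D(2) Mmat_carrier tag_mat_carrier tag_mat_carrier])
  show "Mmat N x n 2 3 * V2 = Mmat N x n 1 3 * V1 * tag_mat 4 x n1 n2"
    by (rule *[OF Mmat_carrier D(1) Mmat_carrier tag_mat_carrier tag_mat_carrier])
qed

end

lemma jinj_imp_recoverable:
  fixes x :: "var \<Rightarrow> 'r::field"
  assumes zero: "Mmat N x n 2 1 = 0\<^sub>m n n"
    and D: "det (Mmat N x n 2 3) \<noteq> 0" "det (Mmat N x n 3 2) \<noteq> 0"
    and J: "jinj (wanted N x n n1 1) (aligned N x n n1 5 n3 3 1 2)"
      "jinj (wanted N x n n1 2) (aligned N x n n1 4 n2 2 2 3)"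
      "jinj (wanted N x n n1 3) (aligned N x n n1 5 n3 3 3 2)"
  shows "\<forall>j\<in>{1,2,3}. recoverable N x n n1 n2 n3 j"
proof -
  let ?V1 = "tag_mat 3 x n n1"
  let ?V2 = "minv (Mmat N x n 2 3) * Mmat N x n 1 3 * ?V1 * tag_mat 4 x n1 n2"
  let ?V3 = "minv (Mmat N x n 3 2) * Mmat N x n 1 2 * ?V1 * tag_mat 5 x n1 n3"
  note car = received_carrier[OF D]
  have "recoverable N x n n1 n2 n3 1"
  proof -
    have "jinj (Mmat N x n 1 1 * ?V1) (Mmat N x n 3 1 * ?V3)" using J(1) unfolding jinj_received_iff[OF D(2)] .
    from jinj_left_inverse[OF car(1,3) this] obtain G where G: "G \<in> carrier_mat n1 n"
      "G * (Mmat N x n 1 1 * ?V1) = 1\<^sub>m n1" "G * (Mmat N x n 3 1 * ?V3) = 0\<^sub>m n1 n3" by (elim bexE conjE)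
    moreover have "Mmat N x n 2 1 * ?V2 = 0\<^sub>m n n2"
      unfolding zero by (rule left_mult_zero_mat[OF precoder_carrier[OF D(1)]])
    then have "G * (Mmat N x n 2 1 * ?V2) = 0\<^sub>m n1 n2" using right_mult_zero_mat[OF G(1), of n2] by simp
    ultimately show ?thesis unfolding recoverable_1_iff[OF D] by (intro bexI[of _ G] conjI)
  qed
  moreover have "recoverable N x n n1 n2 n3 2"
  proof -
    have "jinj (Mmat N x n 1 2 * ?V1) (Mmat N x n 2 2 * ?V2)" using J(2) unfolding jinj_received_iff[OF D(1)] .
    then have "jinj (Mmat N x n 2 2 * ?V2) (Mmat N x n 1 2 * ?V1)" by (rule jinj_commute[OF car(1,2), THEN iffD1])
    from jinj_left_inverse[OF car(2,1) this] obtain G where G: "G \<in> carrier_mat n2 n"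
      "G * (Mmat N x n 2 2 * ?V2) = 1\<^sub>m n2" "G * (Mmat N x n 1 2 * ?V1) = 0\<^sub>m n2 n1" by (elim bexE conjE)
    moreover have "G * (Mmat N x n 3 2 * ?V3) = 0\<^sub>m n2 n3"
      unfolding aligned_at_receiver(1)[OF D] assoc_mult_mat[OF G(1) car(1) tag_mat_carrier, symmetric] G(3)
      by (rule left_mult_zero_mat[OF tag_mat_carrier])
    ultimately show ?thesis unfolding recoverable_2_iff[OF D] by (intro bexI[of _ G] conjI)
  qed
  moreover have "recoverable N x n n1 n2 n3 3"
  proof -
    have "jinj (Mmat N x n 1 3 * ?V1) (Mmat N x n 3 3 * ?V3)" using J(3) unfolding jinj_received_iff[OF D(2)] .
    then have "jinj (Mmat N x n 3 3 * ?V3) (Mmat N x n 1 3 * ?V1)" by (rule jinj_commute[OF car(1,3), THEN iffD1])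
    from jinj_left_inverse[OF car(3,1) this] obtain G where G: "G \<in> carrier_mat n3 n"
      "G * (Mmat N x n 3 3 * ?V3) = 1\<^sub>m n3" "G * (Mmat N x n 1 3 * ?V1) = 0\<^sub>m n3 n1" by (elim bexE conjE)
    moreover have "G * (Mmat N x n 2 3 * ?V2) = 0\<^sub>m n3 n2"
      unfolding aligned_at_receiver(2)[OF D] assoc_mult_mat[OF G(1) car(1) tag_mat_carrier, symmetric] G(3)
      by (rule left_mult_zero_mat[OF tag_mat_carrier])
    ultimately show ?thesis unfolding recoverable_3_iff[OF D] by (intro bexI[of _ G] conjI)
  qed
  ultimately show ?thesis by simp
qed

section \<open>The two directions of the theorem\<close>

theorem theorem6:
  fixes N :: "'v net" and n n1 n2 n3 :: nat
  assumes dag: "finite_dag N"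
    and n_gt: "n > dmax N"
    and dims: "0 < n3" "n3 \<le> n2" "n2 \<le> n1" "n1 \<le> n"
    and cut_diag: "\<forall>i \<in> {1,2,3}. mincut N (src N i) (dst N i) = 1"
    and cut_21: "mincut N (src N 2) (dst N 1) = 0"
    and cut_other: "\<forall>i \<in> {1,2,3}. \<forall>j \<in> {1,2,3}. (i, j) \<noteq> (2, 1) \<longrightarrow> mincut N (src N i) (dst N j) \<ge> 1"
  shows "(rank_conditions TYPE('p::prime_card) N n n1 n2 n3 \<longrightarrow>
            (\<exists>\<alpha> :: var \<Rightarrow> 'p mod_ring alg_closure. good_assignment N \<alpha> n n1 n2 n3))
       \<and> (n1 + n2 = n \<and> n1 + n3 = n \<and>
            (\<exists>\<alpha> :: var \<Rightarrow> 'p mod_ring alg_closure. good_assignment N \<alpha> n n1 n2 n3)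
            \<longrightarrow> rank_conditions TYPE('p) N n n1 n2 n3)"
proof -
  let ?K = "TYPE('p mod_ring alg_closure)"
  have path: "\<exists>es. is_path N (src N i) (dst N j) es"
    if "i \<in> {1,2,3}" "j \<in> {1,2,3}" "(i, j) \<noteq> (2, 1)" for i j
    using cut_other that by (intro mincut_pos_path) blast
  have zero21: "Mmat N x n 2 1 = 0\<^sub>m n n" for x :: "var \<Rightarrow> 'p mod_ring alg_closure"
    by (rule Mmat_no_path[OF dag]) (use mincut_zero_no_path[OF dag cut_21] in simp_all)
  have gen: "det (Mmat N (indet :: var \<Rightarrow> 'p ratfun) n i j) \<noteq> 0"
    and pol: "det (Mmat N (poly_var :: var \<Rightarrow> (var \<Rightarrow>\<^sub>0 nat) \<Rightarrow>\<^sub>0 'p mod_ring) n i j) \<noteq> 0"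
    if ij: "i \<in> {1,2,3}" "j \<in> {1,2,3}" "(i, j) \<noteq> (2, 1)" for i j
  proof -
    obtain es where es: "is_path N (src N i) (dst N j) es" using path[OF ij] by (elim exE)
    show "det (Mmat N (indet :: var \<Rightarrow> 'p ratfun) n i j) \<noteq> 0"
      by (rule det_Mmat_indet_nonzero[OF dag ij(1,2) n_gt es])
    show "det (Mmat N (poly_var :: var \<Rightarrow> (var \<Rightarrow>\<^sub>0 nat) \<Rightarrow>\<^sub>0 'p mod_ring) n i j) \<noteq> 0"
      by (rule det_Mmat_poly_var_nonzero[OF dag ij(1,2) n_gt es])
  qed
  have gens: "det (Mmat N (indet :: var \<Rightarrow> 'p ratfun) n 2 3) \<noteq> 0" "det (Mmat N (indet :: var \<Rightarrow> 'p ratfun) n 3 2) \<noteq> 0"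
    "det (Mmat N (indet :: var \<Rightarrow> 'p ratfun) n 1 1) \<noteq> 0" "det (Mmat N (indet :: var \<Rightarrow> 'p ratfun) n 1 2) \<noteq> 0"
    "det (Mmat N (indet :: var \<Rightarrow> 'p ratfun) n 1 3) \<noteq> 0"
    by (rule gen; simp)+
  have inv_iff: "invertible_mat (Mmat N x n i j) \<longleftrightarrow> det (Mmat N x n i j) \<noteq> 0"
    for x :: "var \<Rightarrow> 'p mod_ring alg_closure" and i j
    by (rule invertible_mat_iff_det[OF Mmat_carrier])
  have suff: "\<exists>\<alpha> :: var \<Rightarrow> 'p mod_ring alg_closure. good_assignment N \<alpha> n n1 n2 n3"
    if rc: "rank_conditions TYPE('p) N n n1 n2 n3"
  proof -
    note J = rank_conditions_imp_jinj[OF gens rc]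
    obtain d1 :: "(var \<Rightarrow>\<^sub>0 nat) \<Rightarrow>\<^sub>0 'p mod_ring" where d1: "d1 \<noteq> 0" "\<forall>\<alpha>. ac_eval \<alpha> d1 \<noteq> 0 \<longrightarrow>
        jinj (wanted N \<alpha> n n1 1) (aligned N \<alpha> n n1 5 n3 3 1 2)"
      using jinj_indet_imp_jinj_at_points[OF J(1)] by (elim exE conjE)
    obtain d2 :: "(var \<Rightarrow>\<^sub>0 nat) \<Rightarrow>\<^sub>0 'p mod_ring" where d2: "d2 \<noteq> 0" "\<forall>\<alpha>. ac_eval \<alpha> d2 \<noteq> 0 \<longrightarrow>
        jinj (wanted N \<alpha> n n1 2) (aligned N \<alpha> n n1 4 n2 2 2 3)"
      using jinj_indet_imp_jinj_at_points[OF J(2)] by (elim exE conjE)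
    obtain d3 :: "(var \<Rightarrow>\<^sub>0 nat) \<Rightarrow>\<^sub>0 'p mod_ring" where d3: "d3 \<noteq> 0" "\<forall>\<alpha>. ac_eval \<alpha> d3 \<noteq> 0 \<longrightarrow>
        jinj (wanted N \<alpha> n n1 3) (aligned N \<alpha> n n1 5 n3 3 3 2)"
      using jinj_indet_imp_jinj_at_points[OF J(3)] by (elim exE conjE)
    let ?e23 = "det (Mmat N (poly_var :: var \<Rightarrow> (var \<Rightarrow>\<^sub>0 nat) \<Rightarrow>\<^sub>0 'p mod_ring) n 2 3)"
    let ?e32 = "det (Mmat N (poly_var :: var \<Rightarrow> (var \<Rightarrow>\<^sub>0 nat) \<Rightarrow>\<^sub>0 'p mod_ring) n 3 2)"
    have "?e23 \<noteq> 0" "?e32 \<noteq> 0" by (rule pol; simp)+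
    \<comment> \<open>A single point has to satisfy all three conditions and also keep both
      precoders defined; a nonzero of the product of the five polynomials does this.\<close>
    then have "d1 * d2 * d3 * ?e23 * ?e32 \<noteq> 0" using d1(1) d2(1) d3(1) by simp
    then obtain \<alpha> where "ac_eval \<alpha> (d1 * d2 * d3 * ?e23 * ?e32) \<noteq> 0" using ac_eval_nonzero by blast
    then have nz: "ac_eval \<alpha> d1 \<noteq> 0" "ac_eval \<alpha> d2 \<noteq> 0" "ac_eval \<alpha> d3 \<noteq> 0"
      and D: "det (Mmat N \<alpha> n 2 3) \<noteq> 0" "det (Mmat N \<alpha> n 3 2) \<noteq> 0"
      unfolding det_Mmat_eval by (auto simp: ac_eval_mult)
    have "\<forall>j\<in>{1,2,3}. recoverable N \<alpha> n n1 n2 n3 j"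
      using jinj_imp_recoverable[OF zero21 D] d1(2) d2(2) d3(2) nz by simp
    then show ?thesis unfolding good_assignment_def inv_iff using D by blast
  qed
  have nec: "rank_conditions TYPE('p) N n n1 n2 n3"
    if dim: "n1 + n2 = n" "n1 + n3 = n" and good: "good_assignment N \<alpha> n n1 n2 n3"
    for \<alpha> :: "var \<Rightarrow> 'p mod_ring alg_closure"
  proof -
    have D: "det (Mmat N \<alpha> n 2 3) \<noteq> 0" "det (Mmat N \<alpha> n 3 2) \<noteq> 0"
      and rec: "recoverable N \<alpha> n n1 n2 n3 1" "recoverable N \<alpha> n n1 n2 n3 2" "recoverable N \<alpha> n n1 n2 n3 3"
      using good unfolding good_assignment_def inv_iff by simp_all
    let ?V = "tag_mat 3 \<alpha> n n1"
    let ?V2 = "minv (Mmat N \<alpha> n 2 3) * Mmat N \<alpha> n 1 3 * ?V * tag_mat 4 \<alpha> n1 n2"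
    let ?V3 = "minv (Mmat N \<alpha> n 3 2) * Mmat N \<alpha> n 1 2 * ?V * tag_mat 5 \<alpha> n1 n3"
    obtain G1 where G1: "G1 \<in> carrier_mat n1 n" "G1 * (Mmat N \<alpha> n 1 1 * ?V) = 1\<^sub>m n1"
      "G1 * (Mmat N \<alpha> n 3 1 * ?V3) = 0\<^sub>m n1 n3"
      using rec(1) unfolding recoverable_1_iff[OF D] by (elim bexE conjE)
    obtain G2 where G2: "G2 \<in> carrier_mat n2 n" "G2 * (Mmat N \<alpha> n 2 2 * ?V2) = 1\<^sub>m n2"
      "G2 * (Mmat N \<alpha> n 1 2 * ?V) = 0\<^sub>m n2 n1"
      using rec(2) unfolding recoverable_2_iff[OF D] by (elim bexE conjE)
    obtain G3 where G3: "G3 \<in> carrier_mat n3 n" "G3 * (Mmat N \<alpha> n 3 3 * ?V3) = 1\<^sub>m n3"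
      "G3 * (Mmat N \<alpha> n 1 3 * ?V) = 0\<^sub>m n3 n1"
      using rec(3) unfolding recoverable_3_iff[OF D] by (elim bexE conjE)
    have VC: "?V * tag_mat g \<alpha> n1 k \<in> carrier_mat n k" for g k
      by (rule mult_carrier_mat[OF tag_mat_carrier tag_mat_carrier])
    have sq: "net_square ?K N n n1 k a b b'"
      if "a \<in> {2,3}" "b \<in> {1,2,3}" "b' \<in> {1,2,3}" "b \<noteq> b'" "(a, b) \<noteq> (2, 1)" "(a, b') \<noteq> (2, 1)"
        "n = n1 + k" "k \<le> n1" "0 < k" for k a b b'
    proof (rule net_square.intro[OF infinite_alg_closure dag n_gt that(1-4,7-9)])
      show "\<exists>es. is_path N (src N 1) (dst N b) es" by (rule path) (use that in simp_all)
      show "\<exists>es. is_path N (src N a) (dst N b) es" by (rule path) (use that in auto)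
      show "\<exists>es. is_path N (src N a) (dst N b') es" by (rule path) (use that in auto)
      show "\<exists>es. is_path N (src N 1) (dst N b') es" by (rule path) (use that in simp_all)
    qed
    have J1: "jinj (wanted N (indet :: var \<Rightarrow> 'p ratfun) n n1 1) (aligned N indet n n1 5 n3 3 1 2)"
    proof (rule jinj_generic_if_no_low_rank[OF sq])
      fix c :: "'p mod_ring alg_closure" assume c: "c \<noteq> 0"
      \<comment> \<open>Recovery at T_1 yields an identity on the left of
        \<open>tag_mat 5 \<alpha> n1 n3\<close>, so a left inverse of that matrix is needed to
        obtain a minor of size \<open>n3\<close>. Recovery at T_3 provides it: V_3 has this matrix
        as its right factor, and \<open>H\<close> collects all the other factors of the identity
        decoded there. The rows of the minor are then \<open>H * G1\<close>.\<close>
      define H where "H = G3 * Mmat N \<alpha> n 3 3 * (minv (Mmat N \<alpha> n 3 2) * Mmat N \<alpha> n 1 2) * ?V"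
      have mc: "minv (Mmat N \<alpha> n 3 2) * Mmat N \<alpha> n 1 2 \<in> carrier_mat n n"
        by (rule mult_carrier_mat[OF minv(1)[OF Mmat_carrier D(2)] Mmat_carrier])
      have GM: "G3 * Mmat N \<alpha> n 3 3 \<in> carrier_mat n3 n" by (rule mult_carrier_mat[OF G3(1) Mmat_carrier])
      have V3: "?V3 \<in> carrier_mat n n3" by (rule precoder_carrier[OF D(2)])
      have H: "H \<in> carrier_mat n3 n1"
        unfolding H_def by (rule mult_carrier_mat[OF mult_carrier_mat[OF GM mc] tag_mat_carrier])
      have "H * tag_mat 5 \<alpha> n1 n3 = G3 * Mmat N \<alpha> n 3 3 * ?V3"
        unfolding H_def assoc_mult_mat[OF GM mc tag_mat_carrier]
          assoc_mult_mat[OF GM mult_carrier_mat[OF mc tag_mat_carrier] tag_mat_carrier] ..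
      also have "\<dots> = 1\<^sub>m n3" unfolding assoc_mult_mat[OF G3(1) Mmat_carrier V3] by (rule G3(2))
      finally have HB: "H * tag_mat 5 \<alpha> n1 n3 = 1\<^sub>m n3" .
      have HG: "H * G1 \<in> carrier_mat n3 n" by (rule mult_carrier_mat[OF H G1(1)])
      have "H * G1 * (Mmat N \<alpha> n 3 1 * ?V3) = 0\<^sub>m n3 n3"
        unfolding assoc_mult_mat[OF H G1(1) mult_carrier_mat[OF Mmat_carrier V3]] G1(3)
        by (rule right_mult_zero_mat[OF H])
      moreover have "H * G1 * (Mmat N \<alpha> n 1 1 * ?V) * tag_mat 5 \<alpha> n1 n3 = 1\<^sub>m n3"
        unfolding assoc_mult_mat[OF H G1(1) mult_carrier_mat[OF Mmat_carrier tag_mat_carrier]] G1(2)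
          right_mult_one_mat[OF H] by (rule HB)
      ultimately have "det (H * G1 * pencil (Mmat N \<alpha> n 1 1) (Mmat N \<alpha> n 3 1) (Mmat N \<alpha> n 3 2) (Mmat N \<alpha> n 1 2) c
          * (?V * tag_mat 5 \<alpha> n1 n3)) \<noteq> 0"
        by (rule pencil_minor_interference[OF HG Mmat_carrier Mmat_carrier Mmat_carrier Mmat_carrier
              tag_mat_carrier tag_mat_carrier D(2) c])
      then show "\<exists>\<alpha> :: var \<Rightarrow> 'p mod_ring alg_closure. \<exists>R\<in>carrier_mat n3 n. \<exists>C\<in>carrier_mat n n3.
          det (R * pencil (Mmat N \<alpha> n 1 1) (Mmat N \<alpha> n 3 1) (Mmat N \<alpha> n 3 2) (Mmat N \<alpha> n 1 2) c * C) \<noteq> 0"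
        by (intro exI[of _ \<alpha>] bexI[OF _ HG] bexI[OF _ VC])
    qed (use dim dims in simp_all)
    have J2: "jinj (wanted N (indet :: var \<Rightarrow> 'p ratfun) n n1 2) (aligned N indet n n1 4 n2 2 2 3)"
    proof (rule jinj_generic_if_no_low_rank[OF sq])
      fix c :: "'p mod_ring alg_closure" assume c: "c \<noteq> 0"
      \<comment> \<open>The same test matrix, V1 times the matrix with tag 4, works for every
        scalar, because \<open>G2\<close> annihilates the signal of S_1 that the scalar
        multiplies.\<close>
      have "det (G2 * pencil (Mmat N \<alpha> n 1 2) (Mmat N \<alpha> n 2 2) (Mmat N \<alpha> n 2 3) (Mmat N \<alpha> n 1 3) c
          * (?V * tag_mat 4 \<alpha> n1 n2)) \<noteq> 0"
        by (rule pencil_minor_wanted[OF G2(1) Mmat_carrier Mmat_carrier Mmat_carrier Mmat_carrier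
              tag_mat_carrier tag_mat_carrier D(1) G2(2,3)])
      then show "\<exists>\<alpha> :: var \<Rightarrow> 'p mod_ring alg_closure. \<exists>R\<in>carrier_mat n2 n. \<exists>C\<in>carrier_mat n n2.
          det (R * pencil (Mmat N \<alpha> n 1 2) (Mmat N \<alpha> n 2 2) (Mmat N \<alpha> n 2 3) (Mmat N \<alpha> n 1 3) c * C) \<noteq> 0"
        by (intro exI[of _ \<alpha>] bexI[OF _ G2(1)] bexI[OF _ VC])
    qed (use dim dims in simp_all)
    have J3: "jinj (wanted N (indet :: var \<Rightarrow> 'p ratfun) n n1 3) (aligned N indet n n1 5 n3 3 3 2)"
    proof (rule jinj_generic_if_no_low_rank[OF sq])
      fix c :: "'p mod_ring alg_closure" assume c: "c \<noteq> 0"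
      have "det (G3 * pencil (Mmat N \<alpha> n 1 3) (Mmat N \<alpha> n 3 3) (Mmat N \<alpha> n 3 2) (Mmat N \<alpha> n 1 2) c
          * (?V * tag_mat 5 \<alpha> n1 n3)) \<noteq> 0"
        by (rule pencil_minor_wanted[OF G3(1) Mmat_carrier Mmat_carrier Mmat_carrier Mmat_carrier
              tag_mat_carrier tag_mat_carrier D(2) G3(2,3)])
      then show "\<exists>\<alpha> :: var \<Rightarrow> 'p mod_ring alg_closure. \<exists>R\<in>carrier_mat n3 n. \<exists>C\<in>carrier_mat n n3.
          det (R * pencil (Mmat N \<alpha> n 1 3) (Mmat N \<alpha> n 3 3) (Mmat N \<alpha> n 3 2) (Mmat N \<alpha> n 1 2) c * C) \<noteq> 0"
        by (intro exI[of _ \<alpha>] bexI[OF _ G3(1)] bexI[OF _ VC])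
    qed (use dim dims in simp_all)
    show ?thesis by (rule jinj_imp_rank_conditions[OF gens dim J1 J2 J3])
  qed
  show ?thesis using suff nec by blast
qed

end
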